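(* Let $G$ be a locally compact group and let $\mathbb F$ be $\mathbb R$ or $\mathbb C$. Then the left regular representation $\pi:\mathrm{M}(G,\mathbb F)\to\mathrm{L}_{\mathrm r}(\mathrm{M}(G,\mathbb F))$, given by $\pi(\mu)\nu=\mu\star\nu$, is an isometric Banach lattice algebra homomorphism (a complex Banach lattice algebra homomorphism if $\mathbb F=\mathbb C$).
   Context: Locally compact groups are Hausdorff. $\mathrm{M}(G,\mathbb R)$ (resp. $\mathrm{M}(G,\mathbb C)$) is the space of finite real-valued (resp. complex-valued) regular Borel measures on $G$, with the norm $\|\mu\|=|\mu|(G)$ ($|\mu|$ the total variation measure) and the convolution product $\langle\mu\star\nu,f\rangle=\int_G\int_G f(st)\,d\mu(s)\,d\nu(t)$ for continuous $f$ on $G$ vanishing at infinity. $\mathrm{M}(G,\mathbb R)$, ordered by $\mu\ge\nu$ iff $\mu(A)\ge\nu(A)$ for all Borel sets $A$, is a Dedekind complete Banach lattice and a Banach algebra in which the product of positive elements is positive (a Banach lattice algebra); $\mathrm{M}(G,\mathbb C)$ is its complexification. For a Dedekind complete Banach lattice $E$, $\mathrm{L}_{\mathrm r}(E)$ is the space of regular operators on $E$ (differences of two positive linear operators), ordered by $S\ge T$ iff $Sx\ge Tx$ for all $x\ge0$. It is a Dedekind complete Banach lattice algebra under the regular norm $\|T\|_{\mathrm r}=\|\,|T|\,\|$ (operator norm of the modulus of $T$ in $\mathrm{L}_{\mathrm r}(E)$). The complexification $E_{\mathbb C}$ of a Banach lattice $E$ has modulus $|x+iy|_{\mathbb C}=\sup\{x\cos\theta+y\sin\theta:0\le\theta\le2\pi\}\in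 E$ and norm $\|z\|_{\mathbb C}=\|\,|z|_{\mathbb C}\|$. $\mathrm{L}_{\mathrm r}(E_{\mathbb C})$ is the space of complex-linear operators $S_1+iS_2$ with $S_1,S_2\in\mathrm{L}_{\mathrm r}(E)$; it is identified with the complexification of $\mathrm{L}_{\mathrm r}(E)$, with the corresponding modulus and norm. A Banach lattice algebra homomorphism is a continuous algebra homomorphism $\pi$ between Banach lattice algebras that is also a lattice homomorphism ($|\pi(a)|=\pi(|a|)$ for all $a$). A complex Banach lattice algebra homomorphism is a continuous complex algebra homomorphism between complexifications of Banach lattice algebras with $|\pi(z)|_{\mathbb C}=\pi(|z|_{\mathbb C})$ for all $z$. *)

theory Defs
  imports "HOL-Analysis.Analysis"
begin

section \<open>Regular Borel measures with values in a normed space\<close>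

text \<open>The total variation of a set function, as a supremum over finite Borel partitions of \<open>A\<close>
  (it is \<open>0\<close> if \<open>A\<close> is not a Borel set).\<close>

definition variation :: "('g::topological_space set \<Rightarrow> 'v::real_normed_vector) \<Rightarrow> 'g set \<Rightarrow> ennreal" where
  "variation m A =
     (SUP P \<in> {P. finite P \<and> disjoint P \<and> P \<subseteq> sets borel \<and> \<Union>P = A}. \<Sum>B\<in>P. ennreal (norm (m B)))"

definition borel_countably_additive :: "('g::topological_space set \<Rightarrow> 'v::real_normed_vector) \<Rightarrow> bool" where
  "borel_countably_additive m \<longleftrightarrow>
     (\<forall>A :: nat \<Rightarrow> 'g set. range A \<subseteq> sets borel \<longrightarrow> disjoint_family A \<longrightarrow>
        (\<lambda>i. m (A i)) sums m (\<Union>i. A i))"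

definition regular_variation :: "('g::topological_space set \<Rightarrow> 'v::real_normed_vector) \<Rightarrow> bool" where
  "regular_variation m \<longleftrightarrow>
     (\<forall>A \<in> sets borel.
        variation m A = (INF U \<in> {U. A \<subseteq> U \<and> open U}. variation m U) \<and>
        variation m A = (SUP K \<in> {K. K \<subseteq> A \<and> compact K}. variation m K))"

text \<open>Set functions are normalised to be \<open>0\<close> off the Borel sets, so that equality of measures is
  equality of set functions.  For \<open>real\<close> and \<open>complex\<close> values the finiteness
  of the variation is automatic; it is listed because the definition is polymorphic.\<close>

definition is_rca :: "('g::topological_space set \<Rightarrow> 'v::real_normed_vector) \<Rightarrow> bool" where
  "is_rca m \<longleftrightarrow> (\<forall>A. A \<notin> sets borel \<longrightarrow> m A = 0) \<and> borel_countably_additive m \<and>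
     variation m UNIV < \<infinity> \<and> regular_variation m"

subsection \<open>Elementary properties of the variation\<close>

lemma bca_sums:
  assumes "borel_countably_additive m" "range A \<subseteq> sets borel" "disjoint_family A"
  shows "(\<lambda>i::nat. m (A i)) sums m (\<Union>i. A i)"
  using assms unfolding borel_countably_additive_def by blast

lemma bca_empty:
  assumes "borel_countably_additive m"
  shows "m {} = 0"
proof -
  have "(\<lambda>i::nat. m {}) sums m (\<Union>i::nat. {})"
    by (rule bca_sums[OF assms]) (auto simp: disjoint_family_on_def)
  then have "summable (\<lambda>i::nat. m {})"
    by (rule sums_summable)
  then show ?thesis
    by (simp add: summable_const_iff)
qed

lemma bca_Un:
  assumes m: "borel_countably_additive m" and AB: "A \<in> sets borel" "B \<in> sets borel" "A \<inter> B = {}"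
  shows "m (A \<union> B) = m A + m B"
proof -
  have "(\<lambda>i. m (binaryset A B i)) sums m (\<Union>i. binaryset A B i)"
    using AB by (intro bca_sums[OF m]) (auto simp: disjoint_family_on_def binaryset_def)
  moreover have "(\<lambda>i. m (binaryset A B i)) sums (m A + m B)"
    by (rule binaryset_sums) (rule bca_empty[OF m])
  ultimately show ?thesis
    by (metis UN_binaryset_eq sums_unique2)
qed

lemma variation_upper:
  assumes "finite P" "disjoint P" "P \<subseteq> sets borel" "\<Union>P = A"
  shows "(\<Sum>B\<in>P. ennreal (norm (m B))) \<le> variation m A"
  unfolding variation_def using assms by (intro SUP_upper) auto

lemma variation_least:
  assumes "\<And>P. finite P \<Longrightarrow> disjoint P \<Longrightarrow> P \<subseteq> sets borel \<Longrightarrow> \<Union>P = A \<Longrightarrow> (\<Sum>B\<in>P. ennreal (norm (m B))) \<le> c"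
  shows "variation m A \<le> c"
  unfolding variation_def using assms by (intro SUP_least) auto

lemma norm_le_variation:
  assumes "A \<in> sets borel"
  shows "ennreal (norm (m A)) \<le> variation m A"
  using variation_upper[of "{A}" A m] assms by (simp add: disjoint_def pairwise_def)

lemma variation_Un_le:
  assumes m: "borel_countably_additive m" and AB: "A \<in> sets borel" "B \<in> sets borel" "A \<inter> B = {}"
  shows "variation m (A \<union> B) \<le> variation m A + variation m B"
proof (rule variation_least)
  fix P assume P: "finite P" "disjoint P" "P \<subseteq> sets borel" "\<Union>P = A \<union> B"
  have part: "(\<Sum>C\<in>P. ennreal (norm (m (C \<inter> D)))) \<le> variation m D"
    if D: "D \<in> sets borel" "D \<subseteq> A \<union> B" for D
  proof -
    have "(\<Sum>C\<in>P. ennreal (norm (m (C \<inter> D)))) = (\<Sum>C\<in>(\<lambda>C. C \<inter> D) ` P. ennreal (norm (m C)))"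
    proof (subst sum.reindex_nontrivial)
      fix C C' assume C: "C \<in> P" "C' \<in> P" "C \<noteq> C'" "C \<inter> D = C' \<inter> D"
      then have "C \<inter> C' = {}"
        using P(2) by (auto simp: disjoint_def)
      with C have "C \<inter> D = {}" by blast
      then show "ennreal (norm (m (C \<inter> D))) = 0"
        using bca_empty[OF m] by simp
    qed (use P in auto)
    also have "\<dots> \<le> variation m D"
    proof (rule variation_upper)
      show "disjoint ((\<lambda>C. C \<inter> D) ` P)"
        using P(2) unfolding disjoint_def by blast
    qed (use P D in auto)
    finally show ?thesis .
  qed
  have "(\<Sum>C\<in>P. ennreal (norm (m C)))
      \<le> (\<Sum>C\<in>P. ennreal (norm (m (C \<inter> A))) + ennreal (norm (m (C \<inter> B))))"
  proof (rule sum_mono)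
    fix C assume C: "C \<in> P"
    have "C = (C \<inter> A) \<union> (C \<inter> B)" using C P by auto
    moreover have "m ((C \<inter> A) \<union> (C \<inter> B)) = m (C \<inter> A) + m (C \<inter> B)"
      using C P AB by (intro bca_Un[OF m]) auto
    ultimately have "norm (m C) \<le> norm (m (C \<inter> A)) + norm (m (C \<inter> B))"
      by (metis norm_triangle_ineq)
    then show "ennreal (norm (m C)) \<le> ennreal (norm (m (C \<inter> A))) + ennreal (norm (m (C \<inter> B)))"
      by (metis ennreal_leI ennreal_plus norm_ge_zero)
  qed
  also have "\<dots> \<le> variation m A + variation m B"
    unfolding sum.distrib using AB by (intro add_mono part) auto
  finally show "(\<Sum>C\<in>P. ennreal (norm (m C))) \<le> variation m A + variation m B" .
qed

lemma variation_mono: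
  assumes AB: "A \<in> sets borel" "B \<in> sets borel" "A \<subseteq> B"
  shows "variation m A \<le> variation m B"
proof (rule variation_least)
  fix P assume P: "finite P" "disjoint P" "P \<subseteq> sets borel" "\<Union>P = A"
  have "(\<Sum>C\<in>P. ennreal (norm (m C))) \<le> (\<Sum>C\<in>insert (B - A) P. ennreal (norm (m C)))"
    using P by (intro sum_mono2) auto
  also have "\<dots> \<le> variation m B"
  proof (rule variation_upper)
    show "disjoint (insert (B - A) P)"
      using P(2,4) unfolding disjoint_def by blast
  qed (use P AB in auto)
  finally show "(\<Sum>C\<in>P. ennreal (norm (m C))) \<le> variation m B" .
qed

lemma variation_le_combination:
  assumes "\<And>A. A \<in> sets borel \<Longrightarrow> ennreal (norm (l A)) \<le> c * (ennreal (norm (m A)) + ennreal (norm (n A)))"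
  shows "variation l A \<le> c * (variation m A + variation n A)"
proof (rule variation_least)
  fix P assume P: "finite P" "disjoint P" "P \<subseteq> sets borel" "\<Union>P = A"
  have "(\<Sum>C\<in>P. ennreal (norm (l C))) \<le> (\<Sum>C\<in>P. c * (ennreal (norm (m C)) + ennreal (norm (n C))))"
    using P assms by (intro sum_mono) auto
  also have "\<dots> = c * ((\<Sum>C\<in>P. ennreal (norm (m C))) + (\<Sum>C\<in>P. ennreal (norm (n C))))"
    by (simp add: sum_distrib_left sum.distrib distrib_left del: sum_ennreal)
  also have "\<dots> \<le> c * (variation m A + variation n A)"
    using P by (intro mult_left_mono add_mono variation_upper) auto
  finally show "(\<Sum>C\<in>P. ennreal (norm (l C))) \<le> c * (variation m A + variation n A)" .
qed

lemma variation_add_le: "variation (\<lambda>A. m A + n A) A \<le> variation m A + variation n A"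
proof -
  have "variation (\<lambda>A. m A + n A) A \<le> 1 * (variation m A + variation n A)"
    by (rule variation_le_combination)
       (metis ennreal_leI ennreal_plus mult_1 norm_ge_zero norm_triangle_ineq)
  then show ?thesis by simp
qed

lemma variation_bounded_linear_le:
  assumes "\<And>x. norm (h x) \<le> K * norm x" "0 \<le> K"
  shows "variation (\<lambda>A. h (m A)) A \<le> ennreal K * variation m A"
proof (rule variation_least)
  fix P assume P: "finite P" "disjoint P" "P \<subseteq> sets borel" "\<Union>P = A"
  have "(\<Sum>C\<in>P. ennreal (norm (h (m C)))) \<le> (\<Sum>C\<in>P. ennreal K * ennreal (norm (m C)))"
    using assms by (intro sum_mono) (auto simp flip: ennreal_mult'' intro!: ennreal_leI)
  also have "\<dots> \<le> ennreal K * variation m A"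
    using variation_upper[OF P, of m] by (simp flip: sum_distrib_left add: mult_left_mono)
  finally show "(\<Sum>C\<in>P. ennreal (norm (h (m C)))) \<le> ennreal K * variation m A" .
qed

lemma regular_approx:
  fixes m :: "'g::t2_space set \<Rightarrow> 'v::real_normed_vector"
  assumes m: "is_rca m" and A: "A \<in> sets borel" and e: "0 < e"
  obtains K U where "compact K" "open U" "K \<subseteq> A" "A \<subseteq> U"
    "variation m A \<le> variation m K + ennreal e" "variation m U \<le> variation m A + ennreal e"
proof -
  have fin: "variation m A \<noteq> \<infinity>"
    using variation_mono[OF A, of UNIV m] m unfolding is_rca_def by (auto simp: top_unique)
  have U: "variation m A = (INF U \<in> {U. A \<subseteq> U \<and> open U}. variation m U)"
   and K: "variation m A = (SUP K \<in> {K. K \<subseteq> A \<and> compact K}. variation m K)"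
    using m A unfolding is_rca_def regular_variation_def by blast+
  have "\<exists>U\<in>{U. A \<subseteq> U \<and> open U}. variation m U < variation m A + ennreal e"
    using fin e unfolding INF_less_iff[symmetric] U[symmetric]
    by (metis add.right_neutral ennreal_add_left_cancel_less ennreal_less_zero_iff infinity_ennreal_def)
  moreover have "\<exists>K\<in>{K. K \<subseteq> A \<and> compact K}. variation m A \<le> variation m K + ennreal e"
  proof (cases "variation m A = 0")
    case True
    then show ?thesis by (intro bexI[of _ "{}"]) auto
  next
    case False
    then have "variation m A - ennreal e < variation m A"
      using fin e by (intro ennreal_between) (auto simp: less_top zero_less_iff_neq_zero)
    then have "\<exists>K\<in>{K. K \<subseteq> A \<and> compact K}. variation m A - ennreal e < variation m K"
      unfolding less_SUP_iff[symmetric] K[symmetric] .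
    then show ?thesis
      by (metis add.commute ennreal_minus_le_iff less_imp_le)
  qed
  ultimately show thesis
    using that by force
qed

lemma variation_diff:
  assumes m: "borel_countably_additive m" and AB: "A \<in> sets borel" "B \<in> sets borel" "A \<subseteq> B"
  shows "variation m A + variation m (B - A) = variation m B"
proof (rule antisym)
  let ?\<P> = "\<lambda>A. {P. finite P \<and> disjoint P \<and> P \<subseteq> sets borel \<and> \<Union>P = A}"
  let ?s = "\<lambda>P. \<Sum>C\<in>P. ennreal (norm (m C))"
  have ne: "?\<P> A \<noteq> {}" if "A \<in> sets borel" for A
    using that by (auto intro!: exI[of _ "{A}"] simp: disjoint_def pairwise_def)
  have *: "?s P + ?s Q \<le> variation m B" if P: "P \<in> ?\<P> A" and Q: "Q \<in> ?\<P> (B - A)" for P Q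
  proof -
    have "P \<inter> Q \<subseteq> {{}}" using P Q by blast
    then have "?s (P \<inter> Q) = 0"
      using bca_empty[OF m] by (intro sum.neutral) auto
    then have "?s P + ?s Q = ?s (P \<union> Q)"
      using sum.union_inter[of P Q "\<lambda>C. ennreal (norm (m C))"] P Q by simp
    also have "\<dots> \<le> variation m B"
    proof (rule variation_upper)
      show "disjoint (P \<union> Q)"
        using P Q by (intro disjoint_union) auto
      show "\<Union>(P \<union> Q) = B" using P Q AB(3) by auto
    qed (use P Q in auto)
    finally show ?thesis .
  qed
  have "variation m A + variation m (B - A) = (SUP P\<in>?\<P> A. SUP Q\<in>?\<P> (B - A). ?s P + ?s Q)"
    unfolding variation_def
    by (subst ennreal_SUP_add_left[OF ne[OF AB(1)], symmetric],
        subst ennreal_SUP_add_right[OF ne, symmetric]) (use AB in auto)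
  also have "\<dots> \<le> variation m B"
    by (intro SUP_least *) auto
  finally show "variation m A + variation m (B - A) \<le> variation m B" .
  show "variation m B \<le> variation m A + variation m (B - A)"
    using variation_Un_le[OF m, of A "B - A"] AB by (simp add: Un_absorb1)
qed

lemma is_rca_variation_finite:
  assumes m: "is_rca m" and A: "A \<in> sets borel"
  shows "variation m A < \<infinity>"
  using variation_mono[OF A, of UNIV m] m unfolding is_rca_def by (auto simp: top_unique less_top)

lemma is_rca_dominated:
  fixes l :: "'g::t2_space set \<Rightarrow> 'u::real_normed_vector"
    and m :: "'g set \<Rightarrow> 'v::real_normed_vector" and n :: "'g set \<Rightarrow> 'w::real_normed_vector"
  assumes m: "is_rca m" and n: "is_rca n" and c: "0 \<le> c"
    and l0: "\<And>A. A \<notin> sets borel \<Longrightarrow> l A = 0" and l: "borel_countably_additive l"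
    and dom: "\<And>A. A \<in> sets borel \<Longrightarrow> variation l A \<le> ennreal c * (variation m A + variation n A)"
  shows "is_rca l"
proof -
  have bm: "borel_countably_additive m" and bn: "borel_countably_additive n"
    using m n unfolding is_rca_def by auto
  have gap: "variation l (B - A) \<le> ennreal (c * (d + d))"
    if "A \<in> sets borel" "B \<in> sets borel" "A \<subseteq> B" "0 \<le> d"
      "variation m B \<le> variation m A + ennreal d" "variation n B \<le> variation n A + ennreal d" for A B d
  proof -
    have "variation m A + variation m (B - A) \<le> variation m A + ennreal d"
      using variation_diff[OF bm that(1-3)] that by simp
    then have 1: "variation m (B - A) \<le> ennreal d"
      using is_rca_variation_finite[OF m that(1)] by (auto simp: ennreal_add_left_cancel_le)
    have "variation n A + variation n (B - A) \<le> variation n A + ennreal d"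
      using variation_diff[OF bn that(1-3)] that by simp
    then have 2: "variation n (B - A) \<le> ennreal d"
      using is_rca_variation_finite[OF n that(1)] by (auto simp: ennreal_add_left_cancel_le)
    have "variation l (B - A) \<le> ennreal c * (variation m (B - A) + variation n (B - A))"
      using that by (intro dom) auto
    also have "\<dots> \<le> ennreal c * (ennreal d + ennreal d)"
      by (intro mult_left_mono add_mono 1 2) auto
    also have "\<dots> = ennreal (c * (d + d))"
      using c that(4) by (simp add: ennreal_mult ennreal_plus[symmetric] del: ennreal_plus)
    finally show ?thesis .
  qed
  have approx: "\<exists>K U. compact K \<and> open U \<and> K \<subseteq> A \<and> A \<subseteq> U \<and>
      variation l U \<le> variation l A + ennreal e \<and> variation l A \<le> variation l K + ennreal e"
    if A: "A \<in> sets borel" and e: "0 < e" for A e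
  proof -
    define d where "d = e / (2 * c + 1)"
    have "d * (2 * c + 1) = e" "0 < d"
      using e c by (auto simp: d_def)
    then have d: "0 < d" "c * (d + d) \<le> e"
      by (simp_all add: algebra_simps)
    obtain K1 U1 where 1: "compact K1" "open U1" "K1 \<subseteq> A" "A \<subseteq> U1"
      "variation m A \<le> variation m K1 + ennreal d" "variation m U1 \<le> variation m A + ennreal d"
      by (rule regular_approx[OF m A d(1)])
    obtain K2 U2 where 2: "compact K2" "open U2" "K2 \<subseteq> A" "A \<subseteq> U2"
      "variation n A \<le> variation n K2 + ennreal d" "variation n U2 \<le> variation n A + ennreal d"
      by (rule regular_approx[OF n A d(1)])
    let ?K = "K1 \<union> K2" and ?U = "U1 \<inter> U2"
    have K: "compact ?K" "?K \<subseteq> A" and U: "open ?U" "A \<subseteq> ?U"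
      using 1 2 by (auto intro: compact_Un)
    have b: "K1 \<in> sets borel" "K2 \<in> sets borel" "U1 \<in> sets borel" "U2 \<in> sets borel"
      using 1 2 by (auto intro: borel_compact)
    then have KU: "?K \<in> sets borel" "?U \<in> sets borel" by auto
    have "variation l (?U - A) \<le> ennreal (c * (d + d))"
    proof (rule gap[OF A KU(2) U(2)])
      show "variation m ?U \<le> variation m A + ennreal d"
        using variation_mono[OF KU(2) b(3), of m] 1(6) by auto
      show "variation n ?U \<le> variation n A + ennreal d"
        using variation_mono[OF KU(2) b(4), of n] 2(6) by auto
    qed (use d in auto)
    also have "\<dots> \<le> ennreal e" using d by (intro ennreal_leI) auto
    finally have "variation l ?U \<le> variation l A + ennreal e"
      using variation_diff[OF l A KU(2) U(2)] by (metis add_left_mono)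
    moreover have "variation l (A - ?K) \<le> ennreal (c * (d + d))"
    proof (rule gap[OF KU(1) A K(2)])
      show "variation m A \<le> variation m ?K + ennreal d"
        using variation_mono[OF b(1) KU(1), of m] 1(5)
        by (metis Un_upper1 add_right_mono order_trans)
      show "variation n A \<le> variation n ?K + ennreal d"
        using variation_mono[OF b(2) KU(1), of n] 2(5)
        by (metis Un_upper2 add_right_mono order_trans)
    qed (use d in auto)
    then have "variation l (A - ?K) \<le> ennreal e"
      using d by (meson ennreal_leI order_trans)
    then have "variation l A \<le> variation l ?K + ennreal e"
      using variation_diff[OF l KU(1) A K(2)] by (metis add_left_mono)
    ultimately show ?thesis
      using K U by blast
  qed
  have "regular_variation l"
    unfolding regular_variation_def
  proof (intro ballI conjI antisym)
    fix A :: "'g set" assume A: "A \<in> sets borel"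
    show "variation l A \<le> (INF U \<in> {U. A \<subseteq> U \<and> open U}. variation l U)"
      using A by (intro INF_greatest variation_mono) auto
    show "(SUP K \<in> {K. K \<subseteq> A \<and> compact K}. variation l K) \<le> variation l A"
      using A by (intro SUP_least variation_mono) (auto intro: borel_compact)
    show "(INF U \<in> {U. A \<subseteq> U \<and> open U}. variation l U) \<le> variation l A"
    proof (rule ennreal_le_epsilon)
      fix e :: real assume "0 < e"
      from approx[OF A this] obtain U where
        U: "open U" "A \<subseteq> U" "variation l U \<le> variation l A + ennreal e" by blast
      then show "(INF U \<in> {U. A \<subseteq> U \<and> open U}. variation l U) \<le> variation l A + ennreal e"
        by (intro INF_lower2[of U]) auto
    qed
    show "variation l A \<le> (SUP K \<in> {K. K \<subseteq> A \<and> compact K}. variation l K)"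
    proof (rule ennreal_le_epsilon)
      fix e :: real assume "0 < e"
      from approx[OF A this] obtain K where
        K: "compact K" "K \<subseteq> A" "variation l A \<le> variation l K + ennreal e" by blast
      then have "variation l K \<le> (SUP K \<in> {K. K \<subseteq> A \<and> compact K}. variation l K)"
        by (intro SUP_upper) auto
      with K show "variation l A \<le> (SUP K \<in> {K. K \<subseteq> A \<and> compact K}. variation l K) + ennreal e"
        by (meson add_right_mono order_trans)
    qed
  qed
  moreover have "variation l UNIV < \<infinity>"
  proof -
    have "variation l UNIV \<le> ennreal c * (variation m UNIV + variation n UNIV)"
      by (rule dom) auto
    also have "\<dots> < \<infinity>"
      using m n unfolding is_rca_def by (auto simp: ennreal_mult_less_top)
    finally show ?thesis .
  qed
  ultimately show ?thesis
    using l0 l unfolding is_rca_def by blast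
qed

lemma is_rca_add:
  fixes m n :: "'g::t2_space set \<Rightarrow> 'v::real_normed_vector"
  assumes m: "is_rca m" and n: "is_rca n"
  shows "is_rca (\<lambda>A. m A + n A)"
proof (rule is_rca_dominated[OF m n, of 1])
  show "borel_countably_additive (\<lambda>A. m A + n A)"
    using m n unfolding is_rca_def borel_countably_additive_def by (auto intro!: sums_add)
qed (use m n variation_add_le[of m n] in \<open>auto simp: is_rca_def\<close>)

lemma is_rca_bounded_linear:
  fixes m :: "'g::t2_space set \<Rightarrow> 'v::real_normed_vector"
  assumes h: "bounded_linear h" and m: "is_rca m"
  shows "is_rca (\<lambda>A. h (m A))"
proof -
  interpret h: bounded_linear h by fact
  obtain K where K: "0 < K" "\<And>x. norm (h x) \<le> K * norm x"
    using h.pos_bounded by (metis mult.commute)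
  show ?thesis
  proof (rule is_rca_dominated[OF m m, of K])
    show "borel_countably_additive (\<lambda>A. h (m A))"
      using m unfolding is_rca_def borel_countably_additive_def by (auto intro!: h.sums)
    show "variation (\<lambda>A. h (m A)) A \<le> ennreal K * (variation m A + variation m A)" for A
    proof -
      have "variation (\<lambda>A. h (m A)) A \<le> ennreal K * variation m A"
        using K by (intro variation_bounded_linear_le) auto
      also have "\<dots> \<le> ennreal K * (variation m A + variation m A)"
        by (intro mult_left_mono) auto
      finally show ?thesis .
    qed
  qed (use m K in \<open>auto simp: is_rca_def\<close>)
qed

lemma variation_zero: "variation (\<lambda>_. 0) A = 0"
  using variation_bounded_linear_le[of "\<lambda>_. 0" 0 "\<lambda>_. 0::real" A] by simp

lemma is_rca_zero: "is_rca (\<lambda>_::'g::t2_space set. 0 :: 'v::real_normed_vector)"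
proof -
  have "{U::'g set. A \<subseteq> U \<and> open U} \<noteq> {}" "{K::'g set. K \<subseteq> A \<and> compact K} \<noteq> {}" for A
    by (auto intro: exI[of _ UNIV] exI[of _ "{}"])
  then show ?thesis
    unfolding is_rca_def regular_variation_def borel_countably_additive_def
    by (simp add: variation_zero)
qed

subsection \<open>The normed space of regular measures\<close>

text \<open>\<open>('g, real) rca\<close> and \<open>('g, complex) rca\<close> are the spaces M(G,R) and M(G,C).\<close>

typedef (overloaded) ('g::t2_space, 'v::real_normed_vector) rca =
  "{m :: 'g set \<Rightarrow> 'v. is_rca m}"
  morphisms meas_of Abs_rca
  using is_rca_zero by blast

setup_lifting type_definition_rca

instantiation rca :: (t2_space, real_normed_vector) real_vector
begin

lift_definition zero_rca :: "('a, 'b) rca" is "\<lambda>_. 0"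
  by (rule is_rca_zero)

lift_definition plus_rca :: "('a, 'b) rca \<Rightarrow> ('a, 'b) rca \<Rightarrow> ('a, 'b) rca" is "\<lambda>m n A. m A + n A"
  by (rule is_rca_add)

lift_definition uminus_rca :: "('a, 'b) rca \<Rightarrow> ('a, 'b) rca" is "\<lambda>m A. - m A"
  by (rule is_rca_bounded_linear[OF bounded_linear_minus[OF bounded_linear_ident]])

lift_definition minus_rca :: "('a, 'b) rca \<Rightarrow> ('a, 'b) rca \<Rightarrow> ('a, 'b) rca" is "\<lambda>m n A. m A - n A"
  using is_rca_add is_rca_bounded_linear[OF bounded_linear_minus[OF bounded_linear_ident]]
  by fastforce

lift_definition scaleR_rca :: "real \<Rightarrow> ('a, 'b) rca \<Rightarrow> ('a, 'b) rca" is "\<lambda>r m A. r *\<^sub>R m A"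
  by (rule is_rca_bounded_linear[OF bounded_linear_scaleR_right])

instance
  by standard (transfer; simp add: fun_eq_iff algebra_simps)+

end

instantiation rca :: (t2_space, real_normed_vector) real_normed_vector
begin

lift_definition norm_rca :: "('a, 'b) rca \<Rightarrow> real" is "\<lambda>m. enn2real (variation m UNIV)" .

definition dist_rca :: "('a, 'b) rca \<Rightarrow> ('a, 'b) rca \<Rightarrow> real" where
  "dist_rca m n = norm (m - n)"

definition sgn_rca :: "('a, 'b) rca \<Rightarrow> ('a, 'b) rca" where
  "sgn_rca m = m /\<^sub>R norm m"

definition uniformity_rca :: "(('a, 'b) rca \<times> ('a, 'b) rca) filter" where
  "uniformity_rca = (INF e\<in>{0<..}. principal {(m, n). dist m n < e})"

definition open_rca :: "('a, 'b) rca set \<Rightarrow> bool" where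
  "open_rca S \<longleftrightarrow> (\<forall>m\<in>S. \<forall>\<^sub>F (m', n) in uniformity. m' = m \<longrightarrow> n \<in> S)"

lemma ennreal_norm_rca: "ennreal (norm m) = variation (meas_of m) UNIV"
  using meas_of[of m] by (simp add: norm_rca.rep_eq is_rca_def)

instance
proof
  fix m n :: "('a, 'b) rca" and r :: real
  show "(norm m = 0) \<longleftrightarrow> (m = 0)"
  proof
    assume "norm m = 0"
    then have 0: "variation (meas_of m) UNIV = 0"
      using ennreal_norm_rca[of m] by simp
    have "meas_of m A = 0" for A
    proof (cases "A \<in> sets borel")
      case True
      have "ennreal (norm (meas_of m A)) \<le> variation (meas_of m) UNIV"
        using norm_le_variation[OF True] variation_mono[OF True, of UNIV] by (auto intro: order_trans)
      then show ?thesis using 0 by simp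
    next
      case False
      then show ?thesis using meas_of[of m] by (simp add: is_rca_def)
    qed
    then show "m = 0"
      by (simp add: meas_of_inject[symmetric] zero_rca.rep_eq fun_eq_iff)
  next
    assume "m = 0"
    then show "norm m = 0" by (simp add: norm_rca.rep_eq zero_rca.rep_eq variation_zero)
  qed
  show "norm (m + n) \<le> norm m + norm n"
  proof -
    have "ennreal (norm (m + n)) \<le> ennreal (norm m) + ennreal (norm n)"
      unfolding ennreal_norm_rca plus_rca.rep_eq by (rule variation_add_le)
    moreover have "0 \<le> norm m" "0 \<le> norm n" by (simp_all add: norm_rca.rep_eq)
    ultimately show ?thesis
      by (metis add_nonneg_nonneg ennreal_le_iff ennreal_plus)
  qed
  have le: "norm (r *\<^sub>R m) \<le> \<bar>r\<bar> * norm m" for r and m :: "('a, 'b) rca"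
  proof -
    have "ennreal (norm (r *\<^sub>R m)) \<le> ennreal \<bar>r\<bar> * ennreal (norm m)"
      unfolding ennreal_norm_rca scaleR_rca.rep_eq by (rule variation_bounded_linear_le) auto
    then have "ennreal (norm (r *\<^sub>R m)) \<le> ennreal (\<bar>r\<bar> * norm m)"
      by (simp add: ennreal_mult norm_rca.rep_eq)
    then show ?thesis
      by (subst (asm) ennreal_le_iff) (auto simp: norm_rca.rep_eq)
  qed
  show "norm (r *\<^sub>R m) = \<bar>r\<bar> * norm m"
  proof (cases "r = 0")
    case True
    then show ?thesis by (simp add: norm_rca.rep_eq zero_rca.rep_eq variation_zero)
  next
    case False
    have "norm m \<le> \<bar>inverse r\<bar> * norm (r *\<^sub>R m)"
      using le[of "inverse r" "r *\<^sub>R m"] False by simp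
    then show ?thesis
      using le[of r m] False by (simp add: field_simps abs_mult)
  qed
qed (simp_all add: dist_rca_def sgn_rca_def uniformity_rca_def open_rca_def)

end

instantiation rca :: (t2_space, "{real_normed_vector, ordered_real_vector}") ordered_real_vector
begin

definition less_eq_rca :: "('a, 'b) rca \<Rightarrow> ('a, 'b) rca \<Rightarrow> bool" where
  "m \<le> n \<longleftrightarrow> (\<forall>A \<in> sets borel. meas_of m A \<le> meas_of n A)"

definition less_rca :: "('a, 'b) rca \<Rightarrow> ('a, 'b) rca \<Rightarrow> bool" where
  "m < n \<longleftrightarrow> m \<le> n \<and> \<not> n \<le> (m :: ('a, 'b) rca)"

instance
proof
  fix m n :: "('a, 'b) rca"
  assume mn: "m \<le> n" "n \<le> m"
  have "meas_of m A = meas_of n A" for A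
    using mn meas_of[of m] meas_of[of n]
    by (cases "A \<in> sets borel") (auto simp: less_eq_rca_def is_rca_def intro: antisym)
  then show "m = n"
    by (simp add: meas_of_inject[symmetric] fun_eq_iff)
qed (auto simp: less_eq_rca_def less_rca_def plus_rca.rep_eq scaleR_rca.rep_eq zero_rca.rep_eq
      intro: order_trans scaleR_left_mono scaleR_right_mono)

end

lift_definition scale_rca :: "'f::real_normed_algebra \<Rightarrow> ('g::t2_space, 'f) rca \<Rightarrow> ('g, 'f) rca"
  is "\<lambda>c m A. c * m A"
  by (rule is_rca_bounded_linear[OF bounded_linear_mult_right])


section \<open>Integration and convolution\<close>

definition variation_measure :: "('g::t2_space, 'v::real_normed_vector) rca \<Rightarrow> 'g measure" where
  "variation_measure m = measure_of UNIV (sets borel) (variation (meas_of m))"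

definition is_density ::
    "('g::t2_space, 'f::{real_normed_field, banach, second_countable_topology}) rca \<Rightarrow> ('g \<Rightarrow> 'f) \<Rightarrow> bool" where
  "is_density m h \<longleftrightarrow> integrable (variation_measure m) h \<and>
     (\<forall>A \<in> sets borel. meas_of m A = set_lebesgue_integral (variation_measure m) A h)"

text \<open>The integral against a real or complex measure is defined through its polar
  decomposition \<open>dm = h d|m|\<close>; \<open>h\<close> is unique up to \<open>|m|\<close>-null sets.\<close>

definition rca_integral ::
    "('g::t2_space, 'f::{real_normed_field, banach, second_countable_topology}) rca \<Rightarrow> ('g \<Rightarrow> 'f) \<Rightarrow> 'f" where
  "rca_integral m f = (LINT x|variation_measure m. f x * (SOME h. is_density m h) x)"

definition C0 :: "('g::topological_space \<Rightarrow> 'v::real_normed_vector) set" where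
  "C0 = {f. continuous_on UNIV f \<and> (\<forall>e>0. \<exists>K. compact K \<and> (\<forall>x. x \<notin> K \<longrightarrow> norm (f x) < e))}"

text \<open>The group is written additively because the library's class of topological groups is;
  \<open>group_add\<close> does not include commutativity.\<close>

definition convolution ::
    "('g::{topological_group_add, t2_space}, 'f::{real_normed_field, banach, second_countable_topology}) rca
      \<Rightarrow> ('g, 'f) rca \<Rightarrow> ('g, 'f) rca"  (infixl \<open>\<star>\<close> 70) where
  "m \<star> n = (THE l. \<forall>f\<in>C0. rca_integral l f = rca_integral n (\<lambda>t. rca_integral m (\<lambda>s. f (s + t))))"


section \<open>Suprema, regular operators and complexifications\<close>

definition lub_on :: "'a set \<Rightarrow> ('a \<Rightarrow> 'a \<Rightarrow> bool) \<Rightarrow> 'a set \<Rightarrow> 'a" where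
  "lub_on L le S = (THE u. u \<in> L \<and> (\<forall>s\<in>S. le s u) \<and> (\<forall>v\<in>L. (\<forall>s\<in>S. le s v) \<longrightarrow> le u v))"

abbreviation lub :: "'e::order set \<Rightarrow> 'e" where
  "lub \<equiv> lub_on UNIV (\<le>)"

subsection \<open>Regular operators on an ordered vector space\<close>

definition positive_op :: "('e::ordered_real_vector \<Rightarrow> 'e) \<Rightarrow> bool" where
  "positive_op T \<longleftrightarrow> linear T \<and> (\<forall>x\<ge>0. 0 \<le> T x)"

definition regular_ops :: "('e::ordered_real_vector \<Rightarrow> 'e) set" where
  "regular_ops = {(\<lambda>x. S x - T x) | S T. positive_op S \<and> positive_op T}"

definition op_le :: "('e::ordered_real_vector \<Rightarrow> 'e) \<Rightarrow> ('e \<Rightarrow> 'e) \<Rightarrow> bool" where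
  "op_le S T \<longleftrightarrow> (\<forall>x\<ge>0. S x \<le> T x)"

abbreviation op_lub :: "('e::ordered_real_vector \<Rightarrow> 'e) set \<Rightarrow> 'e \<Rightarrow> 'e" where
  "op_lub \<equiv> lub_on regular_ops op_le"

definition op_modulus :: "('e::ordered_real_vector \<Rightarrow> 'e) \<Rightarrow> 'e \<Rightarrow> 'e" where
  "op_modulus T = op_lub {T, \<lambda>x. - T x}"

definition regular_norm :: "('e::{ordered_real_vector, real_normed_vector} \<Rightarrow> 'e) \<Rightarrow> real" where
  "regular_norm T = onorm (op_modulus T)"

subsection \<open>Complex measures as the complexification of the real measures\<close>

lift_definition Re_rca :: "('g::t2_space, complex) rca \<Rightarrow> ('g, real) rca" is "\<lambda>m A. Re (m A)"
  by (rule is_rca_bounded_linear[OF bounded_linear_Re])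

lift_definition Im_rca :: "('g::t2_space, complex) rca \<Rightarrow> ('g, real) rca" is "\<lambda>m A. Im (m A)"
  by (rule is_rca_bounded_linear[OF bounded_linear_Im])

lift_definition complex_rca :: "('g::t2_space, real) rca \<Rightarrow> ('g, complex) rca" is "\<lambda>m A. complex_of_real (m A)"
  by (rule is_rca_bounded_linear[OF bounded_linear_of_real])

text \<open>The measure \<open>x + i y\<close>.\<close>

definition Complex_rca :: "('g::t2_space, real) rca \<Rightarrow> ('g, real) rca \<Rightarrow> ('g, complex) rca" where
  "Complex_rca x y = complex_rca x + scale_rca \<i> (complex_rca y)"

lemma Complex_rca_iff: "z = Complex_rca x y \<longleftrightarrow> x = Re_rca z \<and> y = Im_rca z"
  unfolding Complex_rca_def by transfer (auto simp: fun_eq_iff complex_eq_iff)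

text \<open>The moduli below take values in the real space, regarded as a subset of its
  complexification.\<close>

definition complex_modulus :: "('g::t2_space, complex) rca \<Rightarrow> ('g, complex) rca" where
  "complex_modulus z =
     complex_rca (lub {cos \<theta> *\<^sub>R Re_rca z + sin \<theta> *\<^sub>R Im_rca z | \<theta>. 0 \<le> \<theta> \<and> \<theta> \<le> 2 * pi})"

subsection \<open>Regular operators on the complexification\<close>

text \<open>The complex-linear operator \<open>S\<^sub>1 + i S\<^sub>2\<close>.\<close>

definition Complex_op ::
    "(('g::t2_space, real) rca \<Rightarrow> ('g, real) rca) \<Rightarrow> (('g, real) rca \<Rightarrow> ('g, real) rca)
      \<Rightarrow> ('g, complex) rca \<Rightarrow> ('g, complex) rca" where
  "Complex_op S1 S2 z =
     Complex_rca (S1 (Re_rca z) - S2 (Im_rca z)) (S1 (Im_rca z) + S2 (Re_rca z))"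

definition complex_regular_ops :: "(('g::t2_space, complex) rca \<Rightarrow> ('g, complex) rca) set" where
  "complex_regular_ops = {Complex_op S1 S2 | S1 S2. S1 \<in> regular_ops \<and> S2 \<in> regular_ops}"

definition Re_op :: "(('g::t2_space, complex) rca \<Rightarrow> ('g, complex) rca) \<Rightarrow> ('g, real) rca \<Rightarrow> ('g, real) rca" where
  "Re_op T x = Re_rca (T (complex_rca x))"

definition Im_op :: "(('g::t2_space, complex) rca \<Rightarrow> ('g, complex) rca) \<Rightarrow> ('g, real) rca \<Rightarrow> ('g, real) rca" where
  "Im_op T x = Im_rca (T (complex_rca x))"

lemma Re_op_Complex_op: "linear S2 \<Longrightarrow> Re_op (Complex_op S1 S2) = S1"
  and Im_op_Complex_op: "linear S1 \<Longrightarrow> Im_op (Complex_op S1 S2) = S2"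
proof -
  have [simp]: "Re_rca (complex_rca x) = x" "Im_rca (complex_rca x) = 0" for x :: "('g::t2_space, real) rca"
    by (transfer; simp)+
  have [simp]: "Re_rca (Complex_rca x y) = x" "Im_rca (Complex_rca x y) = y"
    for x y :: "('g::t2_space, real) rca"
    using Complex_rca_iff[of "Complex_rca x y" x y] by auto
  show "linear S2 \<Longrightarrow> Re_op (Complex_op S1 S2) = S1" "linear S1 \<Longrightarrow> Im_op (Complex_op S1 S2) = S2"
    by (auto simp: fun_eq_iff Re_op_def Im_op_def Complex_op_def linear_0)
qed

definition complex_op_real_modulus ::
    "(('g::t2_space, complex) rca \<Rightarrow> ('g, complex) rca) \<Rightarrow> ('g, real) rca \<Rightarrow> ('g, real) rca" where
  "complex_op_real_modulus T =
     op_lub {(\<lambda>x. cos \<theta> *\<^sub>R Re_op T x + sin \<theta> *\<^sub>R Im_op T x) | \<theta>. 0 \<le> \<theta> \<and> \<theta> \<le> 2 * pi}"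


section \<open>Banach lattice algebras and their homomorphisms\<close>

text \<open>One record serves both for real Banach lattice algebras and for their
  complexifications.  Only the data are recorded; it is used for the four structures below.\<close>

record ('f, 'a) lattice_algebra =
  carr :: "'a set"
  add :: "'a \<Rightarrow> 'a \<Rightarrow> 'a"
  scale :: "'f \<Rightarrow> 'a \<Rightarrow> 'a"
  mult :: "'a \<Rightarrow> 'a \<Rightarrow> 'a"
  modulus :: "'a \<Rightarrow> 'a"
  nrm :: "'a \<Rightarrow> real"

definition nrm_dist :: "('f::real_normed_field, 'a) lattice_algebra \<Rightarrow> 'a \<Rightarrow> 'a \<Rightarrow> real" where
  "nrm_dist A x y = nrm A (add A x (scale A (-1) y))"

definition algebra_hom ::
    "('f::real_normed_field, 'a) lattice_algebra \<Rightarrow> ('f, 'b) lattice_algebra \<Rightarrow> ('a \<Rightarrow> 'b) \<Rightarrow> bool" where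
  "algebra_hom A B \<pi> \<longleftrightarrow> \<pi> \<in> carr A \<rightarrow> carr B \<and>
     (\<forall>x\<in>carr A. \<forall>y\<in>carr A. \<pi> (add A x y) = add B (\<pi> x) (\<pi> y)) \<and>
     (\<forall>c. \<forall>x\<in>carr A. \<pi> (scale A c x) = scale B c (\<pi> x)) \<and>
     (\<forall>x\<in>carr A. \<forall>y\<in>carr A. \<pi> (mult A x y) = mult B (\<pi> x) (\<pi> y))"

definition nrm_continuous ::
    "('f::real_normed_field, 'a) lattice_algebra \<Rightarrow> ('f, 'b) lattice_algebra \<Rightarrow> ('a \<Rightarrow> 'b) \<Rightarrow> bool" where
  "nrm_continuous A B \<pi> \<longleftrightarrow>
     (\<forall>x\<in>carr A. \<forall>e>0. \<exists>d>0. \<forall>y\<in>carr A. nrm_dist A y x < d \<longrightarrow> nrm_dist B (\<pi> y) (\<pi> x) < e)"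

definition lattice_algebra_hom ::
    "('f::real_normed_field, 'a) lattice_algebra \<Rightarrow> ('f, 'b) lattice_algebra \<Rightarrow> ('a \<Rightarrow> 'b) \<Rightarrow> bool" where
  "lattice_algebra_hom A B \<pi> \<longleftrightarrow> algebra_hom A B \<pi> \<and> nrm_continuous A B \<pi> \<and>
     (\<forall>x\<in>carr A. modulus B (\<pi> x) = \<pi> (modulus A x))"

definition isometric ::
    "('f, 'a) lattice_algebra \<Rightarrow> ('f, 'b) lattice_algebra \<Rightarrow> ('a \<Rightarrow> 'b) \<Rightarrow> bool" where
  "isometric A B \<pi> \<longleftrightarrow> (\<forall>x\<in>carr A. nrm B (\<pi> x) = nrm A x)"

definition real_measure_algebra ::
    "(real, ('g::{topological_group_add, t2_space}, real) rca) lattice_algebra" where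
  "real_measure_algebra = \<lparr>carr = UNIV, add = (+), scale = scale_rca, mult = (\<star>),
     modulus = (\<lambda>m. lub {m, - m}), nrm = norm\<rparr>"

definition complex_measure_algebra ::
    "(complex, ('g::{topological_group_add, t2_space}, complex) rca) lattice_algebra" where
  "complex_measure_algebra = \<lparr>carr = UNIV, add = (+), scale = scale_rca, mult = (\<star>),
     modulus = complex_modulus, nrm = norm\<rparr>"

definition real_operator_algebra ::
    "(real, ('g::t2_space, real) rca \<Rightarrow> ('g, real) rca) lattice_algebra" where
  "real_operator_algebra = \<lparr>carr = regular_ops, add = (\<lambda>S T x. S x + T x),
     scale = (\<lambda>c T x. scale_rca c (T x)), mult = (\<circ>),
     modulus = op_modulus, nrm = regular_norm\<rparr>"

definition complex_operator_algebra ::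
    "(complex, ('g::t2_space, complex) rca \<Rightarrow> ('g, complex) rca) lattice_algebra" where
  "complex_operator_algebra = \<lparr>carr = complex_regular_ops, add = (\<lambda>S T x. S x + T x),
     scale = (\<lambda>c T x. scale_rca c (T x)), mult = (\<circ>),
     modulus = (\<lambda>T. Complex_op (complex_op_real_modulus T) (\<lambda>_. 0)),
     nrm = (\<lambda>T. regular_norm (complex_op_real_modulus T))\<rparr>"

definition left_regular ::
    "('g::{topological_group_add, t2_space}, 'f::{real_normed_field, banach, second_countable_topology}) rca
      \<Rightarrow> ('g, 'f) rca \<Rightarrow> ('g, 'f) rca" where
  "left_regular m = (\<lambda>n. m \<star> n)"

end

theory Submission
  imports Defs
begin

text \<open>Set-wise, the convolution is \<open>(\<mu> \<star> \<nu>)(A) = \<integral> \<mu>(A - t) d\<nu>(t)\<close>.  This iterated form gives associativity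
  without Fubini's theorem, so nothing has to be known about Borel sets of \<open>G \<times> G\<close>, which need not
  be generated by rectangles.

  The heart of the matter is \<open>|\<pi>(\<mu>)| = \<pi>(|\<mu>|)\<close>.  Clearly \<open>\<pi>(|\<mu>|)\<close> dominates \<open>Re (e\<^sup>i\<^sup>\<theta> \<pi>(\<mu>))\<close> for all \<open>\<theta>\<close>.  Conversely,
  any operator \<open>R\<close> dominating all of these satisfies \<open>R \<nu> \<ge> \<Sum>\<^sub>i |\<mu> \<star> \<nu>\<^sub>i|\<close> whenever \<open>\<nu> = \<Sum>\<^sub>i \<nu>\<^sub>i\<close> with \<open>\<nu>\<^sub>i \<ge> 0\<close>.
  If each \<open>\<nu>\<^sub>i\<close> lives on a small set then \<open>\<mu> \<star> \<nu>\<^sub>i\<close> is almost a translate of a multiple of \<open>\<mu>\<close>, hence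
  \<open>\<parallel>\<mu> \<star> \<nu>\<^sub>i\<parallel> \<ge> (\<parallel>\<mu>\<parallel> - \<epsilon>) \<parallel>\<nu>\<^sub>i\<parallel>\<close>.  As \<open>\<Sum>\<^sub>i |\<mu> \<star> \<nu>\<^sub>i| \<le> |\<mu>| \<star> \<nu>\<close> and the total masses differ by an arbitrarily
  small amount, \<open>R \<nu> \<ge> |\<mu>| \<star> \<nu>\<close>.  Isometry follows by testing \<open>\<pi>(|\<mu>|)\<close> on \<open>|\<mu>|\<close>.\<close>

section \<open>The variation measure\<close>

text \<open>Local compactness enters at two places. Compact neighbourhoods allow one compact
  \<open>C\<close> inside an open \<open>U\<close> to keep m(C - t) large for all t in a compact
  set, which gives the regularity of the convolution; and they supply enough functions in
  \<open>C0\<close> to determine a measure. The lower bound for small pieces comes from disjoint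
  compact sets that almost exhaust the norm of \<mu>. They have disjoint open neighbourhoods, and
  translations near 0 keep each compact set inside its own, so contributions of different sets
  cannot cancel. The cutting of \<nu> is finite because regularity puts all but \<epsilon> of its
  mass on a compact set. Comparing total masses is enough because the difference of the two measures
  is positive, so its mass bounds its value at every Borel set. Suprema are definite descriptions;
  each is settled by exhibiting an element and checking that it is the least upper bound.\<close>

lemma variation_empty:
  assumes "borel_countably_additive m"
  shows "variation m {} = 0"
proof -
  have "variation m {} \<le> 0"
  proof (rule variation_least)
    fix P assume "finite P" "disjoint P" "P \<subseteq> sets borel" "\<Union>P = ({}::'a set)"
    then have "\<And>B. B \<in> P \<Longrightarrow> B = {}" by blast
    then have "(\<Sum>B\<in>P. ennreal (norm (m B))) = 0"
      using bca_empty[OF assms] by (intro sum.neutral) auto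
    then show "(\<Sum>B\<in>P. ennreal (norm (m B))) \<le> 0" by simp
  qed
  then show ?thesis by simp
qed

lemma variation_Un:
  assumes m: "borel_countably_additive m" and "A \<in> sets borel" "B \<in> sets borel" "A \<inter> B = {}"
  shows "variation m (A \<union> B) = variation m A + variation m B"
proof -
  have "A \<union> B - A = B" using assms by auto
  then show ?thesis
    using variation_diff[OF m, of A "A \<union> B"] assms by auto
qed

lemma norm_sums_le_suminf_ennreal:
  fixes f :: "nat \<Rightarrow> 'v::real_normed_vector"
  assumes "f sums s"
  shows "ennreal (norm s) \<le> (\<Sum>i. ennreal (norm (f i)))"
proof (rule tendsto_upperbound)
  show "(\<lambda>n. ennreal (norm (\<Sum>i<n. f i))) \<longlonglongrightarrow> ennreal (norm s)"
    using assms unfolding sums_def by (intro tendsto_ennrealI tendsto_norm)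
  have "ennreal (norm (\<Sum>i<n. f i)) \<le> (\<Sum>i. ennreal (norm (f i)))" for n
  proof -
    have "ennreal (norm (\<Sum>i<n. f i)) \<le> (\<Sum>i<n. ennreal (norm (f i)))"
      by (simp add: norm_sum ennreal_leI sum_nonneg)
    also have "\<dots> \<le> (\<Sum>i. ennreal (norm (f i)))"
      by (rule sum_le_suminf) auto
    finally show ?thesis .
  qed
  then show "\<forall>\<^sub>F n in sequentially. ennreal (norm (\<Sum>i<n. f i)) \<le> (\<Sum>i. ennreal (norm (f i)))"
    by simp
qed simp

text \<open>Two distinct members of \<open>P\<close> can have the same trace on \<open>D\<close>
  only if that trace is empty, so passing from \<open>P\<close> to the set of traces merges nothing
  but zero terms.\<close>

lemma sum_image_Int_le_variation:
  assumes m: "borel_countably_additive m" and P: "finite P" "disjoint P" "P \<subseteq> sets borel"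
    and D: "D \<in> sets borel" "D \<subseteq> \<Union>P"
  shows "(\<Sum>C\<in>P. ennreal (norm (m (C \<inter> D)))) \<le> variation m D"
proof -
  have "(\<Sum>C\<in>P. ennreal (norm (m (C \<inter> D)))) = (\<Sum>C\<in>(\<lambda>C. C \<inter> D) ` P. ennreal (norm (m C)))"
  proof (subst sum.reindex_nontrivial)
    fix C C' assume C: "C \<in> P" "C' \<in> P" "C \<noteq> C'" "C \<inter> D = C' \<inter> D"
    then have "C \<inter> C' = {}"
      using P(2) by (auto simp: disjoint_def)
    with C have "C \<inter> D = {}" by blast
    then show "ennreal (norm (m (C \<inter> D))) = 0"
      using bca_empty[OF m] by simp
  qed (use P in auto)
  also have "\<dots> \<le> variation m D"
  proof (rule variation_upper)
    show "disjoint ((\<lambda>C. C \<inter> D) ` P)"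
      using P(2) unfolding disjoint_def by blast
  qed (use P D in auto)
  finally show ?thesis .
qed

text \<open>One inequality is finite additivity and monotonicity along the partial unions. For the
  other, every partition is refined by the sets \<open>A i\<close>, and the two sums are
  exchanged.\<close>

lemma countably_additive_variation:
  assumes m: "borel_countably_additive (m :: 'g::topological_space set \<Rightarrow> 'v::real_normed_vector)"
  shows "countably_additive (sets borel) (variation m)"
  unfolding countably_additive_def
proof (intro allI impI antisym)
  fix A :: "nat \<Rightarrow> 'g set"
  assume A: "range A \<subseteq> sets borel" "disjoint_family A"
  have Ai [measurable]: "A i \<in> sets borel" for i using A by auto
  show "(\<Sum>i. variation m (A i)) \<le> variation m (\<Union>i. A i)"
  proof (rule suminf_le_const)
    fix n
    have "(\<Sum>i<n. variation m (A i)) = variation m (\<Union>i<n. A i)"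
    proof (induction n)
      case 0 then show ?case using variation_empty[OF m] by simp
    next
      case (Suc n)
      have "A n \<inter> A i = {}" if "i < n" for i
        using A(2) that by (intro disjoint_family_onD[of A UNIV]) auto
      then have "A n \<inter> (\<Union>i<n. A i) = {}" by blast
      then show ?case
        using Suc variation_Un[OF m, of "A n" "\<Union>i<n. A i"] by (simp add: lessThan_Suc add.commute)
    qed
    also have "\<dots> \<le> variation m (\<Union>i. A i)"
      by (intro variation_mono) auto
    finally show "(\<Sum>i<n. variation m (A i)) \<le> variation m (\<Union>i. A i)" .
  qed simp
  show "variation m (\<Union>i. A i) \<le> (\<Sum>i. variation m (A i))"
  proof (rule variation_least)
    fix P assume P: "finite P" "disjoint P" "P \<subseteq> sets borel" "\<Union>P = (\<Union>i. A i)"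
    have "(\<Sum>B\<in>P. ennreal (norm (m B))) \<le> (\<Sum>B\<in>P. \<Sum>i. ennreal (norm (m (B \<inter> A i))))"
    proof (rule sum_mono, rule norm_sums_le_suminf_ennreal)
      fix B assume B: "B \<in> P"
      have "(\<lambda>i. m (B \<inter> A i)) sums m (\<Union>i. B \<inter> A i)"
        using A P B by (intro bca_sums[OF m]) (auto simp: disjoint_family_on_def)
      moreover have "(\<Union>i. B \<inter> A i) = B" using B P by auto
      ultimately show "(\<lambda>i. m (B \<inter> A i)) sums m B" by simp
    qed
    also have "\<dots> = (\<Sum>i. \<Sum>B\<in>P. ennreal (norm (m (B \<inter> A i))))"
      by (rule suminf_sum[symmetric]) simp
    also have "\<dots> \<le> (\<Sum>i. variation m (A i))"
    proof (rule suminf_le)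
      fix i show "(\<Sum>B\<in>P. ennreal (norm (m (B \<inter> A i)))) \<le> variation m (A i)"
        using P by (intro sum_image_Int_le_variation[OF m]) auto
    qed auto
    finally show "(\<Sum>B\<in>P. ennreal (norm (m B))) \<le> (\<Sum>i. variation m (A i))" .
  qed
qed

lemma measure_space_variation:
  assumes m: "borel_countably_additive (m :: 'g::topological_space set \<Rightarrow> 'v::real_normed_vector)"
  shows "measure_space UNIV (sets borel) (variation m)"
  unfolding measure_space_def positive_def
  using countably_additive_variation[OF m] variation_empty[OF m] sets.sigma_algebra_axioms[of borel]
  by simp

section \<open>Values of a regular measure and its variation measure\<close>

lemma bca_meas_of: "borel_countably_additive (meas_of m)"
  using meas_of[of m] by (simp add: is_rca_def)

lemma meas_of_notin: "A \<notin> sets borel \<Longrightarrow> meas_of m A = 0"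
  using meas_of[of m] by (simp add: is_rca_def)

lemma meas_of_empty [simp]: "meas_of m {} = 0"
  by (rule bca_empty[OF bca_meas_of])

lemma rca_eqI: "(\<And>A. A \<in> sets borel \<Longrightarrow> meas_of m A = meas_of n A) \<Longrightarrow> m = n"
  using meas_of_notin[of _ m] meas_of_notin[of _ n]
  by (metis ext meas_of_inject)

lemma sets_variation_measure [simp, measurable_cong]: "sets (variation_measure m) = sets borel"
  unfolding variation_measure_def
  using sets.sigma_sets_eq[of "borel :: 'a measure"] by (simp add: sets_measure_of_conv)

lemma space_variation_measure [simp]: "space (variation_measure m) = UNIV"
  by (simp add: variation_measure_def space_measure_of_conv)

lemma emeasure_variation_measure:
  "A \<in> sets borel \<Longrightarrow> emeasure (variation_measure m) A = variation (meas_of m) A"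
  using measure_space_variation[OF bca_meas_of, of m]
    emeasure_measure_of_sigma[of UNIV "sets borel" "variation (meas_of m)" A]
    sets.sigma_algebra_axioms[of borel]
  unfolding variation_measure_def measure_space_def by simp

lemma finite_measure_variation_measure [simp, intro!]: "finite_measure (variation_measure m)"
proof
  show "emeasure (variation_measure m) (space (variation_measure m)) \<noteq> \<infinity>"
    using is_rca_variation_finite[OF meas_of[simplified], of UNIV m]
    by (simp add: emeasure_variation_measure less_top)
qed

lemma measure_variation_measure:
  "A \<in> sets borel \<Longrightarrow> measure (variation_measure m) A = enn2real (variation (meas_of m) A)"
  by (simp add: measure_def emeasure_variation_measure)

lemma ennreal_measure_variation_measure:
  "A \<in> sets borel \<Longrightarrow> ennreal (measure (variation_measure m) A) = variation (meas_of m) A"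
  by (metis emeasure_variation_measure finite_measure.emeasure_eq_measure finite_measure_variation_measure)

lemma norm_rca_eq_measure: "norm m = measure (variation_measure m) UNIV"
  by (simp add: measure_variation_measure norm_rca.rep_eq)

lemma norm_meas_of_le:
  assumes "A \<in> sets borel"
  shows "norm (meas_of m A) \<le> measure (variation_measure m) A"
  using norm_le_variation[OF assms, of "meas_of m"] ennreal_measure_variation_measure[OF assms, of m]
  by (metis ennreal_le_iff measure_nonneg)

lemma norm_meas_of_le_norm: "norm (meas_of m A) \<le> norm m"
  using norm_meas_of_le[of A m] meas_of_notin[of A m]
    finite_measure.bounded_measure[OF finite_measure_variation_measure[of m], of A]
  by (cases "A \<in> sets borel") (auto simp: norm_rca_eq_measure)

lemma meas_of_Un:
  "A \<in> sets borel \<Longrightarrow> B \<in> sets borel \<Longrightarrow> A \<inter> B = {} \<Longrightarrow> meas_of m (A \<union> B) = meas_of m A + meas_of m B"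
  by (rule bca_Un[OF bca_meas_of])

lemma meas_of_diff:
  "A \<in> sets borel \<Longrightarrow> B \<in> sets borel \<Longrightarrow> B \<subseteq> A \<Longrightarrow> meas_of m (A - B) = meas_of m A - meas_of m B"
  using meas_of_Un[of B "A - B" m] by (simp add: Un_absorb1)

lemma variation_nonneg:
  assumes m: "borel_countably_additive (m :: 'g::topological_space set \<Rightarrow> real)"
    and pos: "\<And>A. A \<in> sets borel \<Longrightarrow> 0 \<le> m A" and A: "A \<in> sets borel"
  shows "variation m A = ennreal (m A)"
proof (rule antisym)
  show "ennreal (m A) \<le> variation m A"
    using norm_le_variation[OF A, of m] pos[OF A] by simp
  show "variation m A \<le> ennreal (m A)"
  proof (rule variation_least)
    fix P assume P: "finite P" "disjoint P" "P \<subseteq> sets borel" "\<Union>P = A"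
    from P(1-3) have "(\<Sum>B\<in>P. m B) = m (\<Union>P)"
    proof (induction P rule: finite_induct)
      case empty then show ?case using bca_empty[OF m] by simp
    next
      case (insert B P)
      have "B \<inter> \<Union>P = {}"
        using insert.prems(1) insert.hyps by (auto simp: disjoint_def)
      then have "m (B \<union> \<Union>P) = m B + m (\<Union>P)"
        using insert by (intro bca_Un[OF m]) auto
      then show ?case using insert by (auto simp: disjoint_def)
    qed
    moreover have "(\<Sum>B\<in>P. ennreal (norm (m B))) = ennreal (\<Sum>B\<in>P. m B)"
      using P pos by (subst sum_ennreal[symmetric]) (auto intro!: sum.cong simp: subset_eq)
    ultimately show "(\<Sum>B\<in>P. ennreal (norm (m B))) \<le> ennreal (m A)"
      using P by simp
  qed
qed

text \<open>The measure |m| as an element of M(G,R). Its regularity comes from domination by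
  \<open>m\<close>, which is passed twice because \<open>is_rca_dominated\<close> compares with a
  sum of two variations. It is identified below with the lattice modulus of a real measure and gives
  the complex modulus of a complex one.\<close>

lift_definition abs_rca :: "('g::t2_space, 'v::real_normed_vector) rca \<Rightarrow> ('g, real) rca"
  is "\<lambda>m A. if A \<in> sets borel then enn2real (variation m A) else 0"
proof -
  fix m :: "'g set \<Rightarrow> 'v" assume m: "is_rca m"
  let ?v = "\<lambda>A. if A \<in> sets borel then enn2real (variation m A) else 0"
  obtain m' where m': "m = meas_of m'"
    using m meas_of_cases by blast
  interpret finite_measure "variation_measure m'" by simp
  have v: "?v = (\<lambda>A. measure (variation_measure m') A)"
    unfolding m' by (auto simp: fun_eq_iff measure_variation_measure measure_notin_sets)
  have bca: "borel_countably_additive ?v"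
    unfolding v borel_countably_additive_def
    by (auto intro!: finite_measure_UNION)
  show "is_rca ?v"
  proof (rule is_rca_dominated[OF m m, of 1])
    fix A :: "'g set" assume "A \<in> sets borel"
    then have "variation ?v A = variation m A"
      by (subst variation_nonneg[OF bca]) (auto simp: m' ennreal_measure_variation_measure measure_variation_measure[symmetric])
    then show "variation ?v A \<le> ennreal 1 * (variation m A + variation m A)"
      by simp
  qed (use bca in auto)
qed

lemma meas_of_abs_rca: "meas_of (abs_rca m) A = measure (variation_measure m) A"
  by (cases "A \<in> sets borel") (simp_all add: abs_rca.rep_eq measure_variation_measure measure_notin_sets)

lemma rca_nonneg_iff: "0 \<le> (m :: ('g::t2_space, real) rca) \<longleftrightarrow> (\<forall>A. 0 \<le> meas_of m A)"
  unfolding less_eq_rca_def zero_rca.rep_eq by (metis meas_of_notin order_refl)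

lemma measure_nonneg_rca:
  fixes m :: "('g::t2_space, real) rca"
  assumes "0 \<le> m"
  shows "measure (variation_measure m) A = meas_of m A"
  using assms variation_nonneg[OF bca_meas_of[of m], of A] measure_variation_measure[of A m]
  by (cases "A \<in> sets borel") (auto simp: rca_nonneg_iff measure_notin_sets meas_of_notin)

lemma abs_rca_nonneg: "0 \<le> abs_rca m"
  by (simp add: rca_nonneg_iff meas_of_abs_rca)

lemma abs_rca_of_nonneg: "0 \<le> m \<Longrightarrow> abs_rca m = m"
  by (rule rca_eqI) (simp add: meas_of_abs_rca measure_nonneg_rca)

lemma variation_measure_abs_rca: "variation_measure (abs_rca m) = variation_measure m"
proof (rule measure_eqI)
  fix A assume "A \<in> sets (variation_measure (abs_rca m))"
  then show "emeasure (variation_measure (abs_rca m)) A = emeasure (variation_measure m) A"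
    by (simp add: finite_measure.emeasure_eq_measure meas_of_abs_rca measure_nonneg_rca abs_rca_nonneg)
qed simp

lemma norm_abs_rca: "norm (abs_rca m) = norm m"
  by (simp add: norm_rca_eq_measure variation_measure_abs_rca)

lemma norm_nonneg_rca: "0 \<le> m \<Longrightarrow> norm m = meas_of m UNIV"
  by (simp add: norm_rca_eq_measure measure_nonneg_rca)

text \<open>A positive additive bound survives summation over partitions. Minimality of |m| among
  such bounds is how the moduli of measures are recognised below.\<close>

lemma abs_rca_leI:
  fixes x :: "('g::t2_space, real) rca"
  assumes le: "\<And>A. A \<in> sets borel \<Longrightarrow> norm (meas_of m A) \<le> meas_of x A"
  shows "abs_rca m \<le> x"
  unfolding less_eq_rca_def
proof
  fix A :: "'g set" assume A: "A \<in> sets borel"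
  have x: "0 \<le> x"
    unfolding less_eq_rca_def zero_rca.rep_eq using le norm_ge_zero order_trans by blast
  have "variation (meas_of m) A \<le> 1 * (variation (meas_of x) A + variation (\<lambda>_. 0::real) A)"
  proof (rule variation_le_combination)
    fix A :: "'g set" assume A: "A \<in> sets borel"
    show "ennreal (norm (meas_of m A)) \<le> 1 * (ennreal (norm (meas_of x A)) + ennreal (norm (0::real)))"
      using le[OF A] by (auto intro!: ennreal_leI)
  qed
  then have "variation (meas_of m) A \<le> variation (meas_of x) A"
    by (simp add: variation_zero)
  then show "meas_of (abs_rca m) A \<le> meas_of x A"
    using A by (simp add: meas_of_abs_rca flip: measure_nonneg_rca[OF x] ennreal_measure_variation_measure)
qed

section \<open>Integration of bounded Borel functions\<close>

text \<open>This class contains the indicators of Borel sets as well as \<open>C0\<close>, is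
  integrable against every finite Borel measure, and is preserved by the inner integral of a
  convolution.\<close>

definition bdd_borel :: "('g::topological_space \<Rightarrow> 'f::real_normed_vector) \<Rightarrow> bool" where
  "bdd_borel f \<longleftrightarrow> f \<in> borel_measurable borel \<and> bounded (range f)"

lemma bdd_borel_measurable: "bdd_borel f \<Longrightarrow> f \<in> borel_measurable borel"
  by (simp add: bdd_borel_def)

lemma bdd_borel_measurable_variation_measure:
  "bdd_borel f \<Longrightarrow> f \<in> borel_measurable (variation_measure m)"
  by (simp add: bdd_borel_def cong: measurable_cong_sets)

lemma bdd_borelI: "f \<in> borel_measurable borel \<Longrightarrow> (\<And>x. norm (f x) \<le> B) \<Longrightarrow> bdd_borel f"
  by (auto simp: bdd_borel_def bounded_iff)

lemma bdd_borelE: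
  assumes "bdd_borel f"
  obtains B where "0 \<le> B" "\<And>x. norm (f x) \<le> B"
proof -
  obtain B where B: "\<And>x. norm (f x) \<le> B"
    using assms by (auto simp: bdd_borel_def bounded_iff)
  then have "0 \<le> B" using norm_ge_zero order_trans by blast
  with B show thesis by (rule that[rotated])
qed

lemma bdd_borel_indicator: "A \<in> sets borel \<Longrightarrow> bdd_borel (\<lambda>x. indicator A x *\<^sub>R c)"
  by (rule bdd_borelI[where B = "norm c"]) (auto simp: indicator_def)

lemma bdd_borel_add:
  fixes f g :: "'g::topological_space \<Rightarrow> 'f::{second_countable_topology, real_normed_vector}"
  assumes "bdd_borel f" "bdd_borel g"
  shows "bdd_borel (\<lambda>x. f x + g x)"
proof -
  obtain B C where "\<And>x. norm (f x) \<le> B" "\<And>x. norm (g x) \<le> C"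
    using assms by (metis bdd_borelE)
  then show ?thesis
    using assms by (intro bdd_borelI[where B = "B + C"])
      (auto intro: norm_triangle_mono borel_measurable_add bdd_borel_measurable)
qed

lemma bdd_borel_mult_left:
  fixes f :: "'g::topological_space \<Rightarrow> 'f::{second_countable_topology, real_normed_field}"
  assumes "bdd_borel f"
  shows "bdd_borel (\<lambda>x. c * f x)"
proof -
  obtain B where "\<And>x. norm (f x) \<le> B"
    using assms by (metis bdd_borelE)
  then show ?thesis
    using assms by (intro bdd_borelI[where B = "norm c * B"])
      (auto simp: norm_mult intro: mult_left_mono borel_measurable_times bdd_borel_measurable)
qed

lemma bdd_borel_const: "bdd_borel (\<lambda>_. c)"
  by (rule bdd_borelI[where B = "norm c"]) auto

lemma bdd_borel_of_real:
  assumes "bdd_borel f"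
  shows "bdd_borel (\<lambda>x. of_real (f x) :: 'f::{real_normed_field, second_countable_topology})"
proof -
  obtain B where "\<And>x. norm (f x) \<le> B"
    using assms by (metis bdd_borelE)
  moreover have "(of_real :: real \<Rightarrow> 'f) \<in> borel_measurable borel"
    by (intro borel_measurable_continuous_onI continuous_intros)
  ultimately show ?thesis
    using assms by (intro bdd_borelI[where B = B]) (auto intro: measurable_compose bdd_borel_measurable)
qed

lemma bdd_borel_sum:
  fixes f :: "'i \<Rightarrow> 'g::topological_space \<Rightarrow> 'f::{second_countable_topology, real_normed_vector}"
  assumes "\<And>i. i \<in> F \<Longrightarrow> bdd_borel (f i)"
  shows "bdd_borel (\<lambda>x. \<Sum>i\<in>F. f i x)"
  using assms by (induction F rule: infinite_finite_induct) (auto intro: bdd_borel_add bdd_borel_const)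

section \<open>Approximation by simple functions and induction over bounded Borel functions\<close>

lemma simple_function_borel_representation:
  fixes f :: "'g::topological_space \<Rightarrow> 'f::real_normed_vector"
  assumes "simple_function borel f"
  shows "finite (range f)" "f -` {y} \<in> sets borel" "f x = (\<Sum>y\<in>range f. indicator (f -` {y}) x *\<^sub>R y)"
proof -
  show fin: "finite (range f)"
    using simple_functionD(1)[OF assms] by simp
  show "f -` {y} \<in> sets borel"
    using simple_functionD(2)[OF assms, of "{y}"] by simp
  have "(\<Sum>y\<in>range f. indicator (f -` {y}) x *\<^sub>R y) = (\<Sum>y\<in>range f. if y = f x then y else 0)"
    by (intro sum.cong) (auto simp: indicator_def)
  then show "f x = (\<Sum>y\<in>range f. indicator (f -` {y}) x *\<^sub>R y)"
    using fin by simp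
qed

lemma bdd_borel_simple_function:
  fixes f :: "'g::topological_space \<Rightarrow> 'f::{second_countable_topology, real_normed_vector}"
  assumes "simple_function borel f"
  shows "bdd_borel f"
proof -
  have "bdd_borel (\<lambda>x. \<Sum>y\<in>range f. indicator (f -` {y}) x *\<^sub>R y)"
    using simple_function_borel_representation(2)[OF assms] by (intro bdd_borel_sum bdd_borel_indicator)
  then show ?thesis
    by (simp flip: simple_function_borel_representation(3)[OF assms])
qed

lemma bdd_borel_simple_approx:
  fixes f :: "'g::topological_space \<Rightarrow> 'f::{second_countable_topology, real_normed_vector}"
  assumes "bdd_borel f"
  obtains s B where "\<And>i. simple_function borel (s i)" "\<And>x. (\<lambda>i. s i x) \<longlonglongrightarrow> f x"
    "\<And>i x. norm (s i x) \<le> B"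
proof -
  obtain B where B: "\<And>x. norm (f x) \<le> B"
    using assms by (metis bdd_borelE)
  obtain s where "\<And>i. simple_function borel (s i)" "\<And>x. (\<lambda>i. s i x) \<longlonglongrightarrow> f x"
    "\<And>i x. norm (s i x) \<le> 2 * norm (f x)"
    using borel_measurable_implies_sequence_metric[OF bdd_borel_measurable[OF assms], of 0]
    by auto
  moreover from this have "norm (s i x) \<le> 2 * B" for i x
    using B[of x] by (meson mult_left_mono order_trans zero_le_numeral)
  ultimately show thesis
    by (intro that[of s "2 * B"]) auto
qed

text \<open>The limit case is uniformly bounded pointwise convergence, the mode in which
  \<open>rca_integral_lim\<close> passes to the limit. Identities between integrals thereby reduce
  to indicators.\<close>

lemma bdd_borel_induct [consumes 1, case_names indicator add lim]:
  fixes f :: "'g::topological_space \<Rightarrow> 'f::{second_countable_topology, real_normed_vector}"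
  assumes f: "bdd_borel f"
    and ind: "\<And>A c. A \<in> sets borel \<Longrightarrow> P (\<lambda>x. indicator A x *\<^sub>R c)"
    and add: "\<And>f g. bdd_borel f \<Longrightarrow> bdd_borel g \<Longrightarrow> P f \<Longrightarrow> P g \<Longrightarrow> P (\<lambda>x. f x + g x)"
    and lim: "\<And>s f B. (\<And>i. bdd_borel (s i)) \<Longrightarrow> (\<And>i. P (s i)) \<Longrightarrow> (\<And>i x. norm (s i x) \<le> B) \<Longrightarrow>
      (\<And>x. (\<lambda>i. s i x) \<longlonglongrightarrow> f x) \<Longrightarrow> bdd_borel f \<Longrightarrow> P f"
  shows "P f"
proof -
  have P_simple: "P s" if s: "simple_function borel s" for s
  proof -
    have "P (\<lambda>x. \<Sum>y\<in>F. indicator (s -` {y}) x *\<^sub>R y)" if "finite F" for F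
      using that
    proof (induction F)
      case empty
      then show ?case using ind[of "{}" 0] by simp
    next
      case (insert y F)
      have "P (\<lambda>x. indicator (s -` {y}) x *\<^sub>R y + (\<Sum>y\<in>F. indicator (s -` {y}) x *\<^sub>R y))"
        using simple_function_borel_representation(2)[OF s] insert
        by (intro add ind bdd_borel_sum bdd_borel_indicator)
      also have "(\<lambda>x. indicator (s -` {y}) x *\<^sub>R y + (\<Sum>y\<in>F. indicator (s -` {y}) x *\<^sub>R y))
          = (\<lambda>x. \<Sum>y\<in>insert y F. indicator (s -` {y}) x *\<^sub>R y)"
        by (rule ext, subst sum.insert[OF insert.hyps]) (rule refl)
      finally show ?case .
    qed
    from this[OF simple_function_borel_representation(1)[OF s]] show "P s"
      by (simp flip: simple_function_borel_representation(3)[OF s])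
  qed
  obtain s B where s: "\<And>i. simple_function borel (s i)" "\<And>x. (\<lambda>i. s i x) \<longlonglongrightarrow> f x"
    "\<And>i x. norm (s i x) \<le> B"
    using bdd_borel_simple_approx[OF f] by metis
  show ?thesis
    by (rule lim[of s B f]) (use s f in \<open>auto intro: P_simple bdd_borel_simple_function\<close>)
qed

lemma bdd_borel_integrable:
  fixes f :: "'g::topological_space \<Rightarrow> 'f::{second_countable_topology, banach}"
  assumes "bdd_borel f" "finite_measure M" "sets M = sets borel"
  shows "integrable M f"
proof -
  obtain B where "\<And>x. norm (f x) \<le> B"
    using assms(1) by (metis bdd_borelE)
  then show ?thesis
    using bdd_borel_measurable[OF assms(1)] measurable_cong_sets[OF assms(3) refl]
    by (intro finite_measure.integrable_const_bound[OF assms(2), of _ B]) auto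
qed

subsection \<open>Polar decomposition\<close>

text \<open>The sort \<open>{real_normed_field, euclidean_space}\<close> treats real and complex measures at once.\<close>

lemma real_density_exists:
  fixes n :: "('g::t2_space, real) rca" and m :: "('g, 'v::real_normed_vector) rca"
  assumes dom: "\<And>A. A \<in> sets borel \<Longrightarrow> \<bar>meas_of n A\<bar> \<le> measure (variation_measure m) A"
  shows "\<exists>h. integrable (variation_measure m) h \<and>
    (\<forall>A\<in>sets borel. meas_of n A = set_lebesgue_integral (variation_measure m) A h)"
proof -
  let ?V = "variation_measure m"
  define p where "p = abs_rca m + n"
  have p: "meas_of p A = measure ?V A + meas_of n A" for A
    by (simp add: p_def plus_rca.rep_eq meas_of_abs_rca)
  have "0 \<le> meas_of p A" for A
    using dom[of A] meas_of_notin[of A p] p[of A] by (cases "A \<in> sets borel") auto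
  then have "0 \<le> p" by (simp add: rca_nonneg_iff)
  note measure_p = measure_nonneg_rca[OF this]
  interpret V: finite_measure ?V by simp
  let ?N = "variation_measure p"
  interpret N: finite_measure ?N by simp
  have ac: "absolutely_continuous ?V ?N"
    unfolding absolutely_continuous_def
  proof
    fix A assume A: "A \<in> null_sets ?V"
    then have A': "A \<in> sets borel" "measure ?V A = 0"
      by (auto simp: null_sets_def measure_def)
    then have "measure ?N A = 0"
      using dom[of A] by (simp add: measure_p p)
    then show "A \<in> null_sets ?N"
      using A' by (simp add: null_sets_def N.emeasure_eq_measure)
  qed
  obtain D where D: "D \<in> borel_measurable ?V" "AE x in ?V. RN_deriv ?V ?N x = ennreal (D x)"
    "\<And>x. 0 \<le> D x"
    using V.real_RN_deriv[OF N.finite_measure_axioms ac] by auto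
  note [measurable] = D(1)
  have D_int: "has_bochner_integral ?V (\<lambda>x. indicator A x *\<^sub>R D x) (meas_of p A)" if A: "A \<in> sets borel" for A
  proof (rule has_bochner_integral_nn_integral)
    have "emeasure ?N A = emeasure (density ?V (RN_deriv ?V ?N)) A"
      using V.density_RN_deriv[OF ac] by simp
    also have "\<dots> = (\<integral>\<^sup>+x. RN_deriv ?V ?N x * indicator A x \<partial>?V)"
      using A by (intro emeasure_density) auto
    also have "\<dots> = (\<integral>\<^sup>+x. ennreal (indicator A x *\<^sub>R D x) \<partial>?V)"
      using D(2) by (intro nn_integral_cong_AE) (auto simp: indicator_def)
    finally show "(\<integral>\<^sup>+x. ennreal (indicator A x *\<^sub>R D x) \<partial>?V) = ennreal (meas_of p A)"
      by (simp add: N.emeasure_eq_measure measure_p)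
  qed (use A D(3) measure_p measure_nonneg in \<open>auto simp flip: measure_p\<close>)
  have 1: "integrable ?V D"
    using D_int[of UNIV] by (simp add: has_bochner_integral_iff)
  show ?thesis
  proof (intro exI[of _ "\<lambda>x. D x - 1"] conjI ballI)
    show "integrable ?V (\<lambda>x. D x - 1)" using 1 by auto
    fix A :: "'g set" assume A: "A \<in> sets borel"
    have "set_lebesgue_integral ?V A (\<lambda>x. D x - 1)
        = set_lebesgue_integral ?V A D - set_lebesgue_integral ?V A (\<lambda>x. 1)"
      using 1 A by (intro set_integral_diff) (auto simp: set_integrable_def less_top[symmetric] simp flip: real_scaleR_def
        intro: integrable_mult_indicator)
    also have "\<dots> = meas_of p A - measure ?V A"
      using D_int[OF A] A by (simp add: set_lebesgue_integral_def has_bochner_integral_iff)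
    finally show "meas_of n A = set_lebesgue_integral ?V A (\<lambda>x. D x - 1)"
      by (simp add: p)
  qed
qed

lift_definition component_rca :: "'v::euclidean_space \<Rightarrow> ('g::t2_space, 'v) rca \<Rightarrow> ('g, real) rca"
  is "\<lambda>b m A. m A \<bullet> b"
  by (rule is_rca_bounded_linear[OF bounded_linear_inner_left])

text \<open>Inner products with basis vectors do not exceed the norm, so each coordinate of
  \<open>m\<close> is dominated by |m| and the scalar case applies to it.\<close>

lemma density_exists:
  fixes m :: "('g::t2_space, 'f::{real_normed_field, euclidean_space}) rca"
  shows "\<exists>h. is_density m h"
proof -
  let ?V = "variation_measure m"
  interpret V: finite_measure ?V by simp
  have "\<exists>h. integrable ?V h \<and>
      (\<forall>A\<in>sets borel. meas_of (component_rca b m) A = set_lebesgue_integral ?V A h)" if "b \<in> Basis" for b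
  proof (rule real_density_exists)
    fix A :: "'g set" assume "A \<in> sets borel"
    then show "\<bar>meas_of (component_rca b m) A\<bar> \<le> measure ?V A"
      using Basis_le_norm[OF that, of "meas_of m A"] norm_meas_of_le[of A m]
      by (simp add: component_rca.rep_eq)
  qed
  then obtain h where h: "\<And>b. b \<in> Basis \<Longrightarrow> integrable ?V (h b)"
    "\<And>b A. b \<in> Basis \<Longrightarrow> A \<in> sets borel \<Longrightarrow> meas_of m A \<bullet> b = set_lebesgue_integral ?V A (h b)"
    by (simp add: component_rca.rep_eq) metis
  have "is_density m (\<lambda>x. \<Sum>b\<in>Basis. h b x *\<^sub>R b)"
    unfolding is_density_def
  proof (intro conjI ballI)
    show "integrable ?V (\<lambda>x. \<Sum>b\<in>Basis. h b x *\<^sub>R b)"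
      using h(1) by auto
    fix A :: "'g set" assume A: "A \<in> sets borel"
    have int: "integrable ?V (\<lambda>x. indicator A x *\<^sub>R h b x)" if "b \<in> Basis" for b
      using h(1)[OF that] A by (intro integrable_mult_indicator) auto
    have "set_lebesgue_integral ?V A (\<lambda>x. \<Sum>b\<in>Basis. h b x *\<^sub>R b)
        = (LINT x|?V. (\<Sum>b\<in>Basis. (indicator A x *\<^sub>R h b x) *\<^sub>R b))"
      unfolding set_lebesgue_integral_def by (simp add: scaleR_sum_right)
    also have "\<dots> = (\<Sum>b\<in>Basis. (LINT x|?V. indicator A x *\<^sub>R h b x) *\<^sub>R b)"
      using int by (subst Bochner_Integration.integral_sum) (auto intro!: sum.cong Bochner_Integration.integral_scaleR_left simp del: real_scaleR_def)
    also have "\<dots> = (\<Sum>b\<in>Basis. (meas_of m A \<bullet> b) *\<^sub>R b)"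
      using h(2)[OF _ A] by (simp add: set_lebesgue_integral_def)
    finally show "meas_of m A = set_lebesgue_integral ?V A (\<lambda>x. \<Sum>b\<in>Basis. h b x *\<^sub>R b)"
      by (simp add: euclidean_representation)
  qed
  then show ?thesis by blast
qed

text \<open>Names the choice made inside \<open>rca_integral\<close>.\<close>

definition polar :: "('g::t2_space, 'f::{real_normed_field, euclidean_space}) rca \<Rightarrow> 'g \<Rightarrow> 'f" where
  "polar m = (SOME h. is_density m h)"

lemma is_density_polar: "is_density m (polar m)"
  unfolding polar_def using density_exists by (rule someI_ex)

lemma integrable_polar: "integrable (variation_measure m) (polar m)"
  using is_density_polar[of m] by (simp add: is_density_def)

lemma meas_of_polar:
  "A \<in> sets borel \<Longrightarrow> meas_of m A = (LINT x|variation_measure m. indicator A x *\<^sub>R polar m x)"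
  using is_density_polar[of m] by (simp add: is_density_def set_lebesgue_integral_def)

lemma rca_integral_polar: "rca_integral m f = (LINT x|variation_measure m. f x * polar m x)"
  by (simp add: rca_integral_def polar_def)

lemma integrable_mult_polar:
  fixes m :: "('g::t2_space, 'f::{real_normed_field, euclidean_space}) rca"
  assumes "bdd_borel f"
  shows "integrable (variation_measure m) (\<lambda>x. f x * polar m x)"
proof -
  obtain B where B: "0 \<le> B" "\<And>x. norm (f x) \<le> B"
    using assms by (metis bdd_borelE)
  show ?thesis
  proof (rule Bochner_Integration.integrable_bound)
    show "integrable (variation_measure m) (\<lambda>x. B * norm (polar m x))"
      using integrable_polar[of m] by auto
    have "f \<in> borel_measurable (variation_measure m)"
      using bdd_borel_measurable[OF assms] by simp
    then show "(\<lambda>x. f x * polar m x) \<in> borel_measurable (variation_measure m)"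
      using borel_measurable_integrable[OF integrable_polar[of m]] by measurable
    show "AE x in variation_measure m. norm (f x * polar m x) \<le> norm (B * norm (polar m x))"
      using B by (auto simp: norm_mult intro!: mult_right_mono)
  qed
qed

section \<open>Linearity, dominated convergence and norm bounds for the integral against a fixed
  measure\<close>

context
  fixes m :: "('g::t2_space, 'f::{real_normed_field, euclidean_space}) rca"
begin

lemma rca_integral_indicator:
  assumes "A \<in> sets borel"
  shows "rca_integral m (\<lambda>x. indicator A x *\<^sub>R c) = c * meas_of m A"
proof -
  have "rca_integral m (\<lambda>x. indicator A x *\<^sub>R c)
      = (LINT x|variation_measure m. c * (indicator A x *\<^sub>R polar m x))"
    unfolding rca_integral_polar by (simp add: mult.commute)
  also have "\<dots> = c * (LINT x|variation_measure m. indicator A x *\<^sub>R polar m x)"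
    using integrable_mult_indicator[OF _ integrable_polar, of A m] assms
    by (intro Bochner_Integration.integral_mult_right) auto
  finally show ?thesis
    by (simp only: meas_of_polar[OF assms])
qed

lemma rca_integral_const: "rca_integral m (\<lambda>_. c) = c * meas_of m UNIV"
  using rca_integral_indicator[of UNIV c] by simp

lemma rca_integral_add:
  assumes "bdd_borel f" "bdd_borel g"
  shows "rca_integral m (\<lambda>x. f x + g x) = rca_integral m f + rca_integral m g"
  using integrable_mult_polar[OF assms(1), of m]
    integrable_mult_polar[OF assms(2), of m]
  unfolding rca_integral_polar by (simp add: distrib_right)

lemma rca_integral_mult_left:
  assumes "bdd_borel f"
  shows "rca_integral m (\<lambda>x. c * f x) = c * rca_integral m f"
  using integrable_mult_polar[OF assms, of m]
  unfolding rca_integral_polar by (simp add: mult.assoc)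

lemma rca_integral_sum:
  assumes "\<And>i. i \<in> F \<Longrightarrow> bdd_borel (f i)"
  shows "rca_integral m (\<lambda>x. \<Sum>i\<in>F. f i x) = (\<Sum>i\<in>F. rca_integral m (f i))"
  using assms
proof (induction F rule: infinite_finite_induct)
  case (insert i F)
  then show ?case by (simp add: rca_integral_add bdd_borel_sum)
qed (simp_all add: rca_integral_const)

lemma rca_integral_lim:
  assumes s: "\<And>i. bdd_borel (s i)" and B: "\<And>i x. norm (s i x) \<le> B"
    and lim: "\<And>x. (\<lambda>i. s i x) \<longlonglongrightarrow> f x"
  shows "(\<lambda>i. rca_integral m (s i)) \<longlonglongrightarrow> rca_integral m f"
  unfolding rca_integral_polar
proof (rule integral_dominated_convergence)
  show "integrable (variation_measure m) (\<lambda>x. B * norm (polar m x))"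
    using integrable_polar[of m] by auto
  show *: "(\<lambda>x. s i x * polar m x) \<in> borel_measurable (variation_measure m)" for i
    using integrable_mult_polar[OF s, of m] by (rule borel_measurable_integrable)
  show **: "AE x in variation_measure m. (\<lambda>i. s i x * polar m x) \<longlonglongrightarrow> f x * polar m x"
    using lim by (auto intro!: tendsto_mult)
  have "f \<in> borel_measurable borel"
    by (rule borel_measurable_LIMSEQ_metric[of s]) (simp_all add: lim bdd_borel_measurable s)
  then have "f \<in> borel_measurable (variation_measure m)" by simp
  then show "(\<lambda>x. f x * polar m x) \<in> borel_measurable (variation_measure m)"
    using borel_measurable_integrable[OF integrable_polar[of m]] by measurable
  show "AE x in variation_measure m. norm (s i x * polar m x) \<le> B * norm (polar m x)" for i
    using B by (auto simp: norm_mult intro!: mult_right_mono)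
qed

text \<open>The modulus of the density is not computed. For simple functions the bound is the
  triangle inequality together with \<open>norm_meas_of_le\<close>, and bounded pointwise limits
  carry it over.\<close>

lemma norm_rca_integral_le:
  assumes f: "bdd_borel f"
  shows "norm (rca_integral m f) \<le> (LINT x|variation_measure m. norm (f x))"
proof -
  let ?V = "variation_measure m"
  interpret V: finite_measure ?V by simp
  have simple: "norm (rca_integral m s) \<le> (LINT x|?V. norm (s x))" if s: "simple_function borel s" for s
  proof -
    note r = simple_function_borel_representation[OF s]
    have "rca_integral m s = rca_integral m (\<lambda>x. \<Sum>y\<in>range s. indicator (s -` {y}) x *\<^sub>R y)"
      by (simp flip: r(3))
    also have "\<dots> = (\<Sum>y\<in>range s. y * meas_of m (s -` {y}))"
      using r(2) by (subst rca_integral_sum) (auto intro: bdd_borel_indicator simp: rca_integral_indicator)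
    also have "norm \<dots> \<le> (\<Sum>y\<in>range s. norm y * measure ?V (s -` {y}))"
      using r(2) by (intro sum_norm_le) (auto simp: norm_mult intro!: mult_left_mono norm_meas_of_le)
    also have "\<dots> = (\<Sum>y\<in>range s. (LINT x|?V. indicator (s -` {y}) x * norm y))"
      using r(2) by (intro sum.cong) (auto simp: mult.commute)
    also have "\<dots> = (LINT x|?V. (\<Sum>y\<in>range s. indicator (s -` {y}) x * norm y))"
      using r(2) by (intro Bochner_Integration.integral_sum[symmetric]) (auto simp: less_top[symmetric])
    also have "(\<lambda>x. \<Sum>y\<in>range s. indicator (s -` {y}) x * norm y) = (\<lambda>x. norm (s x))"
    proof
      fix x
      have "(\<Sum>y\<in>range s. indicator (s -` {y}) x * norm y) = (\<Sum>y\<in>range s. if y = s x then norm y else 0)"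
        by (intro sum.cong) (auto simp: indicator_def)
      then show "(\<Sum>y\<in>range s. indicator (s -` {y}) x * norm y) = norm (s x)"
        using r(1) by simp
    qed
    finally show ?thesis .
  qed
  obtain s B where s: "\<And>i. simple_function borel (s i)" "\<And>x. (\<lambda>i. s i x) \<longlonglongrightarrow> f x"
    "\<And>i x. norm (s i x) \<le> B"
    using bdd_borel_simple_approx[OF f] by metis
  have sm: "s i \<in> borel_measurable borel" for i
    using s(1) by (rule borel_measurable_simple_function)
  show ?thesis
  proof (rule LIMSEQ_le)
    show "(\<lambda>i. norm (rca_integral m (s i))) \<longlonglongrightarrow> norm (rca_integral m f)"
      using s by (intro tendsto_norm rca_integral_lim) (auto intro: bdd_borel_simple_function)
    show "(\<lambda>i. LINT x|?V. norm (s i x)) \<longlonglongrightarrow> (LINT x|?V. norm (f x))"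
      using s sm bdd_borel_measurable[OF f]
      by (intro integral_dominated_convergence[where w = "\<lambda>_. B"]) (auto intro!: AE_I2 tendsto_norm)
    show "\<exists>N. \<forall>n\<ge>N. norm (rca_integral m (s n)) \<le> (LINT x|?V. norm (s n x))"
      using simple s(1) by blast
  qed
qed

lemma norm_rca_integral_le_bound:
  assumes f: "bdd_borel f" and B: "\<And>x. norm (f x) \<le> B"
  shows "norm (rca_integral m f) \<le> B * norm m"
proof -
  interpret V: finite_measure "variation_measure m" by simp
  have "norm (rca_integral m f) \<le> (LINT x|variation_measure m. norm (f x))"
    by (rule norm_rca_integral_le[OF f])
  also have "\<dots> \<le> (LINT x|variation_measure m. B)"
    using bdd_borel_integrable[OF f, of "variation_measure m"] B by (intro integral_mono) auto
  finally show ?thesis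
    by (simp add: norm_rca_eq_measure mult.commute)
qed

end

subsection \<open>Dependence of the integral on the measure\<close>

text \<open>The densities of \<open>m\<close>, \<open>n\<close> and \<open>m + n\<close> refer to
  three different variation measures, so the integrals are compared through their values on
  indicators instead.\<close>

lemma rca_integral_add_rca:
  fixes m n :: "('g::t2_space, 'f::{real_normed_field, euclidean_space}) rca"
  assumes "bdd_borel f"
  shows "rca_integral (m + n) f = rca_integral m f + rca_integral n f"
  using assms
proof (induction rule: bdd_borel_induct)
  case (indicator A c)
  then show ?case by (simp add: rca_integral_indicator plus_rca.rep_eq algebra_simps)
next
  case (add f g)
  then show ?case by (simp add: rca_integral_add)
next
  case (lim s f B)
  have "(\<lambda>i. rca_integral (m + n) (s i)) \<longlonglongrightarrow> rca_integral (m + n) f"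
    using lim by (intro rca_integral_lim) auto
  moreover have "(\<lambda>i. rca_integral m (s i) + rca_integral n (s i)) \<longlonglongrightarrow> rca_integral m f + rca_integral n f"
    using lim by (intro tendsto_add rca_integral_lim) auto
  ultimately show ?case
    using lim by (simp add: LIMSEQ_unique)
qed

lemma rca_integral_scale_rca:
  fixes m :: "('g::t2_space, 'f::{real_normed_field, euclidean_space}) rca"
  assumes "bdd_borel f"
  shows "rca_integral (scale_rca c m) f = c * rca_integral m f"
  using assms
proof (induction rule: bdd_borel_induct)
  case (indicator A c)
  then show ?case by (simp add: rca_integral_indicator scale_rca.rep_eq)
next
  case (add f g)
  then show ?case by (simp add: rca_integral_add algebra_simps)
next
  case (lim s f B)
  have "(\<lambda>i. rca_integral (scale_rca c m) (s i)) \<longlonglongrightarrow> rca_integral (scale_rca c m) f"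
    using lim by (intro rca_integral_lim) auto
  moreover have "(\<lambda>i. c * rca_integral m (s i)) \<longlonglongrightarrow> c * rca_integral m f"
    using lim by (intro tendsto_mult_left rca_integral_lim) auto
  ultimately show ?case
    using lim by (simp add: LIMSEQ_unique)
qed

text \<open>An embedding of M(G,R) into M(G,F) for both scalar fields: the identity for real scalars
  and \<open>complex_rca\<close> for complex ones. Estimates for
  \<open>m \<star> of_real_rca n\<close> with positive \<open>n\<close> then cover both cases at
  once.\<close>

lift_definition of_real_rca :: "('g::t2_space, real) rca \<Rightarrow> ('g, 'f::real_normed_field) rca"
  is "\<lambda>m A. of_real (m A)"
  by (rule is_rca_bounded_linear[OF bounded_linear_of_real])

lemma rca_integral_of_real_rca:
  fixes m :: "('g::t2_space, real) rca" and f :: "'g \<Rightarrow> 'f::{real_normed_field, euclidean_space}"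
  assumes m: "0 \<le> m" and f: "bdd_borel f"
  shows "rca_integral (of_real_rca m) f = (LINT x|variation_measure m. f x)"
  using f
proof (induction rule: bdd_borel_induct)
  case (indicator A c)
  interpret V: finite_measure "variation_measure m" by simp
  have "(LINT x|variation_measure m. indicator A x *\<^sub>R c) = measure (variation_measure m) A *\<^sub>R c"
    using indicator by (subst Bochner_Integration.integral_scaleR_left) (auto simp: less_top[symmetric])
  also have "\<dots> = c * of_real (meas_of m A)"
    by (simp only: measure_nonneg_rca[OF m] scaleR_conv_of_real mult.commute)
  finally show ?case
    using indicator by (simp only: rca_integral_indicator of_real_rca.rep_eq)
next
  case (add f g)
  then show ?case
    by (simp add: rca_integral_add bdd_borel_integrable)
next
  case (lim s f B)
  interpret V: finite_measure "variation_measure m" by simp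
  have "(\<lambda>i. rca_integral (of_real_rca m) (s i)) \<longlonglongrightarrow> rca_integral (of_real_rca m) f"
    using lim by (intro rca_integral_lim) auto
  moreover have "(\<lambda>i. LINT x|variation_measure m. s i x) \<longlonglongrightarrow> (LINT x|variation_measure m. f x)"
    using \<open>\<And>i x. norm (s i x) \<le> B\<close> \<open>\<And>x. (\<lambda>i. s i x) \<longlonglongrightarrow> f x\<close>
      bdd_borel_measurable_variation_measure[OF \<open>\<And>i. bdd_borel (s i)\<close>]
      bdd_borel_measurable_variation_measure[OF \<open>bdd_borel f\<close>]
    by (intro integral_dominated_convergence[where w = "\<lambda>_. B"]) auto
  ultimately show ?case
    using lim by (simp add: LIMSEQ_unique)
qed

lemma of_real_rca_real [simp]: "of_real_rca m = m"
  by (rule rca_eqI) (simp add: of_real_rca.rep_eq)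

lemma rca_integral_of_real:
  fixes m :: "('g::t2_space, real) rca"
  assumes "bdd_borel f"
  shows "rca_integral (of_real_rca m :: ('g, 'f::{real_normed_field, euclidean_space}) rca) (\<lambda>x. of_real (f x))
    = of_real (rca_integral m f)"
  using assms
proof (induction rule: bdd_borel_induct)
  case (indicator A c)
  have "(\<lambda>x. of_real (indicator A x *\<^sub>R c) :: 'f) = (\<lambda>x. indicator A x *\<^sub>R of_real c)"
    by (auto simp: indicator_def)
  then show ?case
    using indicator by (simp only: rca_integral_indicator of_real_rca.rep_eq of_real_mult)
next
  case (add f g)
  then have "bdd_borel (\<lambda>x. of_real (f x) :: 'f)" "bdd_borel (\<lambda>x. of_real (g x) :: 'f)"
    by (auto intro: bdd_borel_of_real)
  then show ?case using add by (simp add: rca_integral_add)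
next
  case (lim s f B)
  have "(\<lambda>i. rca_integral (of_real_rca m) (\<lambda>x. of_real (s i x) :: 'f)) \<longlonglongrightarrow> rca_integral (of_real_rca m) (\<lambda>x. of_real (f x))"
    using lim by (intro rca_integral_lim[where B = B]) (auto intro: bdd_borel_of_real tendsto_of_real)
  moreover have "(\<lambda>i. of_real (rca_integral m (s i)) :: 'f) \<longlonglongrightarrow> of_real (rca_integral m f)"
    using lim by (intro tendsto_of_real rca_integral_lim) auto
  ultimately show ?case
    using lim by (simp add: LIMSEQ_unique)
qed

section \<open>Regularity\<close>

lemma Hausdorff_space_euclidean_t2: "Hausdorff_space (euclidean :: 'a::t2_space topology)"
  unfolding Hausdorff_space_def disjnt_def by (simp, metis hausdorff)

lemma meas_of_is_rca: "is_rca (meas_of m)"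
  using meas_of[of m] by simp

lemma rca_regular_approx:
  fixes m :: "('g::t2_space, 'v::real_normed_vector) rca"
  assumes A: "A \<in> sets borel" and e: "0 < e"
  obtains K U where "compact K" "open U" "K \<subseteq> A" "A \<subseteq> U"
    "measure (variation_measure m) A \<le> measure (variation_measure m) K + e"
    "measure (variation_measure m) U \<le> measure (variation_measure m) A + e"
proof -
  obtain K U where KU: "compact K" "open U" "K \<subseteq> A" "A \<subseteq> U"
    "variation (meas_of m) A \<le> variation (meas_of m) K + ennreal e"
    "variation (meas_of m) U \<le> variation (meas_of m) A + ennreal e"
    by (rule regular_approx[OF meas_of_is_rca A e])
  have [simp]: "variation (meas_of m) B = ennreal (measure (variation_measure m) B)" if "B \<in> sets borel" for B
    by (rule ennreal_measure_variation_measure[OF that, symmetric])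
  have "K \<in> sets borel" "U \<in> sets borel"
    using KU by (auto intro: borel_compact)
  then show thesis
    using KU A e by (intro that[of K U]) (simp_all flip: ennreal_plus)
qed

text \<open>The sets that can be squeezed between a compact and an open set up to small measure form
  a sigma-algebra. The hypothesis \<open>inner\<close> puts the open sets into it.\<close>

lemma finite_measure_regular_approx:
  fixes M :: "'g::t2_space measure"
  assumes "finite_measure M" and sets_M: "sets M = sets borel"
    and inner: "\<And>U e. open U \<Longrightarrow> 0 < e \<Longrightarrow> \<exists>K. compact K \<and> K \<subseteq> U \<and> measure M U \<le> measure M K + e"
    and A: "A \<in> sets borel" and e: "0 < e"
  shows "\<exists>K U. compact K \<and> open U \<and> K \<subseteq> A \<and> A \<subseteq> U \<and> measure M (U - K) \<le> e"
proof -
  interpret finite_measure M by fact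
  note [simp] = sets_M
  have [simp]: "compact K \<Longrightarrow> K \<in> sets borel" for K :: "'g set"
    by (rule borel_compact)
  have "A \<in> sigma_sets UNIV {S. open S}"
    using A by (simp add: borel_def)
  then show ?thesis
    using e
  proof (induction arbitrary: e)
    case (Basic U)
    then obtain K where K: "compact K" "K \<subseteq> U" "measure M U \<le> measure M K + e"
      using inner by blast
    then have "measure M (U - K) \<le> e"
      using Basic by (subst finite_measure_Diff) auto
    then show ?case using K Basic by blast
  next
    case Empty
    then show ?case by (intro exI[of _ "{}"]) auto
  next
    case (Compl A)
    obtain K U where KU: "compact K" "open U" "K \<subseteq> A" "A \<subseteq> U" "measure M (U - K) \<le> e / 2"
      using Compl.IH[of "e / 2"] Compl.prems by auto
    \<comment> \<open>The complement of \<open>U\<close> is closed but need not be compact. It is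
      cut down by a compact set that carries all but e / 2 of the total mass.\<close>
    obtain K0 where K0: "compact K0" "measure M UNIV \<le> measure M K0 + e / 2"
      using inner[of UNIV "e / 2"] Compl.prems by auto
    have [simp]: "K \<in> sets borel" "U \<in> sets borel" "K0 \<in> sets borel"
      using KU K0 by auto
    have "measure M (UNIV - K0) \<le> e / 2"
      using K0 by (subst finite_measure_Diff) auto
    moreover have "measure M (- K - (K0 - U)) \<le> measure M ((U - K) \<union> (UNIV - K0))"
    proof (rule finite_measure_mono)
      show "U - K \<union> (UNIV - K0) \<in> sets M"
        unfolding sets_M by (intro sets.Un sets.Diff) simp_all
    qed auto
    moreover have "\<dots> \<le> measure M (U - K) + measure M (UNIV - K0)"
      by (intro measure_Un_le) (simp_all add: sets.Diff)
    ultimately have "measure M (- K - (K0 - U)) \<le> e"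
      using KU(5) by linarith
    moreover have "compact (K0 - U)" "open (- K)"
      using KU K0 by (auto intro: compact_diff compact_imp_closed)
    ultimately show ?case
      using KU by (intro exI[of _ "K0 - U"] exI[of _ "- K"]) auto
  next
    case (Union A)
    \<comment> \<open>The errors \<open>d i\<close> add up to e / 2. The slack that remains pays for
      replacing the union of all \<open>K i\<close>, which need not be compact, by a finite
      union.\<close>
    define d where "d i = e / 2 * (1 / 2) ^ Suc i" for i
    have d_pos: "0 < d i" for i
      using Union.prems by (simp add: d_def)
    have d_sums: "d sums (e / 2)"
      unfolding d_def using sums_mult[OF power_half_series, of "e / 2"] by simp
    have "\<exists>K U. compact K \<and> open U \<and> K \<subseteq> A i \<and> A i \<subseteq> U \<and> measure M (U - K) \<le> d i" for i
      using Union.IH d_pos by blast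
    then obtain K U where KU: "\<And>i. compact (K i)" "\<And>i. open (U i)" "\<And>i. K i \<subseteq> A i" "\<And>i. A i \<subseteq> U i"
      "\<And>i. measure M (U i - K i) \<le> d i"
      by metis
    have [simp]: "U i \<in> sets borel" "K i \<in> sets borel" for i
      using KU by auto
    have [simp]: "(\<Union>i. U i) - (\<Union>i\<in>I. K i) \<in> sets borel" "(\<Union>i. U i - K i) \<in> sets borel" for I
      by (intro sets.Diff sets.countable_UN'; simp add: image_subset_iff sets.Diff)+
    have sum_le: "summable (\<lambda>i. measure M (U i - K i))"
      using KU(5) by (intro summable_comparison_test'[OF sums_summable[OF d_sums], of 0]) simp
    have "measure M ((\<Union>i. U i) - (\<Union>i. K i)) \<le> measure M (\<Union>i. U i - K i)"
      by (intro finite_measure_mono) auto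
    also have "\<dots> \<le> (\<Sum>i. measure M (U i - K i))"
      using sum_le by (intro finite_measure_subadditive_countably) auto
    also have "\<dots> \<le> (\<Sum>i. d i)"
      using sum_le sums_summable[OF d_sums] KU(5) by (intro suminf_le) auto
    also have "\<dots> = e / 2"
      using d_sums by (simp add: sums_iff)
    finally have lim_le: "measure M ((\<Union>i. U i) - (\<Union>i. K i)) \<le> e / 2" .
    have "(\<lambda>n. measure M ((\<Union>i. U i) - (\<Union>i<n. K i))) \<longlonglongrightarrow> measure M (\<Inter>n. (\<Union>i. U i) - (\<Union>i<n. K i))"
      by (intro finite_Lim_measure_decseq) (auto simp: decseq_def)
    moreover have "(\<Inter>n. (\<Union>i. U i) - (\<Union>i<n. K i)) = (\<Union>i. U i) - (\<Union>i. K i)"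
      by auto
    ultimately have "(\<lambda>n. measure M ((\<Union>i. U i) - (\<Union>i<n. K i)))
        \<longlonglongrightarrow> measure M ((\<Union>i. U i) - (\<Union>i. K i))"
      by simp
    from order_tendstoD(2)[OF this, of e]
    have "\<forall>\<^sub>F n in sequentially. measure M ((\<Union>i. U i) - (\<Union>i<n. K i)) < e"
      using lim_le Union.prems by simp
    then obtain n where n: "measure M ((\<Union>i. U i) - (\<Union>i<n. K i)) < e"
      by (auto simp: eventually_sequentially)
    show ?case
    proof (intro exI conjI)
      show "compact (\<Union>i<n. K i)" "open (\<Union>i. U i)"
        using KU by (auto intro: compact_UN)
      show "measure M ((\<Union>i. U i) - (\<Union>i<n. K i)) \<le> e"
        using n by simp
    qed (auto dest: subsetD[OF KU(3)] subsetD[OF KU(4)])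
  qed
qed

text \<open>Reduces the regularity of a positive convolution to inner regularity on open sets:
  \<open>finite_measure_regular_approx\<close> yields inner and outer approximation of every Borel
  set.\<close>

lemma is_rca_nonnegI:
  fixes l :: "'g::t2_space set \<Rightarrow> real"
  assumes l0: "\<And>A. A \<notin> sets borel \<Longrightarrow> l A = 0" and bca: "borel_countably_additive l"
    and pos: "\<And>A. A \<in> sets borel \<Longrightarrow> 0 \<le> l A"
    and inner: "\<And>U e. open U \<Longrightarrow> 0 < e \<Longrightarrow> \<exists>K. compact K \<and> K \<subseteq> U \<and> l U \<le> l K + e"
  shows "is_rca l"
proof -
  \<comment> \<open>For nonnegative \<open>l\<close> this is \<open>l\<close> itself; going through
    its variation makes \<open>measure_space_variation\<close> applicable.\<close>
  define M where "M = measure_of UNIV (sets borel) (variation l)"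
  have sets_M: "sets M = sets borel"
    unfolding M_def using sets.sigma_sets_eq[of "borel :: 'g measure"] by (simp add: sets_measure_of_conv)
  have space_M: "space M = UNIV"
    by (simp add: M_def space_measure_of_conv)
  have emeasure_M: "emeasure M A = ennreal (l A)" if "A \<in> sets borel" for A
    using measure_space_variation[OF bca] that sets.sigma_algebra_axioms[of borel] pos
      emeasure_measure_of_sigma[of UNIV "sets borel" "variation l" A]
    unfolding measure_space_def M_def by (simp add: variation_nonneg[OF bca pos])
  then have measure_M: "measure M A = l A" if "A \<in> sets borel" for A
    using that pos by (simp add: measure_def)
  interpret finite_measure M
    by standard (simp add: space_M emeasure_M)
  have approx: "\<exists>K U. compact K \<and> open U \<and> K \<subseteq> A \<and> A \<subseteq> U \<and> measure M (U - K) \<le> e"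
    if A: "A \<in> sets borel" "0 < e" for A e
  proof (rule finite_measure_regular_approx[OF finite_measure_axioms sets_M _ A])
    fix U :: "'g set" and e :: real
    assume "open U" "0 < e"
    then show "\<exists>K. compact K \<and> K \<subseteq> U \<and> measure M U \<le> measure M K + e"
      using inner[of U e] by (metis borel_compact borel_open measure_M)
  qed
  have var: "variation l A = ennreal (measure M A)" if "A \<in> sets borel" for A
    using that variation_nonneg[OF bca pos] by (simp add: measure_M)
  have "regular_variation l"
    unfolding regular_variation_def
  proof (intro ballI conjI antisym)
    fix A :: "'g set" assume A: "A \<in> sets borel"
    show "variation l A \<le> (INF U \<in> {U. A \<subseteq> U \<and> open U}. variation l U)"
      using A by (intro INF_greatest variation_mono) auto
    show "(SUP K \<in> {K. K \<subseteq> A \<and> compact K}. variation l K) \<le> variation l A"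
      using A by (intro SUP_least variation_mono) (auto intro: borel_compact)
    have *: "\<exists>K U. compact K \<and> open U \<and> K \<subseteq> A \<and> A \<subseteq> U \<and>
        variation l U \<le> variation l A + ennreal e \<and> variation l A \<le> variation l K + ennreal e" if e_pos: "0 < e" for e
    proof -
      obtain K U where KU: "compact K" "open U" "K \<subseteq> A" "A \<subseteq> U" "measure M (U - K) \<le> e"
        using approx[OF A e_pos] by blast
      have KU': "K \<in> sets borel" "U \<in> sets borel"
        using KU by (auto intro: borel_compact)
      have "measure M (U - K) = measure M U - measure M K"
        using KU KU' by (intro finite_measure_Diff) (auto simp: sets_M)
      moreover have "measure M K \<le> measure M A" "measure M A \<le> measure M U"
        using KU KU' A by (auto intro!: finite_measure_mono simp: sets_M)
      ultimately have "measure M U \<le> measure M A + e" "measure M A \<le> measure M K + e"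
        using KU(5) by auto
      then have "variation l U \<le> variation l A + ennreal e \<and> variation l A \<le> variation l K + ennreal e"
        using KU' A e_pos by (simp add: var ennreal_leI flip: ennreal_plus)
      then show ?thesis using KU by blast
    qed
    show "(INF U \<in> {U. A \<subseteq> U \<and> open U}. variation l U) \<le> variation l A"
    proof (rule ennreal_le_epsilon)
      fix e :: real assume "0 < e"
      then obtain U where U: "open U" "A \<subseteq> U" "variation l U \<le> variation l A + ennreal e"
        using * by meson
      then show "(INF U \<in> {U. A \<subseteq> U \<and> open U}. variation l U) \<le> variation l A + ennreal e"
        by (intro INF_lower2[of U]) auto
    qed
    show "variation l A \<le> (SUP K \<in> {K. K \<subseteq> A \<and> compact K}. variation l K)"
    proof (rule ennreal_le_epsilon)
      fix e :: real assume "0 < e"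
      then obtain K where K: "compact K" "K \<subseteq> A" "variation l A \<le> variation l K + ennreal e"
        using * by meson
      then have "variation l K \<le> (SUP K \<in> {K. K \<subseteq> A \<and> compact K}. variation l K)"
        by (intro SUP_upper) auto
      with K show "variation l A \<le> (SUP K \<in> {K. K \<subseteq> A \<and> compact K}. variation l K) + ennreal e"
        by (meson add_right_mono order_trans)
    qed
  qed
  moreover have "variation l UNIV < \<infinity>"
    by (simp add: var)
  ultimately show ?thesis
    using l0 bca unfolding is_rca_def by blast
qed

section \<open>Translates of measures\<close>

lemma open_translation_tube:
  fixes K :: "'g::topological_group_add set"
  assumes "compact K" "open U" "\<And>s. s \<in> K \<Longrightarrow> s + t0 \<in> U"
  shows "\<exists>V. open V \<and> t0 \<in> V \<and> (\<forall>t\<in>V. \<forall>s\<in>K. s + t \<in> U)"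
proof -
  \<comment> \<open>The coordinates are swapped because the tube lemma thickens the point in the
    first factor.\<close>
  let ?W = "(\<lambda>p. snd p + fst p) -` U"
  have W: "open ?W"
    using assms(2) by (intro open_vimage continuous_intros)
  have "{t0} \<times> K \<subseteq> ?W" using assms(3) by auto
  from Elementary_Topology.tube_lemma[OF assms(1) W this]
  obtain V where "t0 \<in> V" "open V" "V \<times> K \<subseteq> ?W" by blast
  then show ?thesis by (intro exI[of _ V]) auto
qed

lemma borel_translate [measurable]:
  fixes A :: "'g::topological_group_add set"
  assumes "A \<in> sets borel"
  shows "{s. s + t \<in> A} \<in> sets borel"
proof -
  have "(\<lambda>s. s + t) \<in> borel_measurable borel"
    by (intro borel_measurable_continuous_onI continuous_intros)
  from measurable_sets[OF this assms] show ?thesis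
    by (simp add: vimage_def)
qed

section \<open>Semicontinuity and measurability of the mass of translates\<close>

lemma nonneg_rca_mono:
  fixes m :: "('g::t2_space, real) rca"
  assumes "0 \<le> m" "B \<in> sets borel" "A \<subseteq> B"
  shows "meas_of m A \<le> meas_of m B"
  using assms finite_measure.finite_measure_mono[of "variation_measure m" A B]
  by (simp add: measure_nonneg_rca)

lemma nonneg_rca_inner_regular:
  fixes m :: "('g::t2_space, real) rca"
  assumes "0 \<le> m" "A \<in> sets borel" "r < meas_of m A"
  obtains K where "compact K" "K \<subseteq> A" "r < meas_of m K"
proof -
  define e where "e = (meas_of m A - r) / 2"
  have e: "0 < e" using assms(3) by (simp add: e_def)
  show thesis
  proof (rule rca_regular_approx[OF assms(2) e, of m])
    fix K U :: "'g set"
    assume "compact K" "K \<subseteq> A" "measure (variation_measure m) A \<le> measure (variation_measure m) K + e"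
    moreover from this have "r < meas_of m K"
      using e by (simp add: measure_nonneg_rca[OF assms(1)] e_def field_simps)
    ultimately show thesis using that by blast
  qed
qed

text \<open>Lower semicontinuity: a compact set of mass above r whose translate by t lies in
  \<open>U\<close> is still translated into \<open>U\<close> by all points near t.\<close>

lemma open_meas_of_translate_greater:
  fixes m :: "('g::{topological_group_add, t2_space}, real) rca"
  assumes m: "0 \<le> m" and U: "open U"
  shows "open {t. r < meas_of m {s. s + t \<in> U}}"
proof (subst open_subopen, intro ballI)
  fix t assume "t \<in> {t. r < meas_of m {s. s + t \<in> U}}"
  then have "r < meas_of m {s. s + t \<in> U}" by simp
  then obtain K where K: "compact K" "K \<subseteq> {s. s + t \<in> U}" "r < meas_of m K"
    using nonneg_rca_inner_regular[OF m borel_translate[OF borel_open[OF U]]] by metis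
  have "s + t \<in> U" if "s \<in> K" for s using K(2) that by blast
  from open_translation_tube[OF K(1) U this]
  obtain V where V: "open V" "t \<in> V" "\<forall>t\<in>V. \<forall>s\<in>K. s + t \<in> U" by blast
  have "V \<subseteq> {t. r < meas_of m {s. s + t \<in> U}}"
  proof
    fix t assume "t \<in> V"
    then have "meas_of m K \<le> meas_of m {s. s + t \<in> U}"
      using V U by (intro nonneg_rca_mono[OF m]) auto
    then show "t \<in> {t. r < meas_of m {s. s + t \<in> U}}" using K(3) by simp
  qed
  then show "\<exists>T. open T \<and> t \<in> T \<and> T \<subseteq> {t. r < meas_of m {s. s + t \<in> U}}"
    using V by blast
qed

text \<open>Countable additivity speaks about disjoint unions, so the pi-lambda theorem is used,
  with the intersection-stable family of open sets as generator.\<close>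

lemma borel_induct_disjoint [consumes 1, case_names opens compl union]:
  assumes A: "A \<in> sets borel"
    and "\<And>U. open U \<Longrightarrow> P U"
    and "\<And>A. A \<in> sets borel \<Longrightarrow> P A \<Longrightarrow> P (- A)"
    and "\<And>A :: nat \<Rightarrow> 'a::topological_space set. disjoint_family A \<Longrightarrow> (\<And>i. A i \<in> sets borel) \<Longrightarrow> (\<And>i. P (A i)) \<Longrightarrow> P (\<Union>i. A i)"
  shows "P (A :: 'a set)"
proof -
  have borel: "sets borel = sigma_sets (UNIV :: 'a set) {S. open S}"
    by (simp add: borel_def)
  have "Int_stable {S :: 'a set. open S}" "{S :: 'a set. open S} \<subseteq> Pow UNIV"
    by (auto simp: Int_stable_def)
  then show ?thesis
    using A unfolding borel
    by (rule sigma_sets_induct_disjoint[where P = P])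
      (use assms(2-) in \<open>simp_all add: borel Compl_eq_Diff_UNIV image_subset_iff\<close>)
qed

lemma meas_of_translate_sums:
  assumes "disjoint_family A" "\<And>i. A i \<in> sets borel"
  shows "(\<lambda>i. meas_of m {s::'g::{topological_group_add, t2_space}. s + t \<in> A i}) sums
    meas_of m {s. s + t \<in> (\<Union>i::nat. A i)}"
proof -
  have "(\<lambda>i. meas_of m {s. s + t \<in> A i}) sums meas_of m (\<Union>i. {s. s + t \<in> A i})"
    using assms by (intro bca_sums[OF bca_meas_of]) (auto simp: disjoint_family_on_def)
  moreover have "(\<Union>i. {s. s + t \<in> A i}) = {s. s + t \<in> (\<Union>i. A i)}" by auto
  ultimately show ?thesis by simp
qed

lemma borel_measurable_meas_of_translate_nonneg:
  fixes m :: "('g::{topological_group_add, t2_space}, real) rca"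
  assumes m: "0 \<le> m" and A: "A \<in> sets borel"
  shows "(\<lambda>t. meas_of m {s. s + t \<in> A}) \<in> borel_measurable borel"
  using A
proof (induction rule: borel_induct_disjoint)
  case (opens U)
  then show ?case
    using open_meas_of_translate_greater[OF m opens] by (intro borel_measurableI_greater) auto
next
  case (compl A)
  have "meas_of m {s. s + t \<in> - A} = meas_of m UNIV - meas_of m {s. s + t \<in> A}" for t
    using meas_of_diff[of UNIV "{s. s + t \<in> A}" m] compl by (simp add: set_diff_eq)
  then show ?case using compl by simp
next
  case (union A)
  have "(\<lambda>t. \<Sum>i. meas_of m {s. s + t \<in> A i}) \<in> borel_measurable borel"
    using union by (intro borel_measurable_suminf) auto
  moreover have "(\<Sum>i. meas_of m {s. s + t \<in> A i}) = meas_of m {s. s + t \<in> (\<Union>i. A i)}" for t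
    using meas_of_translate_sums[of A m] union by (simp add: sums_iff)
  ultimately show ?case by simp
qed

lemma bdd_borel_meas_of_translate:
  fixes m :: "('g::{topological_group_add, t2_space}, 'f::euclidean_space) rca"
  assumes A: "A \<in> sets borel"
  shows "bdd_borel (\<lambda>t. meas_of m {s. s + t \<in> A})"
proof (rule bdd_borelI)
  show "norm (meas_of m {s. s + t \<in> A}) \<le> norm m" for t
    using norm_meas_of_le[OF borel_translate[OF A, of t], of m]
      finite_measure.bounded_measure[OF finite_measure_variation_measure[of m], of "{s. s + t \<in> A}"]
    by (simp add: norm_rca_eq_measure)
  have "(\<lambda>t. meas_of (component_rca b m) {s. s + t \<in> A}) \<in> borel_measurable borel" if "b \<in> Basis" for b
  proof -
    \<comment> \<open>Each coordinate of \<open>m\<close> is the difference of the positive measures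
      |m| and |m| minus that coordinate, and for positive measures measurability is known.\<close>
    have p: "0 \<le> abs_rca m - component_rca b m"
      unfolding rca_nonneg_iff
    proof
      fix A :: "'g set"
      show "0 \<le> meas_of (abs_rca m - component_rca b m) A"
        using Basis_le_norm[OF that, of "meas_of m A"] norm_meas_of_le[of A m]
          meas_of_notin[of A "abs_rca m - component_rca b m"]
        by (cases "A \<in> sets borel") (auto simp: minus_rca.rep_eq component_rca.rep_eq meas_of_abs_rca)
    qed
    have "(\<lambda>t. meas_of (abs_rca m) {s. s + t \<in> A} - meas_of (abs_rca m - component_rca b m) {s. s + t \<in> A})
        \<in> borel_measurable borel"
      using A p abs_rca_nonneg[of m]
      by (intro borel_measurable_diff borel_measurable_meas_of_translate_nonneg) auto
    then show ?thesis by (simp add: minus_rca.rep_eq)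
  qed
  then show "(\<lambda>t. meas_of m {s. s + t \<in> A}) \<in> borel_measurable borel"
    by (subst borel_measurable_euclidean_space) (simp add: component_rca.rep_eq)
qed

section \<open>The convolution as a regular measure\<close>

text \<open>Only a set function at first: \<open>is_rca_conv_fun\<close> shows that it is regular,
  after which it can be identified with the convolution.\<close>

definition conv_fun ::
    "('g::{topological_group_add, t2_space}, 'f::{real_normed_field, euclidean_space}) rca
      \<Rightarrow> ('g, 'f) rca \<Rightarrow> 'g set \<Rightarrow> 'f" where
  "conv_fun m n A = (if A \<in> sets borel then rca_integral n (\<lambda>t. meas_of m {s. s + t \<in> A}) else 0)"

text \<open>The partial sums of the integrands are values of \<open>m\<close> on finite unions,
  hence bounded by the norm of \<open>m\<close>; this bound justifies passing to the limit under the
  outer integral.\<close>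

lemma borel_countably_additive_conv_fun: "borel_countably_additive (conv_fun m n)"
  unfolding borel_countably_additive_def
proof (intro allI impI)
  fix A :: "nat \<Rightarrow> 'a set"
  assume A: "range A \<subseteq> sets borel" "disjoint_family A"
  then have Ai: "A i \<in> sets borel" for i by auto
  let ?g = "\<lambda>i t. meas_of m {s. s + t \<in> A i}"
  have g: "bdd_borel (?g i)" for i
    by (rule bdd_borel_meas_of_translate[OF Ai])
  have "(\<lambda>k. rca_integral n (\<lambda>t. \<Sum>i<k. ?g i t)) \<longlonglongrightarrow> rca_integral n (\<lambda>t. meas_of m {s. s + t \<in> (\<Union>i. A i)})"
  proof (rule rca_integral_lim)
    fix k and t :: 'a
    have "(\<Sum>i<k. ?g i t) = meas_of m {s. s + t \<in> (\<Union>i<k. A i)}"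
    proof (induction k)
      case (Suc k)
      have "A k \<inter> A i = {}" if "i < k" for i
        using A(2) that by (intro disjoint_family_onD[of A UNIV]) auto
      then have "{s. s + t \<in> (\<Union>i<k. A i)} \<inter> {s. s + t \<in> A k} = {}" by blast
      then have "meas_of m ({s. s + t \<in> (\<Union>i<k. A i)} \<union> {s. s + t \<in> A k})
          = meas_of m {s. s + t \<in> (\<Union>i<k. A i)} + ?g k t"
        using Ai by (intro meas_of_Un borel_translate sets.finite_UN) auto
      moreover have "{s. s + t \<in> (\<Union>i<k. A i)} \<union> {s. s + t \<in> A k} = {s. s + t \<in> (\<Union>i<Suc k. A i)}"
        by (auto simp: lessThan_Suc)
      ultimately show ?case using Suc by simp
    qed simp
    also have "norm \<dots> \<le> norm m"
      by (rule norm_meas_of_le_norm)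
    finally show "norm (\<Sum>i<k. ?g i t) \<le> norm m" .
  next
    show "(\<lambda>k. \<Sum>i<k. ?g i t) \<longlonglongrightarrow> meas_of m {s. s + t \<in> (\<Union>i. A i)}" for t
      using meas_of_translate_sums[OF A(2) Ai, of m t] by (simp add: sums_def)
  qed (intro bdd_borel_sum g)
  then have "(\<lambda>i. rca_integral n (?g i)) sums rca_integral n (\<lambda>t. meas_of m {s. s + t \<in> (\<Union>i. A i)})"
    using g by (simp add: sums_def rca_integral_sum)
  moreover have "(\<Union>i. A i) \<in> sets borel" using Ai by auto
  ultimately show "(\<lambda>i. conv_fun m n (A i)) sums conv_fun m n (\<Union>i. A i)"
    using Ai by (simp add: conv_fun_def)
qed

lemma rca_integral_nonneg_eq:
  fixes m :: "('g::t2_space, real) rca"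
  assumes "0 \<le> m" "bdd_borel f"
  shows "rca_integral m f = (LINT x|variation_measure m. f x)"
  using rca_integral_of_real_rca[OF assms] by simp

text \<open>Serves twice: regularity of the general convolution follows by domination from that of
  |m| and |n|, and with \<open>abs_rca_leI\<close> it gives |m \<star> n| \<le> |m| \<star>
  |n|.\<close>

lemma norm_conv_fun_le:
  assumes "A \<in> sets borel"
  shows "norm (conv_fun m n A) \<le> conv_fun (abs_rca m) (abs_rca n) A"
proof -
  let ?V = "variation_measure n"
  let ?g = "\<lambda>t. meas_of m {s. s + t \<in> A}" and ?h = "\<lambda>t. meas_of (abs_rca m) {s. s + t \<in> A}"
  have g: "bdd_borel ?g" "bdd_borel ?h" by (rule bdd_borel_meas_of_translate[OF assms])+
  have int: "integrable ?V ?g" "integrable ?V ?h"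
    using g by (auto intro: bdd_borel_integrable)
  have "norm (conv_fun m n A) \<le> (LINT t|?V. norm (?g t))"
    using norm_rca_integral_le[OF g(1), of n] assms by (simp add: conv_fun_def)
  also have "\<dots> \<le> (LINT t|?V. ?h t)"
    using int norm_meas_of_le[OF borel_translate[OF assms], of m]
    by (intro integral_mono integrable_norm) (auto simp: meas_of_abs_rca)
  also have "\<dots> = conv_fun (abs_rca m) (abs_rca n) A"
    using assms g rca_integral_nonneg_eq[OF abs_rca_nonneg, of ?h n]
    by (simp add: conv_fun_def variation_measure_abs_rca)
  finally show ?thesis .
qed

text \<open>Each t in \<open>L\<close> has a compact \<open>K\<close> of mass above r and, by local
  compactness, a compact neighbourhood \<open>W\<close> with K + W inside \<open>U\<close>. Finitely
  many of these neighbourhoods cover \<open>L\<close>, and the union of the corresponding sums K + W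
  is a compact set that serves all t in \<open>L\<close>.\<close>

lemma compact_lower_bound_translate:
  fixes m :: "('g::{topological_group_add, t2_space}, real) rca"
  assumes lc: "locally_compact_space (euclidean :: 'g topology)"
    and m: "0 \<le> m" and U: "open U" and L: "compact L"
    and gt: "\<And>t. t \<in> L \<Longrightarrow> r < meas_of m {s. s + t \<in> U}"
  shows "\<exists>C. compact C \<and> C \<subseteq> U \<and> (\<forall>t\<in>L. r < meas_of m {s. s + t \<in> C})"
proof -
  have nb: "neighbourhood_base_of (compactin euclidean) (euclidean :: 'g topology)"
    using lc locally_compact_space_neighbourhood_base Hausdorff_space_euclidean_t2 by blast
  have "\<exists>V W K. open V \<and> compact W \<and> compact K \<and> t \<in> V \<and> V \<subseteq> W \<and> (\<forall>t\<in>W. \<forall>s\<in>K. s + t \<in> U) \<and> r < meas_of m K"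
    if t: "t \<in> L" for t
  proof -
    obtain K where K: "compact K" "K \<subseteq> {s. s + t \<in> U}" "r < meas_of m K"
      by (rule nonneg_rca_inner_regular[OF m borel_translate[OF borel_open[OF U]] gt[OF t]])
    have "s + t \<in> U" if "s \<in> K" for s using K(2) that by blast
    from open_translation_tube[OF K(1) U this]
    obtain V where V: "open V" "t \<in> V" "\<forall>t\<in>V. \<forall>s\<in>K. s + t \<in> U" by blast
    then obtain V' W where "open V'" "compact W" "t \<in> V'" "V' \<subseteq> W" "W \<subseteq> V"
      using nb unfolding neighbourhood_base_of by (metis compactin_euclidean_iff open_openin)
    then show ?thesis using K V by (intro exI[of _ V'] exI[of _ W] exI[of _ K]) auto
  qed
  then obtain V W K where VWK0: "\<And>t. t \<in> L \<Longrightarrow> open (V t) \<and> compact (W t) \<and> compact (K t) \<and> t \<in> V t \<and> V t \<subseteq> W t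
      \<and> (\<forall>t'\<in>W t. \<forall>s\<in>K t. s + t' \<in> U) \<and> r < meas_of m (K t)"
    by metis
  then have VWK: "\<And>t. t \<in> L \<Longrightarrow> open (V t)" "\<And>t. t \<in> L \<Longrightarrow> compact (W t)"
    "\<And>t. t \<in> L \<Longrightarrow> compact (K t)" "\<And>t. t \<in> L \<Longrightarrow> t \<in> V t" "\<And>t. t \<in> L \<Longrightarrow> V t \<subseteq> W t"
    "\<And>t t' s. t \<in> L \<Longrightarrow> t' \<in> W t \<Longrightarrow> s \<in> K t \<Longrightarrow> s + t' \<in> U" "\<And>t. t \<in> L \<Longrightarrow> r < meas_of m (K t)"
    by blast+
  obtain T where T: "T \<subseteq> L" "finite T" "L \<subseteq> (\<Union>t\<in>T. V t)"
    using compactE_image[OF L, of L V] VWK(1,4) by blast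
  define C where "C = (\<Union>t\<in>T. (\<lambda>p. fst p + snd p) ` (K t \<times> W t))"
  have "compact C"
    unfolding C_def using T VWK(2,3)
    by (intro compact_UN compact_continuous_image continuous_intros compact_Times) auto
  moreover have "C \<subseteq> U"
    unfolding C_def using T VWK(6) by auto
  moreover have "r < meas_of m {s. s + t \<in> C}" if tL: "t \<in> L" for t
  proof -
    obtain t' where t': "t' \<in> T" "t \<in> V t'" using T(3) tL by blast
    then have "t' \<in> L" using T by auto
    then have "t \<in> W t'" using VWK(5) t' by auto
    then have "K t' \<subseteq> {s. s + t \<in> C}"
      unfolding C_def using t'(1) by force
    moreover have "{s. s + t \<in> C} \<in> sets borel"
      using \<open>compact C\<close> by (intro borel_translate borel_compact)
    ultimately have "meas_of m (K t') \<le> meas_of m {s. s + t \<in> C}"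
      by (intro nonneg_rca_mono[OF m])
    with VWK(7)[OF \<open>t' \<in> L\<close>] show ?thesis by simp
  qed
  ultimately show ?thesis by blast
qed

text \<open>The function \<open>g t = m(U - t)\<close> is only lower semicontinuous, so it is cut into layers of height \<open>d\<close>: off a
  set \<open>E\<close> of measure at most \<open>d\<close>, every \<open>t\<close> in the open set \<open>{g > j d}\<close> lies in a compact part \<open>L j\<close> of it,
  on which one compact \<open>C' j \<subseteq> U\<close> keeps \<open>m(C' j - t)\<close> above \<open>j d\<close>.\<close>

lemma conv_fun_inner_regular:
  fixes m n :: "('g::{topological_group_add, t2_space}, real) rca"
  assumes lc: "locally_compact_space (euclidean :: 'g topology)"
    and m: "0 \<le> m" and n: "0 \<le> n" and U: "open U" and e: "0 < e"
  shows "\<exists>C. compact C \<and> C \<subseteq> U \<and> conv_fun m n U \<le> conv_fun m n C + e"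
proof -
  let ?N = "variation_measure n"
  interpret N: finite_measure ?N by simp
  \<comment> \<open>The layers cost d times the norm of \<open>n\<close>, and the exceptional set
    \<open>E\<close> at most d times the norm of \<open>m\<close>. The added 1 keeps the denominator
    positive.\<close>
  define d where "d = e / (norm n + norm m + 1)"
  have pos: "0 < norm n + norm m + 1" by (meson add_nonneg_pos add_nonneg_nonneg norm_ge_zero zero_less_one)
  then have d: "0 < d" using e by (simp add: d_def)
  \<comment> \<open>Since \<open>g\<close> is bounded by the norm of \<open>m\<close>, the sets
    \<open>O' j\<close> are empty beyond this level. There are J + 1 levels, whence the share d / (J
    + 1) for each exceptional set.\<close>
  define J where "J = nat \<lceil>norm m / d\<rceil>"
  define g where "g t = meas_of m {s. s + t \<in> U}" for t
  define O' where "O' j = {t. real j * d < g t}" for j :: nat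
  have O_open: "open (O' j)" for j
    unfolding O'_def g_def by (rule open_meas_of_translate_greater[OF m U])
  have "\<exists>L. compact L \<and> L \<subseteq> O' j \<and> measure ?N (O' j - L) \<le> d / (J + 1)" for j
  proof -
    have "0 < d / (J + 1)" using d by simp
    from rca_regular_approx[OF borel_open[OF O_open] this, of j n]
    obtain L where L: "compact L" "L \<subseteq> O' j" "measure ?N (O' j) \<le> measure ?N L + d / (J + 1)"
      by metis
    then have "measure ?N (O' j - L) \<le> d / (J + 1)"
      using O_open by (subst N.finite_measure_Diff) (auto intro: borel_compact)
    then show ?thesis using L by blast
  qed
  then obtain L where L: "\<And>j. compact (L j)" "\<And>j. L j \<subseteq> O' j" "\<And>j. measure ?N (O' j - L j) \<le> d / (J + 1)"
    by metis
  have "\<exists>C. compact C \<and> C \<subseteq> U \<and> (\<forall>t\<in>L j. real j * d < meas_of m {s. s + t \<in> C})" for j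
    using L(2)[of j] by (intro compact_lower_bound_translate[OF lc m U L(1)]) (auto simp: O'_def g_def)
  then obtain C' where C': "\<And>j. compact (C' j)" "\<And>j. C' j \<subseteq> U"
    "\<And>j t. t \<in> L j \<Longrightarrow> real j * d < meas_of m {s. s + t \<in> C' j}"
    by metis
  define C where "C = (\<Union>j\<le>J. C' j)"
  have C: "compact C" "C \<subseteq> U"
    unfolding C_def using C' by (auto intro: compact_UN)
  define gC where "gC t = meas_of m {s. s + t \<in> C}" for t
  define E where "E = (\<Union>j\<le>J. O' j - L j)"
  have E_borel: "E \<in> sets borel"
    unfolding E_def by (intro sets.finite_UN sets.Diff borel_open borel_compact O_open L(1)) simp
  have OL_borel: "O' j - L j \<in> sets borel" for j
    by (intro sets.Diff borel_open borel_compact O_open L(1))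
  have E: "measure ?N E \<le> d"
  proof -
    have "measure ?N E \<le> (\<Sum>j\<le>J. measure ?N (O' j - L j))"
      unfolding E_def using OL_borel by (intro measure_UNION_le) auto
    also have "\<dots> \<le> (\<Sum>j\<le>J. d / (J + 1))"
      by (intro sum_mono L(3))
    also have "\<dots> = d" by simp
    finally show ?thesis .
  qed
  have gC_nonneg: "0 \<le> gC t" and g_nonneg: "0 \<le> g t" for t
    using m by (auto simp: gC_def g_def rca_nonneg_iff)
  have g_le: "g t \<le> norm m" for t
    unfolding g_def norm_nonneg_rca[OF m] by (rule nonneg_rca_mono[OF m]) auto
  have bound: "g t \<le> gC t + (d + indicator E t * norm m)" for t
  proof (cases "t \<in> E \<or> g t = 0")
    case True
    then show ?thesis using g_le[of t] gC_nonneg[of t] d by auto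
  next
    case False
    \<comment> \<open>The largest level strictly below \<open>g t\<close>, so that j d < g t \<le>
      (j + 1) d also when g t is a multiple of d.\<close>
    define j where "j = nat (\<lceil>g t / d\<rceil> - 1)"
    have gt: "0 < g t / d" using False g_nonneg[of t] d by auto
    then have j: "real j = \<lceil>g t / d\<rceil> - 1"
      unfolding j_def by (simp add: less_ceiling_iff)
    have "real j < g t / d" "g t / d \<le> real j + 1"
      unfolding j by linarith+
    then have j1: "real j * d < g t" "g t \<le> real j * d + d"
      using d by (auto simp: field_simps)
    have "real j * d < norm m" using j1(1) g_le[of t] by simp
    then have "real j < norm m / d" using d by (simp add: field_simps)
    then have "j \<le> J" unfolding J_def by linarith
    moreover have "t \<in> O' j" using j1 by (simp add: O'_def)
    ultimately have "t \<in> L j" using False unfolding E_def by blast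
    then have "real j * d < meas_of m {s. s + t \<in> C' j}" by (rule C'(3))
    also have "\<dots> \<le> gC t"
      unfolding gC_def using \<open>j \<le> J\<close> C(1)
      by (intro nonneg_rca_mono[OF m] borel_translate borel_compact) (auto simp: C_def)
    finally show ?thesis using j1 False by (simp add: indicator_def)
  qed
  have bb: "bdd_borel g" "bdd_borel gC"
    unfolding g_def[abs_def] gC_def[abs_def] using U C
    by (auto intro: bdd_borel_meas_of_translate borel_compact)
  have int: "integrable ?N g" "integrable ?N gC"
    using bb by (auto intro: bdd_borel_integrable)
  have intE: "integrable ?N (\<lambda>t. indicator E t * norm m)"
    using E_borel by (intro integrable_mult_left) (auto simp: less_top[symmetric])
  have "conv_fun m n U = (LINT t|?N. g t)"
    using U rca_integral_nonneg_eq[OF n bb(1)] by (simp add: conv_fun_def g_def[abs_def])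
  also have "\<dots> \<le> (LINT t|?N. gC t + (d + indicator E t * norm m))"
    using int intE bound by (intro integral_mono) auto
  also have "\<dots> = (LINT t|?N. gC t) + (d * norm n + measure ?N E * norm m)"
    using int intE E_borel by (simp add: norm_rca_eq_measure)
  also have "(LINT t|?N. gC t) = conv_fun m n C"
    using C rca_integral_nonneg_eq[OF n bb(2)] by (simp add: conv_fun_def gC_def[abs_def] borel_compact)
  also have "d * norm n + measure ?N E * norm m \<le> d * norm n + d * norm m"
    using E by (intro add_left_mono mult_right_mono) auto
  also have "\<dots> \<le> d * (norm n + norm m + 1)"
    using d by (simp add: algebra_simps)
  also have "\<dots> = e"
    using pos by (simp add: d_def)
  finally show ?thesis using C by auto
qed

lemma is_rca_conv_fun:
  fixes m n :: "('g::{topological_group_add, t2_space}, 'f::{real_normed_field, euclidean_space}) rca"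
  assumes lc: "locally_compact_space (euclidean :: 'g topology)"
  shows "is_rca (conv_fun m n)"
proof -
  let ?k = "conv_fun (abs_rca m) (abs_rca n)"
  have k_nonneg: "0 \<le> ?k A" if "A \<in> sets borel" for A
    using norm_conv_fun_le[OF that, of m n] norm_ge_zero order_trans by blast
  have k: "is_rca ?k"
    by (rule is_rca_nonnegI[OF _ borel_countably_additive_conv_fun k_nonneg
          conv_fun_inner_regular[OF lc abs_rca_nonneg abs_rca_nonneg]])
      (simp add: conv_fun_def)
  show ?thesis
  proof (rule is_rca_dominated[OF k k, of 1])
    show "variation (conv_fun m n) A \<le> ennreal 1 * (variation ?k A + variation ?k A)" for A
      unfolding ennreal_1
    proof (rule variation_le_combination)
      fix A :: "'g set" assume A: "A \<in> sets borel"
      have "ennreal (norm (conv_fun m n A)) \<le> ennreal (norm (?k A)) + 0"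
        using norm_conv_fun_le[OF A, of m n] by (auto intro!: ennreal_leI)
      also have "\<dots> \<le> ennreal (norm (?k A)) + ennreal (norm (?k A))"
        by (intro add_left_mono) simp
      finally show "ennreal (norm (conv_fun m n A)) \<le> 1 * (ennreal (norm (?k A)) + ennreal (norm (?k A)))"
        by simp
    qed
  qed (auto simp: conv_fun_def borel_countably_additive_conv_fun)
qed

section \<open>Iterated integrals against a convolution\<close>

lemma bdd_borel_translate:
  fixes f :: "'g::topological_group_add \<Rightarrow> 'f::real_normed_vector"
  assumes "bdd_borel f"
  shows "bdd_borel (\<lambda>s. f (s + t))"
proof -
  have "(\<lambda>s. s + t) \<in> borel_measurable borel"
    by (intro borel_measurable_continuous_onI continuous_intros)
  from measurable_compose[OF this bdd_borel_measurable[OF assms]]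
  have "(\<lambda>s. f (s + t)) \<in> borel_measurable borel" .
  moreover obtain B where "\<And>x. norm (f x) \<le> B"
    using assms by (metis bdd_borelE)
  ultimately show ?thesis by (auto intro: bdd_borelI)
qed

text \<open>Both claims are proved in one induction, because linearity and limits of the outer
  integral require the inner integral to be a bounded Borel function.\<close>

lemma conv_fun_integral_aux:
  fixes m n :: "('g::{topological_group_add, t2_space}, 'f::{real_normed_field, euclidean_space}) rca"
  assumes l: "meas_of l = conv_fun m n" and f: "bdd_borel f"
  shows "bdd_borel (\<lambda>t. rca_integral m (\<lambda>s. f (s + t))) \<and>
    rca_integral l f = rca_integral n (\<lambda>t. rca_integral m (\<lambda>s. f (s + t)))"
  using f
proof (induction rule: bdd_borel_induct)
  case (indicator A c)
  have inner: "rca_integral m (\<lambda>s. indicator A (s + t) *\<^sub>R c) = c * meas_of m {s. s + t \<in> A}" for t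
    using rca_integral_indicator[OF borel_translate[OF indicator, of t], of m c]
    by (simp add: indicator_def)
  have *: "bdd_borel (\<lambda>t. meas_of m {s. s + t \<in> A})"
    by (rule bdd_borel_meas_of_translate[OF indicator])
  show ?case
    unfolding inner using indicator *
    by (simp add: rca_integral_indicator rca_integral_mult_left bdd_borel_mult_left l conv_fun_def)
next
  case (add f g)
  then show ?case
    by (simp add: rca_integral_add bdd_borel_translate bdd_borel_add)
next
  case (lim s f B)
  have s: "\<And>i. bdd_borel (s i)" "\<And>i x. norm (s i x) \<le> B" "\<And>x. (\<lambda>i. s i x) \<longlonglongrightarrow> f x"
    and f: "bdd_borel f" and IH: "\<And>i. bdd_borel (\<lambda>t. rca_integral m (\<lambda>x. s i (x + t)))"
    "\<And>i. rca_integral l (s i) = rca_integral n (\<lambda>t. rca_integral m (\<lambda>x. s i (x + t)))"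
    using lim by auto
  have inner: "(\<lambda>i. rca_integral m (\<lambda>x. s i (x + t))) \<longlonglongrightarrow> rca_integral m (\<lambda>x. f (x + t))" for t
    using s by (intro rca_integral_lim) (auto intro: bdd_borel_translate)
  have bound: "norm (rca_integral m (\<lambda>x. s i (x + t))) \<le> B * norm m" for i t
    using s by (intro norm_rca_integral_le_bound bdd_borel_translate) auto
  have "bdd_borel (\<lambda>t. rca_integral m (\<lambda>x. f (x + t)))"
  proof (rule bdd_borelI)
    show "(\<lambda>t. rca_integral m (\<lambda>x. f (x + t))) \<in> borel_measurable borel"
      by (rule borel_measurable_LIMSEQ_metric[OF bdd_borel_measurable[OF IH(1)] inner])
    show "norm (rca_integral m (\<lambda>x. f (x + t))) \<le> B * norm m" for t
      by (rule Lim_bounded[OF tendsto_norm[OF inner], of 0]) (simp add: bound)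
  qed
  moreover have "(\<lambda>i. rca_integral l (s i)) \<longlonglongrightarrow> rca_integral l f"
    using s by (intro rca_integral_lim) auto
  moreover have "(\<lambda>i. rca_integral n (\<lambda>t. rca_integral m (\<lambda>x. s i (x + t))))
      \<longlonglongrightarrow> rca_integral n (\<lambda>t. rca_integral m (\<lambda>x. f (x + t)))"
    by (rule rca_integral_lim[OF IH(1) bound inner])
  ultimately show ?case
    using LIMSEQ_unique by (simp add: IH(2))
qed

subsection \<open>Continuous functions vanishing at infinity separate measures\<close>

lemma bdd_borel_C0:
  fixes f :: "'g::t2_space \<Rightarrow> 'v::real_normed_vector"
  assumes "f \<in> C0"
  shows "bdd_borel f"
proof -
  have cont: "continuous_on UNIV f" and "\<exists>K. compact K \<and> (\<forall>x. x \<notin> K \<longrightarrow> norm (f x) < 1)"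
    using assms by (auto simp: C0_def)
  then obtain K where K: "compact K" "\<And>x. x \<notin> K \<Longrightarrow> norm (f x) < 1" by blast
  have "compact (f ` K)"
    using cont K(1) by (meson compact_continuous_image continuous_on_subset top_greatest)
  then obtain B where B: "\<And>x. x \<in> K \<Longrightarrow> norm (f x) \<le> B"
    by (metis bounded_iff compact_imp_bounded imageI)
  have "norm (f x) \<le> max B 1" for x
    using B[of x] K(2)[of x] by (cases "x \<in> K") auto
  then show ?thesis
    using borel_measurable_continuous_onI[OF cont] by (rule bdd_borelI[rotated])
qed

text \<open>Separating \<open>K\<close> from the complement of \<open>U\<close> alone gives no
  control at infinity. \<open>U\<close> is therefore first intersected with a finite union of open
  sets, each contained in a compact set, that covers \<open>K\<close>.\<close>

lemma locally_compact_C0_Urysohn: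
  fixes K U :: "'g::t2_space set"
  assumes lc: "locally_compact_space (euclidean :: 'g topology)"
    and K: "compact K" and U: "open U" "K \<subseteq> U"
  obtains f :: "'g \<Rightarrow> real" where "f \<in> C0"
    "\<And>x. 0 \<le> f x" "\<And>x. f x \<le> 1" "\<And>x. x \<in> K \<Longrightarrow> f x = 1" "\<And>x. x \<notin> U \<Longrightarrow> f x = 0"
proof -
  have "\<exists>V W. open V \<and> compact W \<and> x \<in> V \<and> V \<subseteq> W" for x :: 'g
    using lc by (force simp: locally_compact_space_def)
  then obtain V W where VW: "\<And>x::'g. open (V x)" "\<And>x. compact (W x)" "\<And>x. x \<in> V x" "\<And>x. V x \<subseteq> W x"
    by metis
  have "K \<subseteq> (\<Union>x\<in>K. V x)" using VW(3) by auto
  from compactE_image[OF K VW(1) this]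
  obtain T where T: "finite T" "K \<subseteq> (\<Union>x\<in>T. V x)" by metis
  let ?V = "\<Union>x\<in>T. V x" and ?W = "\<Union>x\<in>T. W x"
  have cr: "completely_regular_space (euclidean :: 'g topology)"
    using lc Hausdorff_space_euclidean_t2 locally_compact_regular_imp_completely_regular_space by blast
  have cl: "closedin euclidean (- (U \<inter> ?V))"
    using U VW(1) unfolding closed_closedin[symmetric] by (intro closed_Compl open_Int open_UN) auto
  have dj: "disjnt K (- (U \<inter> ?V))"
    using U T by (auto simp: disjnt_def)
  have K': "compactin euclidean K" using K by simp
  obtain g where g: "continuous_map euclidean (subtopology euclidean {0..1::real}) g"
    "g ` (- (U \<inter> ?V)) \<subseteq> {0}" "g ` K \<subseteq> {1}"
    by (rule Urysohn_completely_regular_compact_closed[OF zero_le_one cr K' cl dj])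
  then have cont: "continuous_on UNIV g" and g01: "\<And>x. 0 \<le> g x \<and> g x \<le> 1"
    by (auto simp: continuous_map_in_subtopology)
  have compact_W: "compact ?W" using T VW by (intro compact_UN) auto
  have off: "g x = 0" if "x \<notin> ?W" for x
    using g(2) that VW(4) by blast
  show thesis
  proof (rule that[of g])
    show "g \<in> C0"
      unfolding C0_def using cont compact_W off by (auto intro!: exI[of _ ?W])
  qed (use g g01 in auto)
qed

lemma C0_of_real:
  assumes "f \<in> C0"
  shows "(\<lambda>x. of_real (f x) :: 'f::real_normed_field) \<in> C0"
  using assms unfolding C0_def by (auto intro!: continuous_intros)

text \<open>For the difference d and compact \<open>K\<close> inside open \<open>U\<close>, a
  Urysohn function has d-integral 0 and differs from the indicator of \<open>K\<close> only on U -
  K, where |d| is small. Hence d vanishes on compact sets, and by inner regularity on all Borel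
  sets.\<close>

lemma rca_eqI_C0:
  fixes l l' :: "('g::t2_space, 'f::{real_normed_field, euclidean_space}) rca"
  assumes lc: "locally_compact_space (euclidean :: 'g topology)"
    and eq: "\<And>f. f \<in> C0 \<Longrightarrow> rca_integral l f = rca_integral l' f"
  shows "l = l'"
proof -
  define d where "d = l - l'"
  let ?V = "variation_measure d"
  interpret V: finite_measure ?V by simp
  have d0: "rca_integral d f = 0" if "f \<in> C0" for f
    using rca_integral_add_rca[OF bdd_borel_C0[OF that], of d l'] eq[OF that] by (simp add: d_def)
  have compact0: "meas_of d K = 0" if K: "compact K" for K
  proof -
    have K_borel: "K \<in> sets borel" using K by (rule borel_compact)
    have "norm (meas_of d K) \<le> e" if e: "0 < e" for e
    proof (rule rca_regular_approx[OF K_borel e, of d])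
      fix K' U :: "'g set"
      assume U: "open U" "K \<subseteq> U" "measure ?V U \<le> measure ?V K + e"
      obtain f :: "'g \<Rightarrow> real" where f: "f \<in> C0" "\<And>x. 0 \<le> f x" "\<And>x. f x \<le> 1"
        "\<And>x. x \<in> K \<Longrightarrow> f x = 1" "\<And>x. x \<notin> U \<Longrightarrow> f x = 0"
        using locally_compact_C0_Urysohn[OF lc K U(1,2)] by blast
      define F where "F x = (of_real (f x) :: 'f)" for x
      let ?i = "\<lambda>x. indicator K x *\<^sub>R (1 :: 'f)"
      have F: "bdd_borel F" unfolding F_def[abs_def] by (intro bdd_borel_C0 C0_of_real f(1))
      have dF: "rca_integral d F = 0"
        using d0[OF C0_of_real[OF f(1)]] by (simp add: F_def[abs_def])
      have i: "bdd_borel (\<lambda>x. -1 * ?i x)"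
        by (intro bdd_borel_mult_left bdd_borel_indicator K_borel)
      have "rca_integral d (\<lambda>x. F x + - 1 * ?i x) = rca_integral d F + - 1 * rca_integral d ?i"
        by (subst rca_integral_add[OF F i], subst rca_integral_mult_left) (auto intro: bdd_borel_indicator K_borel)
      also have "\<dots> = - meas_of d K"
        unfolding dF rca_integral_indicator[OF K_borel] by simp
      finally have "norm (meas_of d K) = norm (rca_integral d (\<lambda>x. F x + - 1 * ?i x))"
        by simp
      also have "\<dots> \<le> (LINT x|?V. norm (F x + - 1 * ?i x))"
        by (intro norm_rca_integral_le bdd_borel_add F i)
      also have "\<dots> \<le> (LINT x|?V. indicator (U - K) x)"
      proof (rule integral_mono)
        show "integrable ?V (\<lambda>x. norm (F x + - 1 * ?i x))"
          using bdd_borel_integrable[OF bdd_borel_add[OF F i], of ?V] by (intro integrable_norm) auto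
        show "integrable ?V (indicator (U - K) :: 'g \<Rightarrow> real)"
          using K_borel U(1) by (auto simp: less_top[symmetric])
        show "norm (F x + - 1 * ?i x) \<le> indicator (U - K) x" for x
          using f(2-5)[of x] U(2) by (auto simp: F_def indicator_def)
      qed
      also have "\<dots> = measure ?V (U - K)" using K_borel U(1) by simp
      also have "\<dots> = measure ?V U - measure ?V K"
        using K_borel U by (intro V.finite_measure_Diff) auto
      also have "\<dots> \<le> e" using U(3) by simp
      finally show ?thesis .
    qed
    then show ?thesis
      using field_le_epsilon[of "norm (meas_of d K)" 0] by simp
  qed
  have "meas_of d A = 0" if A: "A \<in> sets borel" for A
  proof -
    have "norm (meas_of d A) \<le> e" if e: "0 < e" for e
    proof (rule rca_regular_approx[OF A e, of d])
      fix K U :: "'g set"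
      assume K: "compact K" "K \<subseteq> A" "measure ?V A \<le> measure ?V K + e"
      then have K_borel: "K \<in> sets borel" by (intro borel_compact)
      have "meas_of d (A - K) = meas_of d A"
        using meas_of_diff[OF A K_borel K(2), of d] compact0[OF K(1)] by simp
      then have "norm (meas_of d A) \<le> measure ?V (A - K)"
        using norm_meas_of_le[of "A - K" d] A K_borel by auto
      also have "\<dots> = measure ?V A - measure ?V K"
        using K_borel A K(2) by (intro V.finite_measure_Diff) auto
      finally show ?thesis using K(3) by simp
    qed
    then show ?thesis
      using field_le_epsilon[of "norm (meas_of d A)" 0] by simp
  qed
  then have "d = 0"
    by (intro rca_eqI) (simp add: zero_rca.rep_eq)
  then show ?thesis by (simp add: d_def)
qed

section \<open>The convolution algebra\<close>

context
  assumes lc: "locally_compact_space (euclidean :: 'g::{topological_group_add, t2_space} topology)"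
begin

text \<open>Resolves the definite description: the candidate satisfies the defining identity for all
  bounded Borel functions, and \<open>C0\<close> leaves no other choice.\<close>

lemma meas_of_convolution_conv_fun:
  fixes m n :: "('g, 'f::{real_normed_field, euclidean_space}) rca"
  shows "meas_of (m \<star> n) = conv_fun m n"
proof -
  obtain l where l: "meas_of l = conv_fun m n"
    using Abs_rca_inverse is_rca_conv_fun[OF lc] by blast
  have "m \<star> n = l"
    unfolding convolution_def
  proof (rule the_equality)
    show *: "\<forall>f\<in>C0. rca_integral l f = rca_integral n (\<lambda>t. rca_integral m (\<lambda>s. f (s + t)))"
      using conv_fun_integral_aux[OF l] bdd_borel_C0 by blast
    show "l' = l" if "\<forall>f\<in>C0. rca_integral l' f = rca_integral n (\<lambda>t. rca_integral m (\<lambda>s. f (s + t)))" for l'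
      using that * by (intro rca_eqI_C0[OF lc]) simp
  qed
  with l show ?thesis by simp
qed

lemma meas_of_convolution:
  fixes m n :: "('g, 'f::{real_normed_field, euclidean_space}) rca"
  shows "A \<in> sets borel \<Longrightarrow> meas_of (m \<star> n) A = rca_integral n (\<lambda>t. meas_of m {s. s + t \<in> A})"
  by (simp add: meas_of_convolution_conv_fun conv_fun_def)

lemma rca_integral_convolution:
  fixes m n :: "('g, 'f::{real_normed_field, euclidean_space}) rca"
  assumes "bdd_borel f"
  shows "rca_integral (m \<star> n) f = rca_integral n (\<lambda>t. rca_integral m (\<lambda>s. f (s + t)))"
  using conv_fun_integral_aux[OF meas_of_convolution_conv_fun assms] by simp

lemma convolution_assoc:
  fixes l m n :: "('g, 'f::{real_normed_field, euclidean_space}) rca"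
  shows "(l \<star> m) \<star> n = l \<star> (m \<star> n)"
proof (rule rca_eqI)
  fix A :: "'g set" assume A: "A \<in> sets borel"
  have "meas_of ((l \<star> m) \<star> n) A = rca_integral n (\<lambda>t. rca_integral m (\<lambda>s. meas_of l {x. x + s + t \<in> A}))"
    using A by (simp add: meas_of_convolution borel_translate)
  also have "\<dots> = meas_of (l \<star> (m \<star> n)) A"
    using A by (simp add: meas_of_convolution rca_integral_convolution bdd_borel_meas_of_translate add.assoc)
  finally show "meas_of ((l \<star> m) \<star> n) A = meas_of (l \<star> (m \<star> n)) A" .
qed

lemma convolution_add_left:
  fixes l m n :: "('g, 'f::{real_normed_field, euclidean_space}) rca"
  shows "(l + m) \<star> n = l \<star> n + m \<star> n"
  by (rule rca_eqI)
    (simp add: meas_of_convolution plus_rca.rep_eq rca_integral_add bdd_borel_meas_of_translate)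

lemma convolution_add_right:
  fixes l m n :: "('g, 'f::{real_normed_field, euclidean_space}) rca"
  shows "l \<star> (m + n) = l \<star> m + l \<star> n"
  by (rule rca_eqI)
    (simp add: meas_of_convolution plus_rca.rep_eq rca_integral_add_rca bdd_borel_meas_of_translate)

lemma convolution_scale_left:
  fixes m n :: "('g, 'f::{real_normed_field, euclidean_space}) rca"
  shows "scale_rca c m \<star> n = scale_rca c (m \<star> n)"
  by (rule rca_eqI)
    (simp add: meas_of_convolution scale_rca.rep_eq rca_integral_mult_left bdd_borel_meas_of_translate)

lemma convolution_scale_right:
  fixes m n :: "('g, 'f::{real_normed_field, euclidean_space}) rca"
  shows "m \<star> scale_rca c n = scale_rca c (m \<star> n)"
  by (rule rca_eqI)
    (simp add: meas_of_convolution scale_rca.rep_eq rca_integral_scale_rca bdd_borel_meas_of_translate)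

lemma convolution_of_real_rca:
  fixes m n :: "('g, real) rca"
  shows "of_real_rca m \<star> of_real_rca n = (of_real_rca (m \<star> n) :: ('g, 'f::{real_normed_field, euclidean_space}) rca)"
  by (rule rca_eqI)
    (simp add: meas_of_convolution of_real_rca.rep_eq rca_integral_of_real bdd_borel_meas_of_translate)

text \<open>The whole group is translation invariant, so the inner integrand is constant. For
  positive measures this makes the norm multiplicative, which the comparison of masses and the
  isometry both use.\<close>

lemma meas_of_convolution_UNIV:
  fixes m n :: "('g, 'f::{real_normed_field, euclidean_space}) rca"
  shows "meas_of (m \<star> n) UNIV = meas_of m UNIV * meas_of n UNIV"
  by (simp add: meas_of_convolution rca_integral_const)

lemma abs_rca_convolution_le:
  fixes m n :: "('g, 'f::{real_normed_field, euclidean_space}) rca"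
  shows "abs_rca (m \<star> n) \<le> abs_rca m \<star> abs_rca n"
  by (rule abs_rca_leI) (simp add: meas_of_convolution_conv_fun norm_conv_fun_le)

lemma convolution_nonneg:
  fixes m n :: "('g, real) rca"
  assumes "0 \<le> m" "0 \<le> n"
  shows "0 \<le> m \<star> n"
proof -
  have "abs_rca (m \<star> n) \<le> m \<star> n"
    using abs_rca_convolution_le[of m n] assms by (simp add: abs_rca_of_nonneg)
  then show ?thesis
    by (rule order_trans[OF abs_rca_nonneg])
qed

end

section \<open>Restrictions of measures\<close>

text \<open>For a set \<open>Q\<close> that is not Borel the result is the zero measure, which makes
  the operation total.\<close>

lift_definition restrict_rca :: "'g::t2_space set \<Rightarrow> ('g, 'v::real_normed_vector) rca \<Rightarrow> ('g, 'v) rca"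
  is "\<lambda>Q m A. if Q \<in> sets borel \<and> A \<in> sets borel then m (A \<inter> Q) else 0"
proof -
  fix Q :: "'g set" and m :: "'g set \<Rightarrow> 'v"
  assume m: "is_rca m"
  let ?l = "\<lambda>A. if Q \<in> sets borel \<and> A \<in> sets borel then m (A \<inter> Q) else 0"
  have bm: "borel_countably_additive m" using m by (simp add: is_rca_def)
  show "is_rca ?l"
  proof (cases "Q \<in> sets borel")
    case True
    show ?thesis
    proof (rule is_rca_dominated[OF m m, of 1])
      show "borel_countably_additive ?l"
        unfolding borel_countably_additive_def
      proof (intro allI impI)
        fix A :: "nat \<Rightarrow> 'g set" assume A: "range A \<subseteq> sets borel" "disjoint_family A"
        have "(\<lambda>i. m (A i \<inter> Q)) sums m (\<Union>i. A i \<inter> Q)"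
          using A True by (intro bca_sums[OF bm]) (auto simp: disjoint_family_on_def)
        moreover have "(\<Union>i. A i) \<in> sets borel" "\<And>i. A i \<in> sets borel" using A by auto
        ultimately show "(\<lambda>i. ?l (A i)) sums ?l (\<Union>i. A i)"
          using True by simp
      qed
      show "variation ?l A \<le> ennreal 1 * (variation m A + variation m A)" if A: "A \<in> sets borel" for A
      proof -
        have "variation ?l A \<le> variation m A"
        proof (rule variation_least)
          fix P assume P: "finite P" "disjoint P" "P \<subseteq> sets borel" "\<Union>P = A"
          have "(\<Sum>B\<in>P. ennreal (norm (?l B))) = (\<Sum>B\<in>P. ennreal (norm (m (B \<inter> (A \<inter> Q)))))"
          proof (rule sum.cong)
            fix B assume "B \<in> P"
            then have "B \<in> sets borel" "B \<inter> (A \<inter> Q) = B \<inter> Q" using P by auto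
            then show "ennreal (norm (?l B)) = ennreal (norm (m (B \<inter> (A \<inter> Q))))"
              using True by simp
          qed simp
          also have "\<dots> \<le> variation m (A \<inter> Q)"
            using P A True by (intro sum_image_Int_le_variation[OF bm]) auto
          also have "\<dots> \<le> variation m A"
            using A True by (intro variation_mono) auto
          finally show "(\<Sum>B\<in>P. ennreal (norm (?l B))) \<le> variation m A" .
        qed
        then show ?thesis by (simp add: add_increasing)
      qed
    qed auto
  next
    case False
    then show ?thesis by (simp add: is_rca_zero)
  qed
qed

lemma meas_of_restrict_rca:
  "Q \<in> sets borel \<Longrightarrow> A \<in> sets borel \<Longrightarrow> meas_of (restrict_rca Q m) A = meas_of m (A \<inter> Q)"
  by (simp add: restrict_rca.rep_eq)

lemma restrict_rca_nonneg: "0 \<le> m \<Longrightarrow> 0 \<le> restrict_rca Q (m :: ('g::t2_space, real) rca)"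
  by (simp add: rca_nonneg_iff restrict_rca.rep_eq)

lemma restrict_rca_add_Compl:
  assumes "Q \<in> sets borel"
  shows "restrict_rca Q m + restrict_rca (- Q) m = m"
proof (rule rca_eqI)
  fix A :: "'a set" assume A: "A \<in> sets borel"
  have "- Q \<in> sets borel" using assms by (simp add: Compl_eq_Diff_UNIV)
  then have "meas_of (restrict_rca Q m + restrict_rca (- Q) m) A = meas_of m ((A \<inter> Q) \<union> (A \<inter> - Q))"
    using A assms by (subst meas_of_Un) (auto simp: plus_rca.rep_eq meas_of_restrict_rca)
  also have "(A \<inter> Q) \<union> (A \<inter> - Q) = A" by auto
  finally show "meas_of (restrict_rca Q m + restrict_rca (- Q) m) A = meas_of m A" .
qed

lemma abs_rca_of_real_rca:
  "abs_rca (of_real_rca m :: ('g::t2_space, 'f::real_normed_field) rca) = abs_rca m"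
  by (rule rca_eqI) (simp add: abs_rca.rep_eq of_real_rca.rep_eq variation_def)

section \<open>Disjoint compact sets that carry almost all of the variation, and their
  separation\<close>

lemma sum_measure_disjoint_le_norm:
  assumes "finite P" "disjoint_family_on E P" "\<And>B. B \<in> P \<Longrightarrow> E B \<in> sets borel"
  shows "(\<Sum>B\<in>P. measure (variation_measure m) (E B)) \<le> norm m"
proof -
  interpret finite_measure "variation_measure m" by simp
  have "(\<Sum>B\<in>P. measure (variation_measure m) (E B)) = measure (variation_measure m) (\<Union>B\<in>P. E B)"
    using assms by (intro finite_measure_finite_Union[symmetric]) auto
  also have "\<dots> \<le> norm m"
    using bounded_measure by (simp add: norm_rca_eq_measure)
  finally show ?thesis .
qed

text \<open>A partition that nearly attains the variation is shrunk blockwise to compact sets. The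
  family is indexed by the blocks, since several of its members may be empty.\<close>

lemma rca_compact_family:
  fixes m :: "('g::t2_space, 'v::real_normed_vector) rca"
  assumes e: "0 < e"
  shows "\<exists>(P :: 'g set set) K. finite P \<and> (\<forall>B\<in>P. compact (K B)) \<and> disjoint_family_on K P \<and>
    norm m - e \<le> (\<Sum>B\<in>P. norm (meas_of m (K B)))"
proof (cases "m = 0")
  case True
  then show ?thesis using e by (intro exI[of _ "{}"]) (auto simp: disjoint_family_on_def)
next
  case False
  let ?V = "variation_measure m"
  interpret V: finite_measure ?V by simp
  \<comment> \<open>The strict inequality would fail for m = 0, where negative reals are truncated
    to 0; hence the case distinction.\<close>
  have "ennreal (norm m - e / 2) < variation (meas_of m) UNIV"
    unfolding ennreal_norm_rca[symmetric] using False e by (intro ennreal_lessI) auto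
  then obtain P where "P \<in> {P. finite P \<and> disjoint P \<and> P \<subseteq> sets borel \<and> \<Union>P = UNIV}"
    and sum_P: "ennreal (norm m - e / 2) < (\<Sum>B\<in>P. ennreal (norm (meas_of m B)))"
    unfolding variation_def less_SUP_iff by (rule bexE)
  then have P: "finite P" "disjoint P" "P \<subseteq> sets borel" "\<Union>P = UNIV" by auto
  from sum_P have sum_P: "norm m - e / 2 \<le> (\<Sum>B\<in>P. norm (meas_of m B))"
    by (simp add: sum_nonneg) (metis ennreal_leI leD linorder_linear)
  \<comment> \<open>Half of e went into the choice of the partition; shrinking all its blocks costs
    at most card P times d \<le> e / 2.\<close>
  define d where "d = e / (2 * (card P + 1))"
  have d: "0 < d" using e by (simp add: d_def)
  have "\<exists>K. compact K \<and> K \<subseteq> B \<and> norm (meas_of m B) - d \<le> norm (meas_of m K)" if B: "B \<in> P" for B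
  proof -
    have B_borel: "B \<in> sets borel" using B P by auto
    show ?thesis
    proof (rule rca_regular_approx[OF B_borel d, of m])
      fix K U :: "'g set"
      assume K: "compact K" "K \<subseteq> B" "measure ?V B \<le> measure ?V K + d"
      then have K_borel: "K \<in> sets borel" by (intro borel_compact)
      have "norm (meas_of m B - meas_of m K) = norm (meas_of m (B - K))"
        using meas_of_diff[OF B_borel K_borel K(2), of m] by simp
      also have "\<dots> \<le> measure ?V (B - K)"
        using B_borel K_borel by (intro norm_meas_of_le) auto
      also have "\<dots> = measure ?V B - measure ?V K"
        using B_borel K_borel K(2) by (intro V.finite_measure_Diff) auto
      also have "\<dots> \<le> d" using K(3) by simp
      finally have "norm (meas_of m B) - d \<le> norm (meas_of m K)"
        using norm_triangle_ineq2[of "meas_of m B" "meas_of m K"] by simp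
      then show ?thesis using K by blast
    qed
  qed
  then obtain K where K: "\<And>B. B \<in> P \<Longrightarrow> compact (K B)" "\<And>B. B \<in> P \<Longrightarrow> K B \<subseteq> B"
    "\<And>B. B \<in> P \<Longrightarrow> norm (meas_of m B) - d \<le> norm (meas_of m (K B))"
    by metis
  have "card P * d \<le> e / 2"
    using e by (simp add: d_def field_simps)
  then have "norm m - e \<le> (\<Sum>B\<in>P. norm (meas_of m B) - d)"
    using sum_P by (simp add: sum_subtractf)
  also have "\<dots> \<le> (\<Sum>B\<in>P. norm (meas_of m (K B)))"
    by (intro sum_mono K(3))
  finally have "norm m - e \<le> (\<Sum>B\<in>P. norm (meas_of m (K B)))" .
  moreover have "disjoint_family_on K P"
    using P(2) K(2) unfolding disjoint_family_on_def disjoint_def by blast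
  ultimately show ?thesis using P(1) K(1) by blast
qed

lemma finite_compact_separation:
  fixes K :: "'i \<Rightarrow> 'g::t2_space set"
  assumes P: "finite P" and K: "\<And>i. i \<in> P \<Longrightarrow> compact (K i)" "disjoint_family_on K P"
  obtains D where "\<And>i. i \<in> P \<Longrightarrow> open (D i)" "\<And>i. i \<in> P \<Longrightarrow> K i \<subseteq> D i" "disjoint_family_on D P"
proof -
  have "\<exists>U V. open U \<and> open V \<and> K i \<subseteq> U \<and> K j \<subseteq> V \<and> U \<inter> V = {}" if ij: "i \<in> P" "j \<in> P" "i \<noteq> j" for i j
  proof -
    have K_ij: "compactin euclidean (K i)" "compactin euclidean (K j)" "disjnt (K i) (K j)"
      using disjoint_family_onD[OF K(2) ij] K(1) ij by (simp_all add: disjnt_def)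
    obtain U V where "openin euclidean U" "openin euclidean V" "K i \<subseteq> U" "K j \<subseteq> V" "disjnt U V"
      by (rule Hausdorff_space_compact_separation[OF Hausdorff_space_euclidean_t2 K_ij])
    then show ?thesis by (intro exI[of _ U] exI[of _ V]) (auto simp: disjnt_def)
  qed
  then obtain U V where UV: "\<And>i j. i \<in> P \<Longrightarrow> j \<in> P \<Longrightarrow> i \<noteq> j \<Longrightarrow> open (U i j) \<and> open (V i j) \<and>
      K i \<subseteq> U i j \<and> K j \<subseteq> V i j \<and> U i j \<inter> V i j = {}"
    by metis
  \<comment> \<open>The pairs are separated independently for (i, j) and (j, i). Intersecting both
    kinds of neighbourhoods puts \<open>D i\<close> into \<open>U i j\<close> and \<open>D j\<close>
    into \<open>V i j\<close>, which are disjoint.\<close>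
  define D where "D i = (\<Inter>j\<in>P - {i}. U i j \<inter> V j i)" for i
  show thesis
  proof (rule that[of D])
    show "open (D i)" if "i \<in> P" for i
      unfolding D_def using P UV that by (intro open_INT open_Int) auto
    show "K i \<subseteq> D i" if "i \<in> P" for i
      unfolding D_def
    proof (intro INT_greatest Int_greatest)
      fix j assume "j \<in> P - {i}"
      then show "K i \<subseteq> U i j" "K i \<subseteq> V j i"
        using UV[of i j] UV[of j i] that by auto
    qed
    show "disjoint_family_on D P"
      unfolding disjoint_family_on_def
    proof (intro ballI impI)
      fix i j assume ij: "i \<in> P" "j \<in> P" "i \<noteq> j"
      then have "D i \<subseteq> U i j" "D j \<subseteq> V i j" unfolding D_def by auto
      with UV[OF ij] show "D i \<inter> D j = {}" by blast
    qed
  qed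
qed

section \<open>Convolution with measures of small support\<close>

context
  assumes lc: "locally_compact_space (euclidean :: 'g::{topological_group_add, t2_space} topology)"
begin

text \<open>\<open>W\<close> is so small that translation by its elements keeps every
  \<open>K B\<close> inside \<open>D B\<close>. If \<open>n\<close> lives on W + t0, then
  translating by n-almost every t takes \<open>K B\<close> into D B + t0, so the convolution has
  roughly the value norm n times m(K B) there. These sets are disjoint, so the values add up in the
  norm.\<close>

lemma norm_convolution_small_support:
  fixes m :: "('g, 'f::{real_normed_field, euclidean_space}) rca"
  assumes e: "0 < e"
  shows "\<exists>W. open W \<and> 0 \<in> W \<and> (\<forall>n t0. 0 \<le> n \<longrightarrow> meas_of n {t. t - t0 \<notin> W} = 0 \<longrightarrow>
    (norm m - e) * norm n \<le> norm (m \<star> of_real_rca n))"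
proof -
  let ?V = "variation_measure m"
  interpret V: finite_measure ?V by simp
  obtain P K where P: "finite (P :: 'g set set)" and K: "\<And>B. B \<in> P \<Longrightarrow> compact (K B)" "disjoint_family_on K P"
    and sum_K: "norm m - e / 2 \<le> (\<Sum>B\<in>P. norm (meas_of m (K B)))"
    using rca_compact_family[of "e / 2" m] e by auto
  have K_borel: "K B \<in> sets borel" if "B \<in> P" for B
    using K(1)[OF that] by (rule borel_compact)
  obtain D where D: "\<And>B. B \<in> P \<Longrightarrow> open (D B)" "\<And>B. B \<in> P \<Longrightarrow> K B \<subseteq> D B" "disjoint_family_on D P"
    using finite_compact_separation[OF P K] by blast
  have "\<exists>V. open V \<and> 0 \<in> V \<and> (\<forall>t\<in>V. \<forall>s\<in>K B. s + t \<in> D B)" if "B \<in> P" for B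
    using D(2)[OF that] by (intro open_translation_tube K(1) D(1) that) auto
  then obtain V where V: "\<And>B. B \<in> P \<Longrightarrow> open (V B)" "\<And>B. B \<in> P \<Longrightarrow> 0 \<in> V B"
    "\<And>B t s. B \<in> P \<Longrightarrow> t \<in> V B \<Longrightarrow> s \<in> K B \<Longrightarrow> s + t \<in> D B"
    by metis
  define W where "W = (\<Inter>B\<in>P. V B)"
  have W: "open W" "0 \<in> W"
    unfolding W_def using P V(1,2) by auto
  have "(norm m - e) * norm n \<le> norm (m \<star> of_real_rca n)"
    if n: "0 \<le> n" and n0: "meas_of n {t. t - t0 \<notin> W} = 0" for n t0
  proof -
    let ?N = "variation_measure n"
    interpret N: finite_measure ?N by simp
    define E where "E B = {x. x - t0 \<in> D B}" for B
    have E_open: "open (E B)" if "B \<in> P" for B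
    proof -
      have "open ((\<lambda>x. x - t0) -` D B)"
        using D(1)[OF that] by (intro open_vimage continuous_intros)
      then show ?thesis by (simp add: E_def vimage_def)
    qed
    have W_closed: "{t. t - t0 \<notin> W} \<in> sets borel"
    proof -
      have "closed ((\<lambda>x. x - t0) -` (- W))"
        using W(1) by (intro closed_vimage continuous_intros) (simp add: closed_Compl)
      then show ?thesis by (simp add: vimage_def)
    qed
    have AE_W: "AE t in ?N. t - t0 \<in> W"
    proof (rule AE_I[of _ _ "{t. t - t0 \<notin> W}"])
      show "emeasure ?N {t. t - t0 \<notin> W} = 0"
        using n0 by (simp add: N.emeasure_eq_measure measure_nonneg_rca[OF n])
    qed (use W_closed in auto)
    define S where "S B t = {s. s + t \<in> E B}" for B t
    have S_borel: "S B t \<in> sets borel" if "B \<in> P" for B t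
      unfolding S_def using E_open[OF that] by (intro borel_translate borel_open)
    have disj: "disjoint_family_on E P" "disjoint_family_on (\<lambda>B. S B t) P" for t
      using D(3) unfolding disjoint_family_on_def E_def S_def by blast+
    define g h where "g B t = meas_of m (S B t)" and "h B t = meas_of (abs_rca m) (S B t)" for B t
    have gh: "bdd_borel (g B)" "bdd_borel (h B)" if "B \<in> P" for B
      unfolding g_def[abs_def] h_def[abs_def] S_def
      using E_open[OF that] by (auto intro: bdd_borel_meas_of_translate borel_open)
    have int: "integrable ?N (g B)" "integrable ?N (h B)" if "B \<in> P" for B
      using gh[OF that] by (auto intro: bdd_borel_integrable)
    have lower: "norm n * norm (meas_of m (K B)) - (LINT t|?N. h B t - measure ?V (K B))
        \<le> norm (meas_of (m \<star> of_real_rca n) (E B))" if B: "B \<in> P" for B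
    proof -
      have "meas_of (m \<star> of_real_rca n) (E B) = (LINT t|?N. g B t)"
        using E_open[OF B] gh[OF B] rca_integral_of_real_rca[OF n gh(1)[OF B]]
        by (simp add: meas_of_convolution[OF lc] g_def[abs_def] S_def)
      then have "norm (norm n *\<^sub>R meas_of m (K B) - meas_of (m \<star> of_real_rca n) (E B))
          = norm (LINT t|?N. meas_of m (K B) - g B t)"
        using int[OF B] by (simp add: norm_rca_eq_measure[of n])
      also have "\<dots> \<le> (LINT t|?N. norm (meas_of m (K B) - g B t))"
        using int[OF B] by (intro integral_norm_bound)
      also have "\<dots> \<le> (LINT t|?N. h B t - measure ?V (K B))"
      proof (rule integral_mono_AE)
        show "AE t in ?N. norm (meas_of m (K B) - g B t) \<le> h B t - measure ?V (K B)"
          using AE_W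
        proof (rule AE_mp, intro AE_I2 impI)
          fix t assume "t - t0 \<in> W"
          then have "t - t0 \<in> V B" using B by (simp add: W_def)
          then have sub: "K B \<subseteq> S B t"
            using V(3)[OF B, of "t - t0"] by (auto simp: S_def E_def add_diff_eq)
          have "norm (meas_of m (K B) - g B t) = norm (meas_of m (S B t - K B))"
            using meas_of_diff[OF S_borel[OF B] K_borel[OF B] sub, of m] by (simp add: g_def norm_minus_commute)
          also have "\<dots> \<le> measure ?V (S B t - K B)"
            using S_borel[OF B] K_borel[OF B] by (intro norm_meas_of_le) auto
          also have "\<dots> = h B t - measure ?V (K B)"
            using S_borel[OF B] K_borel[OF B] sub unfolding h_def meas_of_abs_rca
            by (intro V.finite_measure_Diff) auto
          finally show "norm (meas_of m (K B) - g B t) \<le> h B t - measure ?V (K B)" .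
        qed
      qed (use int[OF B] in auto)
      finally show ?thesis
        using norm_triangle_ineq2[of "norm n *\<^sub>R meas_of m (K B)" "meas_of (m \<star> of_real_rca n) (E B)"]
        by simp
    qed
    \<comment> \<open>A single set \<open>S B t\<close> may exceed \<open>K B\<close> by a sizeable
      mass, but the sum of all excesses is controlled: the sets \<open>S B t\<close> are disjoint
      for fixed t, and the \<open>K B\<close> already carry all but e / 2 of |m|.\<close>
    have excess: "(\<Sum>B\<in>P. h B t - measure ?V (K B)) \<le> e / 2" for t
    proof -
      have "(\<Sum>B\<in>P. h B t) \<le> norm m"
        unfolding h_def meas_of_abs_rca
        using sum_measure_disjoint_le_norm[OF P disj(2)[of t] S_borel[of _ t], of m] by simp
      moreover have "(\<Sum>B\<in>P. norm (meas_of m (K B))) \<le> (\<Sum>B\<in>P. measure ?V (K B))"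
        by (intro sum_mono norm_meas_of_le K_borel)
      ultimately show ?thesis using sum_K by (simp add: sum_subtractf)
    qed
    have "(\<Sum>B\<in>P. LINT t|?N. h B t - measure ?V (K B)) = (LINT t|?N. (\<Sum>B\<in>P. h B t - measure ?V (K B)))"
      using int by (intro Bochner_Integration.integral_sum[symmetric]) auto
    also have "\<dots> \<le> (LINT t|?N. e / 2)"
      using int excess by (intro integral_mono Bochner_Integration.integrable_sum) auto
    also have "\<dots> = e / 2 * norm n"
      by (simp add: norm_rca_eq_measure)
    finally have excess': "(\<Sum>B\<in>P. LINT t|?N. h B t - measure ?V (K B)) \<le> e / 2 * norm n" .
    have "(norm m - e) * norm n = norm n * (norm m - e / 2) - e / 2 * norm n"
      by (simp add: algebra_simps)
    also have "\<dots> \<le> norm n * (\<Sum>B\<in>P. norm (meas_of m (K B))) - (\<Sum>B\<in>P. LINT t|?N. h B t - measure ?V (K B))"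
      using excess' sum_K by (intro diff_mono mult_left_mono) auto
    also have "\<dots> = (\<Sum>B\<in>P. norm n * norm (meas_of m (K B)) - (LINT t|?N. h B t - measure ?V (K B)))"
      by (simp add: sum_subtractf sum_distrib_left)
    also have "\<dots> \<le> (\<Sum>B\<in>P. norm (meas_of (m \<star> of_real_rca n) (E B)))"
      by (intro sum_mono lower)
    also have "\<dots> \<le> (\<Sum>B\<in>P. measure (variation_measure (m \<star> of_real_rca n)) (E B))"
      using E_open by (intro sum_mono norm_meas_of_le) auto
    also have "\<dots> \<le> norm (m \<star> of_real_rca n)"
      using E_open by (intro sum_measure_disjoint_le_norm[OF P disj(1)]) auto
    finally show ?thesis .
  qed
  then show ?thesis using W by blast
qed

lemma abs_rca_convolution_le_operator:
  fixes m :: "('g, 'f::{real_normed_field, euclidean_space}) rca" and R :: "('g, real) rca \<Rightarrow> ('g, real) rca"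
  assumes R: "linear R" and dom: "\<And>n. 0 \<le> n \<Longrightarrow> abs_rca (m \<star> of_real_rca n) \<le> R n"
    and n: "0 \<le> n"
  shows "abs_rca m \<star> n \<le> R n"
proof -
  have conv_le: "abs_rca (m \<star> of_real_rca n) \<le> abs_rca m \<star> n" if "0 \<le> n" for n :: "('g, real) rca"
    using abs_rca_convolution_le[OF lc, of m "of_real_rca n"] that
    by (simp add: abs_rca_of_real_rca abs_rca_of_nonneg)
  have meas_abs_UNIV: "meas_of (abs_rca k) UNIV = norm k" for k :: "('g, 'f) rca"
    by (simp add: meas_of_abs_rca norm_rca_eq_measure)
  \<comment> \<open>Here \<open>l\<close> is the sum of the measures |m \<star> n_i| over pieces n_i
    of \<open>n\<close>, each carried by one translate of \<open>W\<close>. The assumption on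
    \<open>T\<close> says that these translates carry all of \<open>n\<close>.\<close>
  have pieces: "\<exists>l. l \<le> R n \<and> l \<le> abs_rca m \<star> n \<and> (norm m - e) * norm n \<le> meas_of l UNIV"
    if W: "open W" and W_small: "\<And>n t0. 0 \<le> n \<Longrightarrow> meas_of n {t. t - t0 \<notin> W} = 0 \<Longrightarrow>
      (norm m - e) * norm n \<le> norm (m \<star> of_real_rca n)"
      and T: "finite T" and n: "0 \<le> n" and n0: "meas_of n {t. \<forall>t0\<in>T. t - t0 \<notin> W} = 0"
    for W e T and n :: "('g, real) rca"
    using T n n0
  proof (induction T arbitrary: n)
    case empty
    then have "norm n = 0" by (simp add: norm_nonneg_rca)
    then have "n = 0" by simp
    moreover have "abs_rca m \<star> 0 = 0"
      using convolution_add_right[OF lc, of "abs_rca m" 0 0] by simp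
    ultimately show ?case
      using linear_0[OF R] by (intro exI[of _ 0]) (simp add: zero_rca.rep_eq)
  next
    case (insert t0 T)
    \<comment> \<open>One translate of \<open>W\<close> is split off; the rest of \<open>n\<close>
      is carried by the remaining ones.\<close>
    define Q where "Q = {t. t - t0 \<in> W}"
    have translate: "{t. t - t1 \<notin> W} \<in> sets borel" for t1
    proof -
      have "closed ((\<lambda>x. x - t1) -` (- W))"
        using W by (intro closed_vimage continuous_intros) (simp add: closed_Compl)
      then show ?thesis by (simp add: vimage_def)
    qed
    have Q: "Q \<in> sets borel" "- Q \<in> sets borel"
    proof -
      show *: "- Q \<in> sets borel"
        using translate[of t0] by (simp add: Q_def Collect_neg_eq)
      have "Q = UNIV - (- Q)" by auto
      then show "Q \<in> sets borel" using * by (metis sets.Diff sets.top space_borel)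
    qed
    define n1 n2 where "n1 = restrict_rca Q n" and "n2 = restrict_rca (- Q) n"
    have n12: "0 \<le> n1" "0 \<le> n2" "n = n1 + n2"
      using insert.prems(1) Q by (auto simp: n1_def n2_def restrict_rca_nonneg restrict_rca_add_Compl)
    have "meas_of n1 {t. t - t0 \<notin> W} = 0"
    proof -
      have "{t. t - t0 \<notin> W} \<inter> Q = {}" by (auto simp: Q_def)
      then show ?thesis
        using Q(1) translate[of t0] by (simp add: n1_def meas_of_restrict_rca)
    qed
    from W_small[OF n12(1) this] have small: "(norm m - e) * norm n1 \<le> norm (m \<star> of_real_rca n1)" .
    have "meas_of n2 {t. \<forall>t0\<in>T. t - t0 \<notin> W} = 0"
    proof -
      have "{t. \<forall>t0\<in>T. t - t0 \<notin> W} = UNIV \<inter> (\<Inter>t0\<in>T. {t. t - t0 \<notin> W})" by auto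
      moreover have "UNIV \<inter> (\<Inter>t0\<in>T. {t. t - t0 \<notin> W}) \<in> sets borel"
        using insert.hyps(1) translate sets.finite_INT[of T "\<lambda>t0. {t. t - t0 \<notin> W}" borel]
        by (cases "T = {}") auto
      moreover have "{t. \<forall>t0\<in>T. t - t0 \<notin> W} \<inter> - Q = {t. \<forall>t0\<in>insert t0 T. t - t0 \<notin> W}"
        by (auto simp: Q_def)
      ultimately show ?thesis
        using Q(2) insert.prems(2) by (simp add: n2_def meas_of_restrict_rca)
    qed
    from insert.IH[OF n12(2) this] obtain l where l: "l \<le> R n2" "l \<le> abs_rca m \<star> n2"
      "(norm m - e) * norm n2 \<le> meas_of l UNIV" by blast
    have "abs_rca (m \<star> of_real_rca n1) + l \<le> R n"
      unfolding n12(3) linear_add[OF R] by (intro add_mono dom n12 l)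
    moreover have "abs_rca (m \<star> of_real_rca n1) + l \<le> abs_rca m \<star> n"
      unfolding n12(3) convolution_add_right[OF lc] by (intro add_mono conv_le n12 l)
    moreover have "norm n = norm n1 + norm n2"
      using n12 insert.prems(1) by (simp add: norm_nonneg_rca plus_rca.rep_eq)
    then have "(norm m - e) * norm n \<le> meas_of (abs_rca (m \<star> of_real_rca n1) + l) UNIV"
      using small l(3) by (simp add: plus_rca.rep_eq meas_abs_UNIV algebra_simps)
    ultimately show ?case by blast
  qed
  show ?thesis
    unfolding less_eq_rca_def
  proof
    fix A :: "'g set" assume A: "A \<in> sets borel"
    have gap: "meas_of (abs_rca m \<star> n) A \<le> meas_of (R n) A + e * (norm m + norm n)" if e: "0 < e" for e
    proof -
      obtain W where W: "open W" "0 \<in> W" "\<And>n t0. 0 \<le> n \<Longrightarrow> meas_of n {t. t - t0 \<notin> W} = 0 \<Longrightarrow>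
          (norm m - e) * norm n \<le> norm (m \<star> of_real_rca n)"
        using norm_convolution_small_support[OF e, of m] by blast
      \<comment> \<open>A compact set with all but e of the mass of \<open>n\<close> is covered by
        finitely many translates of \<open>W\<close>. The part of \<open>n\<close> off
        \<open>L\<close> is only estimated from below by 0.\<close>
      obtain L where L: "compact L" "norm n - e < meas_of n L"
        using nonneg_rca_inner_regular[OF n, of UNIV "norm n - e"] e norm_nonneg_rca[OF n] by auto
      have L_borel: "L \<in> sets borel" "- L \<in> sets borel"
        using L(1) by (auto intro: borel_compact simp: Compl_eq_Diff_UNIV)
      have "open ((\<lambda>t. t - t0) -` W)" for t0
        using W(1) by (intro open_vimage continuous_intros)
      moreover have "L \<subseteq> (\<Union>t0\<in>L. (\<lambda>t. t - t0) -` W)" using W(2) by auto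
      ultimately obtain T where T: "finite T" "L \<subseteq> (\<Union>t0\<in>T. (\<lambda>t. t - t0) -` W)"
        using compactE_image[OF L(1), of L "\<lambda>t0. (\<lambda>t. t - t0) -` W"] by metis
      define n1 n2 where "n1 = restrict_rca L n" and "n2 = restrict_rca (- L) n"
      have n12: "0 \<le> n1" "0 \<le> n2" "n = n1 + n2"
        using n L_borel by (auto simp: n1_def n2_def restrict_rca_nonneg restrict_rca_add_Compl)
      have n1_0: "meas_of n1 {t. \<forall>t0\<in>T. t - t0 \<notin> W} = 0"
      \<comment> \<open>Measures are 0 off the Borel sets, so the second case is immediate.\<close>
      proof (cases "{t. \<forall>t0\<in>T. t - t0 \<notin> W} \<in> sets borel")
        case True
        have "{t. \<forall>t0\<in>T. t - t0 \<notin> W} \<inter> L = {}" using T(2) by auto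
        then show ?thesis using True L_borel by (simp add: n1_def meas_of_restrict_rca)
      qed (rule meas_of_notin)
      obtain l where l: "l \<le> R n1" "l \<le> abs_rca m \<star> n1" "(norm m - e) * norm n1 \<le> meas_of l UNIV"
        using pieces[OF W(1) _ T(1) n12(1) n1_0, of e] W(3) by blast
      have "0 \<le> R n2"
        using dom[OF n12(2)] abs_rca_nonneg order_trans by blast
      then have l_R: "l \<le> R n"
        unfolding n12(3) linear_add[OF R] using l(1) by (rule add_increasing2)
      have "0 \<le> abs_rca m \<star> n2"
        by (intro convolution_nonneg[OF lc] abs_rca_nonneg n12)
      then have "l \<le> abs_rca m \<star> n"
        unfolding n12(3) convolution_add_right[OF lc] using l(2) by (rule add_increasing2)
      then have "0 \<le> abs_rca m \<star> n - l" by simp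
      \<comment> \<open>A positive measure is bounded at \<open>A\<close> by its total mass; this
        turns the comparison of masses into one of values.\<close>
      then have "meas_of (abs_rca m \<star> n - l) A \<le> meas_of (abs_rca m \<star> n - l) UNIV"
        by (rule nonneg_rca_mono) auto
      also have "\<dots> = norm m * norm n - meas_of l UNIV"
        by (simp add: minus_rca.rep_eq meas_of_convolution_UNIV[OF lc] meas_abs_UNIV norm_nonneg_rca[OF n])
      also have "\<dots> \<le> norm m * norm n - (norm m - e) * norm n1"
        using l(3) by simp
      also have "\<dots> = norm m * (norm n - norm n1) + e * norm n1"
        by (simp add: algebra_simps)
      also have "\<dots> \<le> norm m * e + e * norm n"
      proof (intro add_mono mult_left_mono)
        have "norm n1 = meas_of n L"
          using L_borel by (simp add: norm_nonneg_rca[OF n12(1)]) (simp add: n1_def meas_of_restrict_rca)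
        then show "norm n - norm n1 \<le> e" "norm n1 \<le> norm n"
          using L(2) nonneg_rca_mono[OF n, of UNIV L] by (auto simp: norm_nonneg_rca[OF n])
      qed (use e in auto)
      finally have "meas_of (abs_rca m \<star> n) A \<le> meas_of l A + e * (norm m + norm n)"
        by (simp add: minus_rca.rep_eq algebra_simps)
      also have "meas_of l A \<le> meas_of (R n) A"
        using l_R A by (simp add: less_eq_rca_def)
      finally show ?thesis by simp
    qed
    show "meas_of (abs_rca m \<star> n) A \<le> meas_of (R n) A"
    proof (rule field_le_epsilon)
      fix e :: real assume e: "0 < e"
      have pos: "0 < norm m + norm n + 1" by (meson add_nonneg_pos add_nonneg_nonneg norm_ge_zero zero_less_one)
      have "e / (norm m + norm n + 1) * (norm m + norm n) \<le> e"
        using e pos by (simp add: field_simps)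
      moreover have "meas_of (abs_rca m \<star> n) A
          \<le> meas_of (R n) A + e / (norm m + norm n + 1) * (norm m + norm n)"
        by (intro gap divide_pos_pos e pos)
      ultimately show "meas_of (abs_rca m \<star> n) A \<le> meas_of (R n) A + e"
        by linarith
    qed
  qed
qed

end

section \<open>Suprema of measures and of operators\<close>

text \<open>Antisymmetry is asked for on \<open>L\<close> alone because \<open>op_le\<close>
  compares values on the positive cone, which determines an operator only when it is linear.\<close>

lemma lub_on_eqI:
  assumes "u \<in> L" "\<And>s. s \<in> S \<Longrightarrow> le s u" "\<And>v. v \<in> L \<Longrightarrow> (\<And>s. s \<in> S \<Longrightarrow> le s v) \<Longrightarrow> le u v"
    and antisym: "\<And>u v. u \<in> L \<Longrightarrow> v \<in> L \<Longrightarrow> le u v \<Longrightarrow> le v u \<Longrightarrow> u = v"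
  shows "lub_on L le S = u"
  unfolding lub_on_def by (rule the_equality) (use assms in blast)+

lemma le_abs_rca: "m \<le> abs_rca m" for m :: "('g::t2_space, real) rca"
  unfolding less_eq_rca_def meas_of_abs_rca using norm_meas_of_le[of _ m] by (auto simp: abs_le_iff)

lemma abs_rca_minus: "abs_rca (- m) = abs_rca m"
  by (rule rca_eqI) (simp add: abs_rca.rep_eq uminus_rca.rep_eq variation_def)

lemma abs_rca_least_real:
  fixes m x :: "('g::t2_space, real) rca"
  assumes "m \<le> x" "- m \<le> x"
  shows "abs_rca m \<le> x"
  using assms by (intro abs_rca_leI) (auto simp: less_eq_rca_def uminus_rca.rep_eq abs_le_iff)

lemma lub_pm_eq_abs_rca: "lub {m, - m} = abs_rca m" for m :: "('g::t2_space, real) rca"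
  using le_abs_rca[of m] le_abs_rca[of "- m"]
  by (intro lub_on_eqI) (auto simp: abs_rca_minus intro: abs_rca_least_real)

lemma phase_le_abs_rca:
  "cos \<theta> *\<^sub>R Re_rca z + sin \<theta> *\<^sub>R Im_rca z \<le> abs_rca z"
  unfolding less_eq_rca_def
proof
  fix A :: "'a set" assume A: "A \<in> sets borel"
  have "cos \<theta> * Re (meas_of z A) + sin \<theta> * Im (meas_of z A) = Re (cis (- \<theta>) * meas_of z A)"
    by simp
  also have "\<dots> \<le> norm (meas_of z A)"
    using complex_Re_le_cmod[of "cis (- \<theta>) * meas_of z A"] by (simp only: norm_mult norm_cis mult_1)
  also have "\<dots> \<le> meas_of (abs_rca z) A"
    unfolding meas_of_abs_rca by (rule norm_meas_of_le[OF A])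
  finally show "meas_of (cos \<theta> *\<^sub>R Re_rca z + sin \<theta> *\<^sub>R Im_rca z) A \<le> meas_of (abs_rca z) A"
    by (simp add: plus_rca.rep_eq scaleR_rca.rep_eq Re_rca.rep_eq Im_rca.rep_eq)
qed

lemma cmod_eq_phase: "\<exists>\<theta>. 0 \<le> \<theta> \<and> \<theta> \<le> 2 * pi \<and> cmod w = cos \<theta> * Re w + sin \<theta> * Im w"
proof (cases "w = 0")
  case True
  then show ?thesis by (intro exI[of _ 0]) auto
next
  case False
  then have "(Re w / cmod w)\<^sup>2 + (Im w / cmod w)\<^sup>2 = 1"
    by (simp add: power_divide cmod_power2 complex_eq_iff flip: add_divide_distrib)
  then obtain \<theta> where \<theta>: "0 \<le> \<theta>" "\<theta> < 2 * pi" "Re w / cmod w = cos \<theta>" "Im w / cmod w = sin \<theta>"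
    using sincos_total_2pi by metis
  have "cos \<theta> * Re w + sin \<theta> * Im w = ((Re w)\<^sup>2 + (Im w)\<^sup>2) / cmod w"
    by (simp add: power2_eq_square add_divide_distrib flip: \<theta>(3,4))
  also have "\<dots> = cmod w"
    unfolding cmod_power2[symmetric] by (simp add: power2_eq_square)
  finally show ?thesis using \<theta> by (intro exI[of _ \<theta>]) auto
qed

text \<open>The phase that attains the modulus of z(A) depends on \<open>A\<close>. An upper bound
  dominates every phase at every Borel set, so it may be chosen set by set.\<close>

lemma abs_rca_least_complex:
  assumes "\<And>\<theta>. 0 \<le> \<theta> \<Longrightarrow> \<theta> \<le> 2 * pi \<Longrightarrow> cos \<theta> *\<^sub>R Re_rca z + sin \<theta> *\<^sub>R Im_rca z \<le> x"
  shows "abs_rca z \<le> x"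
proof (rule abs_rca_leI)
  fix A :: "'a set" assume A: "A \<in> sets borel"
  obtain \<theta> where "0 \<le> \<theta>" "\<theta> \<le> 2 * pi"
    "norm (meas_of z A) = cos \<theta> * Re (meas_of z A) + sin \<theta> * Im (meas_of z A)"
    using cmod_eq_phase by blast
  with assms[of \<theta>] A show "norm (meas_of z A) \<le> meas_of x A"
    by (simp add: less_eq_rca_def plus_rca.rep_eq scaleR_rca.rep_eq Re_rca.rep_eq Im_rca.rep_eq)
qed

lemma complex_rca_eq_of_real_rca: "complex_rca = of_real_rca"
  by (intro ext rca_eqI) (simp add: complex_rca.rep_eq of_real_rca.rep_eq)

lemma complex_modulus_eq_abs_rca: "complex_modulus z = complex_rca (abs_rca z)"
proof -
  have "lub {cos \<theta> *\<^sub>R Re_rca z + sin \<theta> *\<^sub>R Im_rca z | \<theta>. 0 \<le> \<theta> \<and> \<theta> \<le> 2 * pi} = abs_rca z"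
    by (rule lub_on_eqI) (auto intro: phase_le_abs_rca abs_rca_least_complex)
  then show ?thesis by (simp add: complex_modulus_def)
qed

section \<open>The order on regular operators\<close>

lemma linear_regular_ops: "T \<in> regular_ops \<Longrightarrow> linear T"
  by (auto simp: regular_ops_def positive_op_def intro: linear_compose_sub)

text \<open>The positive cone spans: every x is the difference of the positive measures |x| and |x|
  - x.\<close>

lemma op_le_antisym:
  fixes S T :: "('g::t2_space, real) rca \<Rightarrow> ('g, real) rca"
  assumes "S \<in> regular_ops" "T \<in> regular_ops" "op_le S T" "op_le T S"
  shows "S = T"
proof
  fix x :: "('g, real) rca"
  have eq: "S y = T y" if "0 \<le> y" for y
    using assms(3,4) that by (auto simp: op_le_def intro: antisym)
  have "S (abs_rca x - (abs_rca x - x)) = T (abs_rca x - (abs_rca x - x))"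
    using linear_regular_ops[OF assms(1)] linear_regular_ops[OF assms(2)]
      eq[OF abs_rca_nonneg, of x] eq[of "abs_rca x - x"] le_abs_rca[of x]
    by (simp only: linear_diff) simp
  then show "S x = T x" by simp
qed

section \<open>The left regular representation\<close>

text \<open>An isometric homomorphism preserves distances. The full carrier ensures that differences
  formed in \<open>A\<close> stay in the domain of \<pi>.\<close>

lemma nrm_continuous_isometric:
  assumes "algebra_hom A B \<pi>" "isometric A B \<pi>" "carr A = UNIV"
  shows "nrm_continuous A B \<pi>"
proof -
  have "nrm_dist B (\<pi> y) (\<pi> x) = nrm_dist A y x" for x y
  proof -
    have "\<pi> (add A y (scale A (- 1) x)) = add B (\<pi> y) (scale B (- 1) (\<pi> x))"
      using assms(1,3) by (simp add: algebra_hom_def)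
    then show ?thesis
      using assms(2,3) by (metis UNIV_I isometric_def nrm_dist_def)
  qed
  then show ?thesis unfolding nrm_continuous_def by auto
qed

context
  assumes lc: "locally_compact_space (euclidean :: 'g::{topological_group_add, t2_space} topology)"
begin

section \<open>Norm bound, linearity and regularity of left convolution\<close>

lemma norm_convolution_le:
  fixes m n :: "('g, 'f::{real_normed_field, euclidean_space}) rca"
  shows "norm (m \<star> n) \<le> norm m * norm n"
proof -
  have "meas_of (abs_rca (m \<star> n)) UNIV \<le> meas_of (abs_rca m \<star> abs_rca n) UNIV"
    using abs_rca_convolution_le[OF lc, of m n] by (simp add: less_eq_rca_def)
  then show ?thesis
    by (simp add: meas_of_convolution_UNIV[OF lc] meas_of_abs_rca norm_rca_eq_measure)
qed

lemma scale_rca_real: "scale_rca c m = c *\<^sub>R m" for m :: "('g, real) rca"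
  by (rule rca_eqI) (simp add: scale_rca.rep_eq scaleR_rca.rep_eq)

lemma linear_left_regular: "linear (left_regular m)" for m :: "('g, real) rca"
  unfolding left_regular_def
  by (rule linearI) (simp_all add: convolution_add_right[OF lc] convolution_scale_right[OF lc] flip: scale_rca_real)

lemma left_regular_add:
  fixes m n :: "('g, 'f::{real_normed_field, euclidean_space}) rca"
  shows "left_regular (m + n) x = left_regular m x + left_regular n x"
  by (simp add: left_regular_def convolution_add_left[OF lc])

lemma left_regular_diff:
  fixes m n :: "('g, 'f::{real_normed_field, euclidean_space}) rca"
  shows "left_regular (m - n) x = left_regular m x - left_regular n x"
  using left_regular_add[of "m - n" n x] by simp

lemma positive_op_left_regular: "0 \<le> m \<Longrightarrow> positive_op (left_regular m)" for m :: "('g, real) rca"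
  unfolding positive_op_def using linear_left_regular convolution_nonneg[OF lc] by (simp add: left_regular_def)

lemma left_regular_regular: "left_regular m \<in> regular_ops" for m :: "('g, real) rca"
proof -
  have "left_regular m = (\<lambda>x. left_regular (abs_rca m) x - left_regular (abs_rca m - m) x)"
    by (simp add: fun_eq_iff flip: left_regular_diff)
  moreover have "positive_op (left_regular (abs_rca m))" "positive_op (left_regular (abs_rca m - m))"
    using le_abs_rca[of m] by (auto intro: positive_op_left_regular abs_rca_nonneg)
  ultimately show ?thesis unfolding regular_ops_def by blast
qed

text \<open>Treats both moduli at once, with \<open>S\<close> consisting of \<plusminus> the
  operator or of its rotated real parts. On positive x the hypotheses make |m \<star> x| the
  supremum of the values T x. A supremum of operators can be larger than that;
  \<open>abs_rca_convolution_le_operator\<close> identifies it as |m| \<star> x.\<close>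

lemma op_lub_eq_left_regular_abs:
  fixes m :: "('g, 'f::{real_normed_field, euclidean_space}) rca"
  assumes upper: "\<And>T x. T \<in> S \<Longrightarrow> 0 \<le> x \<Longrightarrow> T x \<le> abs_rca (m \<star> of_real_rca x)"
    and least: "\<And>x y. (\<And>T. T \<in> S \<Longrightarrow> T x \<le> y) \<Longrightarrow> abs_rca (m \<star> of_real_rca x) \<le> y"
  shows "op_lub S = left_regular (abs_rca m)"
proof (rule lub_on_eqI)
  show "left_regular (abs_rca m) \<in> regular_ops"
    by (rule left_regular_regular)
  show "op_le T (left_regular (abs_rca m))" if "T \<in> S" for T
    unfolding op_le_def
  proof (intro allI impI)
    fix x :: "('g, real) rca" assume x: "0 \<le> x"
    have "abs_rca (m \<star> of_real_rca x) \<le> abs_rca m \<star> x"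
      using abs_rca_convolution_le[OF lc, of m "of_real_rca x"] x
      by (simp add: abs_rca_of_real_rca abs_rca_of_nonneg)
    then show "T x \<le> left_regular (abs_rca m) x"
      using upper[OF that x] by (simp add: left_regular_def)
  qed
  show "op_le (left_regular (abs_rca m)) R" if R: "R \<in> regular_ops" "\<And>T. T \<in> S \<Longrightarrow> op_le T R" for R
    unfolding op_le_def left_regular_def
  proof (intro allI impI)
    fix x :: "('g, real) rca" assume x: "0 \<le> x"
    show "abs_rca m \<star> x \<le> R x"
    proof (rule abs_rca_convolution_le_operator[OF lc linear_regular_ops[OF R(1)] _ x])
      fix n :: "('g, real) rca" assume "0 \<le> n"
      then show "abs_rca (m \<star> of_real_rca n) \<le> R n"
        using R(2) by (intro least) (simp add: op_le_def)
    qed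
  qed
qed (rule op_le_antisym)

lemma op_modulus_left_regular: "op_modulus (left_regular m) = left_regular (abs_rca m)"
  for m :: "('g, real) rca"
  unfolding op_modulus_def
proof (rule op_lub_eq_left_regular_abs)
  fix T and x :: "('g, real) rca"
  assume "T \<in> {left_regular m, \<lambda>x. - left_regular m x}"
  then show "T x \<le> abs_rca (m \<star> of_real_rca x)"
    using le_abs_rca[of "m \<star> x"] le_abs_rca[of "- (m \<star> x)"]
    by (auto simp: left_regular_def abs_rca_minus)
next
  fix x y :: "('g, real) rca"
  assume "\<And>T. T \<in> {left_regular m, \<lambda>x. - left_regular m x} \<Longrightarrow> T x \<le> y"
  from this[of "left_regular m"] this[of "\<lambda>x. - left_regular m x"]
  show "abs_rca (m \<star> of_real_rca x) \<le> y"
    by (intro abs_rca_least_real) (simp_all add: left_regular_def)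
qed

lemma complex_op_real_modulus_left_regular:
  "complex_op_real_modulus (left_regular z) = left_regular (abs_rca z)" for z :: "('g, complex) rca"
  unfolding complex_op_real_modulus_def
proof (rule op_lub_eq_left_regular_abs)
  let ?T = "\<lambda>\<theta> x. cos \<theta> *\<^sub>R Re_op (left_regular z) x + sin \<theta> *\<^sub>R Im_op (left_regular z) x"
  have T: "?T \<theta> x = cos \<theta> *\<^sub>R Re_rca (z \<star> of_real_rca x) + sin \<theta> *\<^sub>R Im_rca (z \<star> of_real_rca x)" for \<theta> x
    by (simp add: Re_op_def Im_op_def left_regular_def complex_rca_eq_of_real_rca)
  fix x :: "('g, real) rca"
  show "T x \<le> abs_rca (z \<star> of_real_rca x)" if "T \<in> {?T \<theta> | \<theta>. 0 \<le> \<theta> \<and> \<theta> \<le> 2 * pi}" for T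
    using that by (auto simp: T phase_le_abs_rca)
  show "abs_rca (z \<star> of_real_rca x) \<le> y"
    if le: "\<And>T. T \<in> {?T \<theta> | \<theta>. 0 \<le> \<theta> \<and> \<theta> \<le> 2 * pi} \<Longrightarrow> T x \<le> y" for y
  proof (rule abs_rca_least_complex)
    fix \<theta> :: real assume "0 \<le> \<theta>" "\<theta> \<le> 2 * pi"
    then have "?T \<theta> x \<le> y" by (intro le) blast
    then show "cos \<theta> *\<^sub>R Re_rca (z \<star> of_real_rca x) + sin \<theta> *\<^sub>R Im_rca (z \<star> of_real_rca x) \<le> y"
      unfolding T .
  qed
qed

lemma onorm_left_regular:
  fixes m :: "('g, real) rca"
  assumes m: "0 \<le> m"
  shows "onorm (left_regular m) = norm m"
proof (rule antisym)
  show "onorm (left_regular m) \<le> norm m"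
    by (rule onorm_bound) (simp_all add: left_regular_def norm_convolution_le)
  have bl: "bounded_linear (left_regular m)"
    using linear_left_regular[of m] norm_convolution_le[of m]
    by (intro bounded_linear_intro[of _ "norm m"])
      (auto simp: linear_add linear_scale left_regular_def mult.commute)
  show "norm m \<le> onorm (left_regular m)"
  proof (cases "m = 0")
    case True
    then show ?thesis using onorm_pos_le[OF bl] by simp
  next
    case False
    have "norm (left_regular m m) = norm m * norm m"
      using convolution_nonneg[OF lc m m]
      by (simp add: left_regular_def norm_nonneg_rca m meas_of_convolution_UNIV[OF lc])
    then show ?thesis
      using le_onorm[OF bl, of m] False by simp
  qed
qed

lemma regular_norm_left_regular: "regular_norm (left_regular m) = norm m" for m :: "('g, real) rca"
  unfolding regular_norm_def op_modulus_left_regular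
  by (simp add: onorm_left_regular abs_rca_nonneg norm_abs_rca)

text \<open>Exhibits the two real regular operators that membership in
  \<open>complex_regular_ops\<close> asks for.\<close>

lemma left_regular_Complex_op:
  fixes z :: "('g, complex) rca"
  shows "left_regular z = Complex_op (left_regular (Re_rca z)) (left_regular (Im_rca z))"
proof
  fix w :: "('g, complex) rca"
  have z: "z = complex_rca (Re_rca z) + scale_rca \<i> (complex_rca (Im_rca z))" for z :: "('g, complex) rca"
    using Complex_rca_iff[of z "Re_rca z" "Im_rca z"] by (simp add: Complex_rca_def)
  have conv: "complex_rca x \<star> complex_rca y = complex_rca (x \<star> y)" for x y :: "('g, real) rca"
    by (simp add: complex_rca_eq_of_real_rca convolution_of_real_rca[OF lc])
  have "z \<star> w = (complex_rca (Re_rca z) + scale_rca \<i> (complex_rca (Im_rca z)))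
      \<star> (complex_rca (Re_rca w) + scale_rca \<i> (complex_rca (Im_rca w)))"
    using z[of z] z[of w] by simp
  also have "\<dots> = Complex_rca (Re_rca z \<star> Re_rca w - Im_rca z \<star> Im_rca w)
      (Re_rca z \<star> Im_rca w + Im_rca z \<star> Re_rca w)"
    unfolding convolution_add_left[OF lc] convolution_add_right[OF lc]
      convolution_scale_left[OF lc] convolution_scale_right[OF lc] conv Complex_rca_def
    by (rule rca_eqI)
      (simp add: plus_rca.rep_eq minus_rca.rep_eq scale_rca.rep_eq complex_rca.rep_eq algebra_simps)
  finally show "left_regular z w = Complex_op (left_regular (Re_rca z)) (left_regular (Im_rca z)) w"
    by (simp add: left_regular_def Complex_op_def)
qed

text \<open>The modulus of a complex measure is a real measure embedded by
  \<open>complex_rca\<close>, that of an operator a \<open>Complex_op\<close> with zero imaginary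
  part; this matches the two encodings.\<close>

lemma left_regular_complex_rca: "left_regular (complex_rca x) = Complex_op (left_regular x) (\<lambda>_. 0)"
  for x :: "('g, real) rca"
proof -
  have "Re_rca (complex_rca x) = x" "Im_rca (complex_rca x) = 0"
    by (transfer; simp)+
  moreover have "left_regular (0 :: ('g, real) rca) = (\<lambda>_. 0)"
    using left_regular_diff[of "0 :: ('g, real) rca" 0] by auto
  ultimately show ?thesis
    using left_regular_Complex_op[of "complex_rca x"] by simp
qed

section \<open>Homomorphism and isometry properties for both scalar fields\<close>

lemma algebra_hom_left_regular_real:
  "algebra_hom real_measure_algebra real_operator_algebra (left_regular :: ('g, real) rca \<Rightarrow> _)"
  unfolding algebra_hom_def real_measure_algebra_def real_operator_algebra_def
  by (auto simp: fun_eq_iff left_regular_def convolution_add_left[OF lc]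
      convolution_scale_left[OF lc] convolution_assoc[OF lc] intro: left_regular_regular[unfolded left_regular_def])

lemma isometric_left_regular_real:
  "isometric real_measure_algebra real_operator_algebra (left_regular :: ('g, real) rca \<Rightarrow> _)"
  unfolding isometric_def real_measure_algebra_def real_operator_algebra_def
  by (simp add: regular_norm_left_regular)

lemma algebra_hom_left_regular_complex:
  "algebra_hom complex_measure_algebra complex_operator_algebra (left_regular :: ('g, complex) rca \<Rightarrow> _)"
proof -
  have "left_regular z \<in> complex_regular_ops" for z :: "('g, complex) rca"
    unfolding complex_regular_ops_def using left_regular_Complex_op left_regular_regular by blast
  then show ?thesis
    unfolding algebra_hom_def complex_measure_algebra_def complex_operator_algebra_def
    by (auto simp: fun_eq_iff left_regular_def convolution_add_left[OF lc]
        convolution_scale_left[OF lc] convolution_assoc[OF lc])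
qed

lemma isometric_left_regular_complex:
  "isometric complex_measure_algebra complex_operator_algebra (left_regular :: ('g, complex) rca \<Rightarrow> _)"
  unfolding isometric_def complex_measure_algebra_def complex_operator_algebra_def
  by (simp add: complex_op_real_modulus_left_regular regular_norm_left_regular norm_abs_rca)

end

theorem theorem11p1:
  assumes "locally_compact_space (euclidean :: 'g::{topological_group_add, t2_space} topology)"
  shows "lattice_algebra_hom real_measure_algebra real_operator_algebra
           (left_regular :: ('g, real) rca \<Rightarrow> _)
       \<and> isometric real_measure_algebra real_operator_algebra
           (left_regular :: ('g, real) rca \<Rightarrow> _)
       \<and> lattice_algebra_hom complex_measure_algebra complex_operator_algebra
           (left_regular :: ('g, complex) rca \<Rightarrow> _)
       \<and> isometric complex_measure_algebra complex_operator_algebra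
           (left_regular :: ('g, complex) rca \<Rightarrow> _)"
proof (intro conjI)
  note hom = algebra_hom_left_regular_real[OF assms] algebra_hom_left_regular_complex[OF assms]
  note iso = isometric_left_regular_real[OF assms] isometric_left_regular_complex[OF assms]
  show "isometric real_measure_algebra real_operator_algebra (left_regular :: ('g, real) rca \<Rightarrow> _)"
    and "isometric complex_measure_algebra complex_operator_algebra (left_regular :: ('g, complex) rca \<Rightarrow> _)"
    by (rule iso)+
  show "lattice_algebra_hom real_measure_algebra real_operator_algebra (left_regular :: ('g, real) rca \<Rightarrow> _)"
    unfolding lattice_algebra_hom_def
  proof (intro conjI hom nrm_continuous_isometric iso)
    show "\<forall>m\<in>carr real_measure_algebra. modulus real_operator_algebra (left_regular (m :: ('g, real) rca))
        = left_regular (modulus real_measure_algebra m)"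
      by (simp add: real_measure_algebra_def real_operator_algebra_def op_modulus_left_regular[OF assms]
          lub_pm_eq_abs_rca)
  qed (simp add: real_measure_algebra_def)
  show "lattice_algebra_hom complex_measure_algebra complex_operator_algebra
      (left_regular :: ('g, complex) rca \<Rightarrow> _)"
    unfolding lattice_algebra_hom_def
  proof (intro conjI hom nrm_continuous_isometric iso)
    show "\<forall>z\<in>carr complex_measure_algebra. modulus complex_operator_algebra (left_regular (z :: ('g, complex) rca))
        = left_regular (modulus complex_measure_algebra z)"
      by (simp add: complex_measure_algebra_def complex_operator_algebra_def complex_modulus_eq_abs_rca
          complex_op_real_modulus_left_regular[OF assms] left_regular_complex_rca[OF assms])
  qed (simp add: complex_measure_algebra_def)
qed

end
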